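(* For every $n\geq0$, \[ \beta_n<(2n+1)+2\Theta_0+\sqrt{4\Theta_0(2n+1)+4\Theta_0^2+1}, \] and, for $n\geq1$, \[ \beta_n>(2n+1)+2\eta_0^*+\sqrt{4\eta_0^*(2n+1)+4(\eta_0^* )^2+1}, \] where $\eta_0^*=\lambda(\beta_0)/\beta_0$.
   Context: Let $\mathbb{D}$ be the open unit disk in $\mathbb{R}^2$ and $\mathbf{A}(x_1,x_2)=\frac12(-x_2,x_1)$. For $b\geq0$ let $H_b$ be the self-adjoint operator in $L^2(\mathbb{D})$ associated with the closed quadratic form $q_b[u]=\int_{\mathbb{D}}|(-i\nabla+b\mathbf{A})u|^2\,d\mathbf{x}$, $u\in H^1(\mathbb{D})$ (magnetic Neumann Laplacian), and let $\lambda(b)=\inf\operatorname{spec}H_b$. For an integer $n\ge0$, let $\lambda_n(b)$ be the lowest eigenvalue of the self-adjoint operator $H_{n,b}=-\frac{d^2}{dr^2}-\frac1r\frac{d}{dr}+\left(\frac nr-\frac b2r\right)^2$ in $L^2((0,1),r\,dr)$ with Neumann condition $f'(1)=0$, i.e. the operator associated with the quadratic form $q_{n,b}[f]=\int_0^1\bigl[|f'(r)|^2+(\frac nr-\frac b2r)^2|f(r)|^2\bigr]r\,dr$, whose domain consists of those $f\in L^2((0,1),r\,dr)$ for which the right-hand side is finite. Then $\lambda(b)=\min_{n\ge0}\lambda_n(b)$ for $b\ge0$. Definition of $\beta_n$ (a known result of Helffer and Léna): there is a strictly increasing sequence $(\beta_n)_{n\geq0}$, with $\beta_n>2(n+1)$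 for every $n$, such that the branches $\lambda_n$ and $\lambda_{n+1}$ meet exactly once on $(0,+\infty)$, at $b=\beta_n$; moreover $\lambda(b)=\lambda_0(b)$ for $0\leq b\leq\beta_0$, and $\lambda(b)=\lambda_n(b)$ for $\beta_{n-1}\leq b\leq\beta_n$, $n\geq1$. The de Gennes constant is $\Theta_0=\inf_{\xi\in\mathbb{R}}\mu(\xi)$, where $\mu(\xi)$ denotes the lowest eigenvalue of $-\frac{d^2}{dt^2}+(t-\xi)^2$ in $L^2(\mathbb{R}_+)$, $\mathbb{R}_+=(0,+\infty)$, with a Neumann condition at the origin. *)

theory Defs
  imports "HOL-Analysis.Analysis"
begin

section \<open>Weak derivatives\<close>

primrec Ck :: "nat \<Rightarrow> ('a::euclidean_space \<Rightarrow> real) \<Rightarrow> bool" where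
  "Ck 0 f \<longleftrightarrow> continuous_on UNIV f"
| "Ck (Suc k) f \<longleftrightarrow> (\<forall>x. f differentiable (at x)) \<and>
     (\<forall>v. Ck k (\<lambda>x. frechet_derivative f (at x) v))"

definition test_function :: "'a::euclidean_space set \<Rightarrow> ('a \<Rightarrow> real) \<Rightarrow> bool" where
  "test_function S \<phi> \<longleftrightarrow> (\<forall>k. Ck k \<phi>) \<and>
     (\<exists>K. compact K \<and> K \<subseteq> S \<and> (\<forall>x. x \<notin> K \<longrightarrow> \<phi> x = 0))"

definition locally_integrable :: "'a::euclidean_space set \<Rightarrow> ('a \<Rightarrow> complex) \<Rightarrow> bool" where
  "locally_integrable S u \<longleftrightarrow> (\<forall>K. compact K \<and> K \<subseteq> S \<longrightarrow> u absolutely_integrable_on K)"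

text \<open>On the open set \<open>S\<close>, \<open>g\<close> is the distributional derivative of \<open>u\<close> in the direction \<open>e\<close>.\<close>

definition has_weak_deriv ::
    "'a::euclidean_space set \<Rightarrow> 'a \<Rightarrow> ('a \<Rightarrow> complex) \<Rightarrow> ('a \<Rightarrow> complex) \<Rightarrow> bool" where
  "has_weak_deriv S e u g \<longleftrightarrow> locally_integrable S u \<and> locally_integrable S g \<and>
     (\<forall>\<phi>. test_function S \<phi> \<longrightarrow>
        (LINT x|lebesgue_on S. u x * complex_of_real (frechet_derivative \<phi> (at x) e))
          = - (LINT x|lebesgue_on S. g x * complex_of_real (\<phi> x)))"

text \<open>Weak derivatives are unique up to null sets, so the choice below is immaterial
  under integrals.\<close>

definition weak_deriv :: "'a::euclidean_space set \<Rightarrow> 'a \<Rightarrow> ('a \<Rightarrow> complex) \<Rightarrow> 'a \<Rightarrow> complex" where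
  "weak_deriv S e u = (SOME g. has_weak_deriv S e u g)"

section \<open>Operators associated with forms on \<open>L\<^sup>2\<close>\<close>

text \<open>Elements of \<open>L\<^sup>2(M)\<close> are represented by functions; two functions that agree almost
  everywhere represent the same element.\<close>

definition L2 :: "'a measure \<Rightarrow> ('a \<Rightarrow> complex) set" where
  "L2 M = {f \<in> borel_measurable M. integrable M (\<lambda>x. (cmod (f x))\<^sup>2)}"

definition L2_inner :: "'a measure \<Rightarrow> ('a \<Rightarrow> complex) \<Rightarrow> ('a \<Rightarrow> complex) \<Rightarrow> complex" where
  "L2_inner M f g = (LINT x|M. f x * cnj (g x))"

definition L2_norm :: "'a measure \<Rightarrow> ('a \<Rightarrow> complex) \<Rightarrow> real" where
  "L2_norm M f = sqrt (LINT x|M. (cmod (f x))\<^sup>2)"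

text \<open>The operator \<open>H\<close> associated with a closed sesquilinear form \<open>q\<close> with form domain \<open>Q\<close>
  (Kato's first representation theorem), given by its graph: \<open>form_operator M Q q u w\<close> says
  that \<open>u\<close> lies in the operator domain and that \<open>H u = w\<close>. The relation is invariant under
  changing \<open>w\<close> on a null set, so \<open>H u = z u\<close> is \<open>form_operator M Q q u (\<lambda>x. z * u x)\<close>.\<close>

definition form_operator ::
    "'a measure \<Rightarrow> ('a \<Rightarrow> complex) set \<Rightarrow> (('a \<Rightarrow> complex) \<Rightarrow> ('a \<Rightarrow> complex) \<Rightarrow> complex)
      \<Rightarrow> ('a \<Rightarrow> complex) \<Rightarrow> ('a \<Rightarrow> complex) \<Rightarrow> bool" where
  "form_operator M Q q u w \<longleftrightarrow> u \<in> Q \<and> w \<in> L2 M \<and> (\<forall>v\<in>Q. q u v = L2_inner M w v)"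

text \<open>\<open>H - z\<close> is onto \<open>L\<^sup>2(M)\<close>, and the estimate says that it is injective with bounded inverse.\<close>

definition in_resolvent_set ::
    "'a measure \<Rightarrow> (('a \<Rightarrow> complex) \<Rightarrow> ('a \<Rightarrow> complex) \<Rightarrow> bool) \<Rightarrow> complex \<Rightarrow> bool" where
  "in_resolvent_set M H z \<longleftrightarrow>
     (\<forall>f\<in>L2 M. \<exists>u w. H u w \<and> (AE x in M. w x - z * u x = f x)) \<and>
     (\<exists>C. \<forall>u w. H u w \<longrightarrow> L2_norm M u \<le> C * L2_norm M (\<lambda>x. w x - z * u x))"

definition spectrum_of ::
    "'a measure \<Rightarrow> (('a \<Rightarrow> complex) \<Rightarrow> ('a \<Rightarrow> complex) \<Rightarrow> bool) \<Rightarrow> complex set" where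
  "spectrum_of M H = {z. \<not> in_resolvent_set M H z}"

definition is_eigenvalue ::
    "'a measure \<Rightarrow> (('a \<Rightarrow> complex) \<Rightarrow> ('a \<Rightarrow> complex) \<Rightarrow> bool) \<Rightarrow> complex \<Rightarrow> bool" where
  "is_eigenvalue M H z \<longleftrightarrow> (\<exists>u. H u (\<lambda>x. z * u x) \<and> \<not> (AE x in M. u x = 0))"

text \<open>For self-adjoint \<open>H\<close> the spectrum is real.\<close>

definition inf_spec ::
    "'a measure \<Rightarrow> (('a \<Rightarrow> complex) \<Rightarrow> ('a \<Rightarrow> complex) \<Rightarrow> bool) \<Rightarrow> real" where
  "inf_spec M H = Inf {x. complex_of_real x \<in> spectrum_of M H}"

definition lowest_eigenvalue ::
    "'a measure \<Rightarrow> (('a \<Rightarrow> complex) \<Rightarrow> ('a \<Rightarrow> complex) \<Rightarrow> bool) \<Rightarrow> real" where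
  "lowest_eigenvalue M H = (LEAST x. is_eigenvalue M H (complex_of_real x))"

section \<open>The magnetic Neumann Laplacian on the unit disc\<close>

abbreviation disc :: "(real^2) set" where
  "disc \<equiv> ball 0 1"

definition mag_potential :: "real^2 \<Rightarrow> real^2" where
  "mag_potential x = (1/2) *\<^sub>R vector [- (x $ 2), x $ 1]"

definition H1 :: "'a::euclidean_space set \<Rightarrow> ('a \<Rightarrow> complex) set" where
  "H1 S = {u \<in> L2 (lebesgue_on S). \<forall>e\<in>Basis. \<exists>g\<in>L2 (lebesgue_on S). has_weak_deriv S e u g}"

text \<open>The \<open>j\<close>-th component of \<open>(-i\<nabla> + b A) u\<close>.\<close>

definition mag_gradient :: "real \<Rightarrow> (real^2 \<Rightarrow> complex) \<Rightarrow> 2 \<Rightarrow> real^2 \<Rightarrow> complex" where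
  "mag_gradient b u j x =
     - \<i> * weak_deriv disc (axis j 1) u x + complex_of_real (b * mag_potential x $ j) * u x"

definition mag_form :: "real \<Rightarrow> (real^2 \<Rightarrow> complex) \<Rightarrow> (real^2 \<Rightarrow> complex) \<Rightarrow> complex" where
  "mag_form b u v =
     (LINT x|lebesgue_on disc. (\<Sum>j\<in>UNIV. mag_gradient b u j x * cnj (mag_gradient b v j x)))"

definition disc_lambda :: "real \<Rightarrow> real" where
  "disc_lambda b =
     inf_spec (lebesgue_on disc) (form_operator (lebesgue_on disc) (H1 disc) (mag_form b))"

section \<open>One-dimensional Neumann operators\<close>

text \<open>On the open interval \<open>S\<close> with measure \<open>M\<close>, the form \<open>\<integral> (\<bar>f'\<bar>\<^sup>2 + p\<^sup>2 \<bar>f\<bar>\<^sup>2) dM\<close> with its maximal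
  domain. Neumann conditions are the natural boundary conditions of the associated operator.\<close>

definition neumann_domain :: "real set \<Rightarrow> real measure \<Rightarrow> (real \<Rightarrow> real) \<Rightarrow> (real \<Rightarrow> complex) set" where
  "neumann_domain S M p =
     {f \<in> L2 M. (\<exists>g\<in>L2 M. has_weak_deriv S 1 f g) \<and> (\<lambda>r. complex_of_real (p r) * f r) \<in> L2 M}"

definition neumann_form ::
    "real set \<Rightarrow> real measure \<Rightarrow> (real \<Rightarrow> real) \<Rightarrow> (real \<Rightarrow> complex) \<Rightarrow> (real \<Rightarrow> complex) \<Rightarrow> complex" where
  "neumann_form S M p f g =
     (LINT r|M. weak_deriv S 1 f r * cnj (weak_deriv S 1 g r)
                + complex_of_real ((p r)\<^sup>2) * f r * cnj (g r))"

definition neumann_lowest :: "real set \<Rightarrow> real measure \<Rightarrow> (real \<Rightarrow> real) \<Rightarrow> real" where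
  "neumann_lowest S M p =
     lowest_eigenvalue M (form_operator M (neumann_domain S M p) (neumann_form S M p))"

definition radial_measure :: "real measure" where
  "radial_measure = density (lebesgue_on {0<..<1}) (\<lambda>r. ennreal r)"

definition fiber_lambda :: "nat \<Rightarrow> real \<Rightarrow> real" where
  "fiber_lambda n b =
     neumann_lowest {0<..<1} radial_measure (\<lambda>r. real n / r - b / 2 * r)"

definition de_Gennes_mu :: "real \<Rightarrow> real" where
  "de_Gennes_mu \<xi> = neumann_lowest {0<..} (lebesgue_on {0<..}) (\<lambda>t. t - \<xi>)"

definition Theta0 :: real where
  "Theta0 = (INF \<xi>. de_Gennes_mu \<xi>)"

section \<open>The crossing points\<close>

text \<open>By Helffer and Lena there is such a sequence; the third condition makes it unique.\<close>

definition crossing_sequence :: "(nat \<Rightarrow> real) \<Rightarrow> bool" where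
  "crossing_sequence \<beta> \<longleftrightarrow>
     strict_mono \<beta> \<and>
     (\<forall>n. \<beta> n > 2 * (real n + 1)) \<and>
     (\<forall>n. {b. b > 0 \<and> fiber_lambda n b = fiber_lambda (n + 1) b} = {\<beta> n}) \<and>
     (\<forall>b. 0 \<le> b \<and> b \<le> \<beta> 0 \<longrightarrow> disc_lambda b = fiber_lambda 0 b) \<and>
     (\<forall>n\<ge>1. \<forall>b. \<beta> (n - 1) \<le> b \<and> b \<le> \<beta> n \<longrightarrow> disc_lambda b = fiber_lambda n b)"

end

theory Submission
  imports Defs
begin

text \<open>
  The theorem follows from an exact equation at the crossing points together with the
  inequalities \<open>\<eta>\<^sub>0 < \<eta>\<^sub>n\<close> (for \<open>n \<ge> 1\<close>) and \<open>\<eta>\<^sub>n < \<Theta>\<^sub>0\<close> for the reduced energies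
  \<open>\<eta>\<^sub>n = \<lambda>\<^sub>n(\<beta>\<^sub>n) / \<beta>\<^sub>n\<close>.

  In the variable \<open>z = b r\<^sup>2 / 2\<close>, and with energy \<open>b \<eta>\<close>, the radial equation of angular momentum
  \<open>n\<close> has the regular solution \<open>f\<^sub>n = z\<^bsup>n/2\<^esup> e\<^bsup>-z/2\<^esup> M((1-\<eta>)/2, n+1, z)\<close>, with \<open>M\<close> Kummer's function.
  Let \<open>w\<^sub>n = z f\<^sub>n' / f\<^sub>n\<close> (\<open>fiber_slope\<close>). It solves a Riccati equation, and the Neumann condition
  at \<open>r = 1\<close> is \<open>w\<^sub>n = 0\<close> at \<open>z = b/2\<close>. For \<open>0 < \<eta> < 1\<close> the solution is positive, so a zero of
  \<open>w\<^sub>n\<close> gives the lowest eigenvalue (\<open>fiber_lambda_eq\<close>).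

  Magnetic translations commute with the magnetic Laplacian. In polar coordinates they yield a first
  order operator that takes \<open>f\<^sub>n\<close> to \<open>f\<^sub>n\<^sub>+\<^sub>1\<close> at the same energy. Hence \<open>w\<^sub>n\<close> and \<open>w\<^sub>n\<^sub>+\<^sub>1\<close> can vanish
  together only where \<open>(z - n) (z - n - 1) = 2 \<eta> z\<close> (\<open>fiber_slope_common_zero\<close>). With \<open>z = \<beta>\<^sub>n / 2\<close> and
  \<open>z > n + 1\<close> this quadratic equation gives
  \<open>\<beta>\<^sub>n = (2n+1) + 2\<eta>\<^sub>n + sqrt (4\<eta>\<^sub>n(2n+1) + 4\<eta>\<^sub>n\<^sup>2 + 1)\<close> (\<open>crossing_energy\<close>, \<open>double_res_point\<close>).
  The right-hand side increases with the energy, and the \<open>\<eta>\<close> of the theorem is \<open>\<eta>\<^sub>0\<close>, since the disc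
  eigenvalue at \<open>\<beta>\<^sub>0\<close> is \<open>\<lambda>\<^sub>0(\<beta>\<^sub>0)\<close>.

  To compare the \<open>\<eta>\<^sub>n\<close>, fix one energy \<open>\<eta>\<close> and let \<open>z\<^sub>n(\<eta>)\<close> (\<open>res_point\<close>) be the root of that quadratic
  equation. There the first order operator multiplies the slope by a positive factor, so
  \<open>w\<^sub>n(z\<^sub>n) \<ge> 0\<close> implies \<open>w\<^sub>n\<^sub>+\<^sub>1(z\<^sub>n) \<ge> 0\<close>. An explicit lower solution of the Riccati equation on
  \<open>[z\<^sub>n, z\<^sub>n\<^sub>+\<^sub>1]\<close> then yields \<open>w\<^sub>n\<^sub>+\<^sub>1(z\<^sub>n\<^sub>+\<^sub>1) > 0\<close> (\<open>fiber_slope_propagation\<close>). So at \<open>\<eta> = \<eta>\<^sub>0\<close> all later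
  slopes are positive, whereas at \<open>\<eta> = 1\<close> they are negative. Uniqueness of the crossing places the only
  zero, \<open>\<eta>\<^sub>n\<close>, above \<open>\<eta>\<^sub>0\<close>.

  For the upper bound, suppose \<open>\<eta>\<^sub>n \<ge> \<Theta>\<^sub>0\<close>. Then \<open>\<eta> = \<eta>\<^sub>n\<^sub>+\<^sub>1\<close> exceeds \<open>\<Theta>\<^sub>0\<close> and \<open>w\<^sub>N(z\<^sub>N\<^sub>-\<^sub>1(\<eta>)) \<ge> 0\<close> for all
  large \<open>N\<close>. Near the boundary the rescaled radial equations converge to the half-line equation with
  potential \<open>(s - \<surd>\<eta>)\<^sup>2 - \<eta>\<close>. Because \<open>\<eta> > \<Theta>\<^sub>0\<close>, a Neumann solution on some half-line has a zero at
  an energy below \<open>\<eta>\<close>, and Sturm comparison with it contradicts the sign of \<open>w\<^sub>N\<close>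
  (\<open>no_subcritical_energy_above_Theta0\<close>).

  What remains is to identify the least eigenvalues of the weakly defined operators. Weakly
  differentiable functions on an interval have primitives as representatives, and for those Picone's
  identity with a positive solution bounds the quadratic form from below.
\<close>

section \<open>Smooth functions of compact support on the line\<close>

lemma Ck_Suc_imp_Ck: "Ck (Suc k) f \<Longrightarrow> Ck k f"
proof (induction k arbitrary: f)
  case 0
  then show ?case
    by (auto intro!: continuous_at_imp_continuous_on differentiable_imp_continuous_within)
next
  case (Suc k)
  show ?case unfolding Ck.simps(2)[of k]
  proof (intro conjI allI Suc.IH)
    show "f differentiable at x" for x using Suc.prems by simp
    show "Ck (Suc k) (\<lambda>x. frechet_derivative f (at x) v)" for v
      using Suc.prems unfolding Ck.simps(2)[of "Suc k"] by blast
  qed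
qed

lemma Ck_Suc_realI:
  assumes "\<And>x. (f has_real_derivative f' x) (at x)" "\<And>v. Ck k (\<lambda>x. f' x * v)"
  shows "Ck (Suc k) f"
proof -
  have "frechet_derivative f (at x) = (*) (f' x)" for x
    using assms(1)[of x] unfolding has_field_derivative_def
    by (rule frechet_derivative_at[symmetric])
  moreover have "f differentiable (at x)" for x
    using assms(1)[of x] by (auto simp: differentiable_def has_field_derivative_def)
  ultimately show ?thesis using assms(2) by simp
qed

lemma frechet_derivative_real:
  "(f has_real_derivative d) (at x) \<Longrightarrow> frechet_derivative f (at x) v = d * v"
  unfolding has_field_derivative_def by (simp add: frechet_derivative_at[symmetric])

lemma differentiable_imp_real_deriv:
  fixes f :: "real \<Rightarrow> real"
  assumes "f differentiable (at x)"
  shows "(f has_real_derivative frechet_derivative f (at x) 1) (at x)"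
proof (rule has_derivative_imp_has_field_derivative)
  show "(f has_derivative frechet_derivative f (at x)) (at x)"
    using assms by (simp add: frechet_derivative_works)
  show "v * frechet_derivative f (at x) 1 = frechet_derivative f (at x) v" for v
    using linear_scale[OF linear_frechet_derivative[OF assms], of v 1] by simp
qed

lemma Ck_add: "Ck k f \<Longrightarrow> Ck k g \<Longrightarrow> Ck k (\<lambda>x. f x + g x)"
proof (induction k arbitrary: f g)
  case 0
  then show ?case by (auto intro: continuous_on_add)
next
  case (Suc k)
  have "frechet_derivative (\<lambda>x. f x + g x) (at x) v =
      frechet_derivative f (at x) v + frechet_derivative g (at x) v" for x v
  proof -
    have "((\<lambda>x. f x + g x) has_derivative
        (\<lambda>v. frechet_derivative f (at x) v + frechet_derivative g (at x) v)) (at x)"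
      using Suc.prems by (intro has_derivative_add) (auto simp: frechet_derivative_works)
    then show ?thesis by (simp add: frechet_derivative_at[symmetric])
  qed
  note fd = this
  show ?case unfolding Ck.simps(2) fd
  proof (intro conjI allI Suc.IH)
    show "(\<lambda>x. f x + g x) differentiable at x" for x
      using Suc.prems by (intro differentiable_add) simp_all
    show "Ck k (\<lambda>x. frechet_derivative g (at x) v)" "Ck k (\<lambda>x. frechet_derivative f (at x) v)" for v
      using Suc.prems by simp_all
  qed
qed

text \<open>
  The induction applies the hypothesis to the two terms of the Leibniz rule, which pair a derivative
  with an undifferentiated factor; the latter only has to be of class \<open>k\<close>, whence \<open>Ck_Suc_imp_Ck\<close>.
\<close>

lemma Ck_mult: "Ck k f \<Longrightarrow> Ck k g \<Longrightarrow> Ck k (\<lambda>x. f x * g x)"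
proof (induction k arbitrary: f g)
  case 0
  then show ?case by (auto intro: continuous_on_mult)
next
  case (Suc k)
  have "frechet_derivative (\<lambda>x. f x * g x) (at x) v =
      f x * frechet_derivative g (at x) v + frechet_derivative f (at x) v * g x" for x v
  proof -
    have "((\<lambda>x. f x * g x) has_derivative
        (\<lambda>v. f x * frechet_derivative g (at x) v + frechet_derivative f (at x) v * g x)) (at x)"
      using Suc.prems by (intro has_derivative_mult) (auto simp: frechet_derivative_works)
    then show ?thesis by (simp add: frechet_derivative_at[symmetric])
  qed
  note fd = this
  have k: "Ck k f" "Ck k g" using Suc.prems Ck_Suc_imp_Ck by blast+
  show ?case unfolding Ck.simps(2) fd
  proof (intro conjI allI Ck_add Suc.IH k)
    show "(\<lambda>x. f x * g x) differentiable at x" for x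
      using Suc.prems by (intro differentiable_mult) simp_all
    show "Ck k (\<lambda>x. frechet_derivative g (at x) v)" "Ck k (\<lambda>x. frechet_derivative f (at x) v)" for v
      using Suc.prems by simp_all
  qed
qed

lemma Ck_const: "Ck k (\<lambda>x. c)"
proof (induction k arbitrary: c)
  case (Suc k)
  then show ?case by simp
qed simp

lemma Ck_affine:
  fixes f :: "real \<Rightarrow> real"
  shows "Ck k f \<Longrightarrow> Ck k (\<lambda>x. f (c * x + d))"
proof (induction k arbitrary: f)
  case 0
  then show ?case
    by (auto intro!: continuous_on_compose2[of UNIV f UNIV "\<lambda>x. c * x + d"] continuous_intros)
next
  case (Suc k)
  have der: "(f has_real_derivative frechet_derivative f (at y) 1) (at y)" for y
    using Suc.prems by (intro differentiable_imp_real_deriv) simp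
  show ?case
  proof (rule Ck_Suc_realI)
    show "((\<lambda>x. f (c * x + d)) has_real_derivative frechet_derivative f (at (c * x + d)) 1 * c) (at x)" for x
      by (rule DERIV_chain2[OF der]) (auto intro!: derivative_eq_intros)
    have "Ck k (\<lambda>x. frechet_derivative f (at x) 1)" using Suc.prems by simp
    from Ck_mult[OF Ck_mult[OF Suc.IH[OF this] Ck_const] Ck_const]
    show "Ck k (\<lambda>x. frechet_derivative f (at (c * x + d)) 1 * c * v)" for v .
  qed
qed

text \<open>
  The powers \<open>x\<^sup>-\<^sup>m\<close> make the family closed under differentiation up to linear combinations, so
  smoothness of all its members can be proved by one induction.
\<close>

definition flat_exp :: "real \<Rightarrow> nat \<Rightarrow> real \<Rightarrow> real" where
  "flat_exp c m x = (if x > 0 then (1 / x) ^ m * exp (- c / x) else 0)"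

lemma flat_exp_tendsto_0:
  assumes "c > 0" shows "(flat_exp c m \<longlongrightarrow> 0) (at 0)"
proof -
  have "((\<lambda>y. (1 / c) ^ m * ((c * y) ^ m / exp (c * y))) \<longlongrightarrow> (1 / c) ^ m * 0) at_top"
    using assms
    by (intro tendsto_mult tendsto_const filterlim_compose[OF tendsto_power_div_exp_0]
        filterlim_tendsto_pos_mult_at_top[OF tendsto_const] filterlim_ident)
  then have "((\<lambda>y. y ^ m * exp (- c * y)) \<longlongrightarrow> 0) at_top"
    using assms by (simp add: power_mult_distrib exp_minus divide_simps mult_ac)
  then have lim: "((\<lambda>x. (1 / x) ^ m * exp (- c * (1 / x))) \<longlongrightarrow> 0) (at_right 0)"
    by (drule_tac filterlim_compose[OF _ filterlim_inverse_at_top_right]) (simp add: inverse_eq_divide)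
  have "(flat_exp c m \<longlongrightarrow> 0) (at_right 0)"
    by (rule Lim_transform_eventually[OF lim])
       (auto simp: flat_exp_def eventually_at_filter)
  moreover have "(flat_exp c m \<longlongrightarrow> 0) (at_left 0)"
    by (rule Lim_transform_eventually[OF tendsto_const])
       (auto simp: flat_exp_def eventually_at_filter)
  ultimately show ?thesis by (simp add: filterlim_split_at)
qed

text \<open>
  At 0 the difference quotient of a member of the family is the next member, which tends to 0.
\<close>

lemma flat_exp_deriv:
  assumes "c > 0"
  shows "(flat_exp c m has_real_derivative c * flat_exp c (m + 2) x + - real m * flat_exp c (m + 1) x) (at x)"
proof (cases x "0 :: real" rule: linorder_cases)
  case less
  have "((\<lambda>x. 0) has_real_derivative 0) (at x)" by simp
  moreover have "\<forall>\<^sub>F y in nhds x. flat_exp c m y = 0"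
    using eventually_nhds_in_open[of "{..<0}" x] less
    by (auto elim!: eventually_mono simp: flat_exp_def)
  ultimately have "(flat_exp c m has_real_derivative 0) (at x)"
    using DERIV_cong_ev[of x x "flat_exp c m" "\<lambda>x. 0" 0 0] by simp
  then show ?thesis using less by (simp add: flat_exp_def)
next
  case equal
  have "((\<lambda>h. (flat_exp c m (0 + h) - flat_exp c m 0) / h) \<longlongrightarrow> 0) (at 0)"
    by (rule Lim_transform_eventually[OF flat_exp_tendsto_0[OF assms, of "m + 1"]])
       (auto simp: flat_exp_def eventually_at_filter power_divide)
  then have "(flat_exp c m has_real_derivative 0) (at 0)" by (simp add: DERIV_def)
  then show ?thesis using equal by (simp add: flat_exp_def)
next
  case greater
  have "((\<lambda>x. (1 / x) ^ m * exp (- c / x)) has_real_derivative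
     c * flat_exp c (m + 2) x + - real m * flat_exp c (m + 1) x) (at x)"
    using greater
    by (auto intro!: derivative_eq_intros simp: flat_exp_def power2_eq_square)
       (cases m; simp add: field_simps power2_eq_square)
  moreover have "\<forall>\<^sub>F y in nhds x. flat_exp c m y = (1 / y) ^ m * exp (- c / y)"
    using eventually_nhds_in_open[of "{0<..}" x] greater
    by (auto elim!: eventually_mono simp: flat_exp_def)
  ultimately show ?thesis
    using DERIV_cong_ev[of x x "flat_exp c m" "\<lambda>x. (1 / x) ^ m * exp (- c / x)"] by simp
qed

lemma Ck_flat_exp: "c > 0 \<Longrightarrow> Ck k (flat_exp c m)"
proof (induction k arbitrary: m)
  case 0
  then show ?case
    using flat_exp_deriv[of c m] by (auto intro!: continuous_at_imp_continuous_on DERIV_isCont)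
next
  case (Suc k)
  show ?case
    by (rule Ck_Suc_realI[OF flat_exp_deriv[OF Suc.prems]])
       (intro Ck_mult Ck_add Ck_const Suc.IH Suc.prems)
qed

text \<open>
  As \<open>c\<close> tends to 0 these functions increase to the indicator function of the open interval.
\<close>

definition bump :: "real \<Rightarrow> real \<Rightarrow> real \<Rightarrow> real \<Rightarrow> real" where
  "bump c a b x = flat_exp c 0 (x - a) * flat_exp c 0 (b - x)"

lemma bump_eq: "bump c a b x = (if a < x \<and> x < b then exp (- c / (x - a)) * exp (- c / (b - x)) else 0)"
  by (simp add: bump_def flat_exp_def)

lemma test_function_bump:
  assumes "c > 0" "{a..b} \<subseteq> S" shows "test_function S (bump c a b)"
proof -
  have "Ck k (\<lambda>x. flat_exp c 0 (1 * x + (- a)) * flat_exp c 0 ((-1) * x + b))" for k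
    by (intro Ck_mult Ck_affine Ck_flat_exp assms(1))
  then have "Ck k (bump c a b)" for k by (simp add: bump_def[abs_def])
  then show ?thesis using assms(2) by (auto simp: test_function_def bump_eq intro!: exI[of _ "{a..b}"])
qed

lemma bump_bounds: "c > 0 \<Longrightarrow> 0 \<le> bump c a b x \<and> bump c a b x \<le> 1"
  by (auto simp: bump_eq intro!: mult_le_one)

lemma test_functionD_continuous: "test_function S \<phi> \<Longrightarrow> continuous_on UNIV \<phi>"
  by (metis Ck.simps(1) test_function_def)

lemma test_function_deriv:
  fixes \<phi> :: "real \<Rightarrow> real"
  assumes "test_function S \<phi>"
  obtains \<phi>' where "\<And>x. (\<phi> has_real_derivative \<phi>' x) (at x)" "continuous_on UNIV \<phi>'"
    "\<And>x. frechet_derivative \<phi> (at x) 1 = \<phi>' x"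
proof
  let ?d = "\<lambda>x. frechet_derivative \<phi> (at x) 1"
  have Ck: "Ck (Suc 0) \<phi>" using assms by (auto simp: test_function_def)
  then show "continuous_on UNIV ?d" by simp
  show "(\<phi> has_real_derivative ?d x) (at x)" for x
    using Ck by (intro differentiable_imp_real_deriv) simp
qed simp

text \<open>
  The sets over which \<open>h\<close> integrates to zero form a Dynkin system containing the half-lines, hence
  all Borel sets; in particular the sets where \<open>h\<close> is positive or negative.
\<close>

lemma AE_zero_of_interval_integrals:
  fixes h :: "real \<Rightarrow> real"
  assumes h: "integrable lborel h"
    and zero: "\<And>x. (LINT y:{..x}|lborel. h y) = 0"
  shows "AE x in lborel. h x = 0"
proof -
  have meas: "A \<in> sets lborel \<Longrightarrow> set_integrable lborel A h" for A
    unfolding set_integrable_def using h by (rule integrable_mult_indicator[rotated])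
  have total: "integral\<^sup>L lborel h = 0"
  proof -
    have "(\<lambda>n. LINT y:{..real n}|lborel. h y) \<longlonglongrightarrow> (LINT y:(\<Union>n. {..real n})|lborel. h y)"
      by (intro set_integral_cont_up) (auto simp: incseq_def intro!: meas order_trans[of _ "real _"])
    moreover have "(\<Union>n. {..real n}) = UNIV" using real_arch_simple by auto
    ultimately show ?thesis using zero
      by (simp add: set_lebesgue_integral_def LIMSEQ_const_iff)
  qed
  have all: "(LINT y:A|lborel. h y) = 0" if "A \<in> sets borel" for A
  proof -
    have "Int_stable (range (\<lambda>a. {..a::real}))"
      by (auto simp: Int_stable_def intro!: exI[of _ "min _ _"])
    moreover have "range (\<lambda>a. {..a::real}) \<subseteq> Pow UNIV" by simp
    moreover have "A \<in> sigma_sets UNIV (range (\<lambda>a. {..a::real}))"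
      using that by (simp add: borel_eq_atMost)
    ultimately show ?thesis
    proof (induction rule: sigma_sets_induct_disjoint)
      case (basic A)
      then show ?case using zero by auto
    next
      case empty
      then show ?case by (simp add: set_lebesgue_integral_def)
    next
      case (compl A)
      then have A: "A \<in> sets lborel" by (simp add: sets_lborel) (simp add: borel_eq_atMost)
      have "(LINT y:(UNIV - A) \<union> A|lborel. h y) = (LINT y:UNIV - A|lborel. h y) + (LINT y:A|lborel. h y)"
        using A by (intro set_integral_Un meas) auto
      then show ?case using compl total by (simp add: set_lebesgue_integral_def)
    next
      case (union A)
      then have A: "A i \<in> sets lborel" for i by (simp add: sets_lborel) (auto simp: borel_eq_atMost)
      have "(LINT y:(\<Union>i. A i)|lborel. h y) = (\<Sum>i. LINT y:A i|lborel. h y)"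
        using union A by (intro lebesgue_integral_countable_add meas)
          (auto simp: disjoint_family_on_def)
      then show ?case using union by simp
    qed
  qed
  have pos: "AE x in lborel. \<not> 0 < s x" if s: "integrable lborel s"
    "\<And>A. A \<in> sets borel \<Longrightarrow> (LINT y:A|lborel. s y) = 0" for s :: "real \<Rightarrow> real"
  proof -
    have [measurable]: "s \<in> borel_measurable borel" using borel_measurable_integrable[OF s(1)] by simp
    have P: "{x. 0 < s x} \<in> sets borel" by measurable
    have i: "integrable lborel (\<lambda>x. indicator {x. 0 < s x} x * s x)"
      using integrable_mult_indicator[OF _ s(1), of "{x. 0 < s x}"] P by simp
    have "integral\<^sup>L lborel (\<lambda>x. indicator {x. 0 < s x} x * s x) = 0"
      using s(2)[OF P] by (simp add: set_lebesgue_integral_def)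
    then have "AE x in lborel. indicator {x. 0 < s x} x * s x = 0"
      by (subst (asm) integral_nonneg_eq_0_iff_AE[OF i]) (auto simp: indicator_def)
    then show ?thesis by eventually_elim (auto simp: indicator_def split: if_splits)
  qed
  have "AE x in lborel. \<not> 0 < h x" by (rule pos[OF h all])
  moreover have "AE x in lborel. \<not> 0 < - h x"
    using h all by (intro pos) (auto simp: set_lebesgue_integral_def)
  ultimately show ?thesis by eventually_elim auto
qed

section \<open>The fundamental lemma of the calculus of variations\<close>

lemma lebesgue_on_integral_compact_support:
  fixes F :: "real \<Rightarrow> complex"
  assumes "open S" "{\<alpha>..\<beta>} \<subseteq> S" "F absolutely_integrable_on {\<alpha>..\<beta>}"
    and "\<And>x. x \<in> S \<Longrightarrow> x \<notin> {\<alpha>..\<beta>} \<Longrightarrow> F x = 0"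
  shows "integrable (lebesgue_on S) F"
    and "integral\<^sup>L (lebesgue_on S) F = integral {\<alpha>..\<beta>} F"
proof -
  have S: "S \<inter> space lebesgue \<in> sets lebesgue" using assms(1) by simp
  have eq: "(\<lambda>x. indicat_real S x *\<^sub>R F x) = (\<lambda>x. indicat_real {\<alpha>..\<beta>} x *\<^sub>R F x)"
    using assms(2,4) by (auto simp: indicator_def fun_eq_iff)
  show "integrable (lebesgue_on S) F"
    unfolding integrable_restrict_space[OF S] eq using assms(3) by (simp add: set_integrable_def)
  show "integral\<^sup>L (lebesgue_on S) F = integral {\<alpha>..\<beta>} F"
    unfolding integral_restrict_space[OF S] eq
    using set_lebesgue_integral_eq_integral(2)[OF assms(3)] by (simp add: set_lebesgue_integral_def)
qed

lemma absolutely_integrable_continuous_mult: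
  fixes g :: "real \<Rightarrow> complex"
  assumes "g absolutely_integrable_on {\<alpha>..\<beta>}" "continuous_on {\<alpha>..\<beta>} f"
  shows "(\<lambda>x. f x * g x) absolutely_integrable_on {\<alpha>..\<beta>}"
proof (rule absolutely_integrable_bounded_measurable_product[OF bilinear_times])
  show "f \<in> borel_measurable (lebesgue_on {\<alpha>..\<beta>})"
    using assms(2) by (intro continuous_imp_measurable_on_sets_lebesgue) auto
  show "bounded (f ` {\<alpha>..\<beta>})"
    using assms(2) by (intro compact_imp_bounded compact_continuous_image) auto
qed (use assms in auto)

text \<open>
  On an interval the support can be enlarged to a compact interval, on which one-variable calculus is
  available.
\<close>

lemma test_function_support:
  fixes \<phi> :: "real \<Rightarrow> real"
  assumes "test_function S \<phi>" "is_interval S" "S \<noteq> {}"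
  obtains \<alpha> \<beta> where "\<alpha> \<le> \<beta>" "{\<alpha>..\<beta>} \<subseteq> S" "\<And>x. x \<notin> {\<alpha>..\<beta>} \<Longrightarrow> \<phi> x = 0"
proof -
  obtain s where s: "s \<in> S" using assms(3) by blast
  obtain K where K: "compact K" "K \<subseteq> S" "\<And>x. x \<notin> K \<Longrightarrow> \<phi> x = 0"
    using assms(1) by (auto simp: test_function_def)
  let ?K = "insert s K"
  have cK: "compact ?K" using K(1) by simp
  obtain \<alpha> where \<alpha>: "\<alpha> \<in> ?K" "\<And>x. x \<in> ?K \<Longrightarrow> \<alpha> \<le> x"
    using compact_attains_inf[OF cK] by blast
  obtain \<beta> where \<beta>: "\<beta> \<in> ?K" "\<And>x. x \<in> ?K \<Longrightarrow> x \<le> \<beta>"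
    using compact_attains_sup[OF cK] by blast
  show thesis
  proof
    show "\<alpha> \<le> \<beta>" using \<alpha> \<beta> by blast
    have "\<alpha> \<in> S" "\<beta> \<in> S" using \<alpha>(1) \<beta>(1) K(2) s by auto
    then show "{\<alpha>..\<beta>} \<subseteq> S"
      using assms(2) unfolding is_interval_1 by (meson atLeastAtMost_iff subsetI)
    show "\<phi> x = 0" if "x \<notin> {\<alpha>..\<beta>}" for x
      using that K(3) \<alpha>(2) \<beta>(2) by auto
  qed
qed

lemma locally_integrable_Icc:
  "locally_integrable S g \<Longrightarrow> {\<alpha>..\<beta>} \<subseteq> S \<Longrightarrow> g absolutely_integrable_on {\<alpha>..\<beta>::real}"
  by (auto simp: locally_integrable_def)

text \<open>
  The function is Lebesgue measurable only; the argument is carried out for a Borel representative.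
\<close>

lemma AE_zero_Icc_real:
  fixes r :: "real \<Rightarrow> real"
  assumes r: "r absolutely_integrable_on {\<alpha>..\<beta>}"
    and zero: "\<And>x. x \<le> \<beta> \<Longrightarrow> integral {\<alpha>..x} r = 0"
  shows "AE x in lebesgue. x \<in> {\<alpha>..\<beta>} \<longrightarrow> r x = 0"
proof -
  let ?h = "\<lambda>x. indicat_real {\<alpha>..\<beta>} x *\<^sub>R r x"
  have int: "integrable lebesgue ?h" using r by (simp add: set_integrable_def)
  then have "?h \<in> borel_measurable lebesgue" by (rule borel_measurable_integrable)
  from completion_ex_borel_measurable_real[OF this]
  obtain h where h: "h \<in> borel_measurable lborel" "AE x in lborel. ?h x = h x" by blast
  have ae: "AE x in lebesgue. ?h x = h x" using h(2) by (rule AE_completion)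
  have hl: "h \<in> borel_measurable lebesgue" using h(1) by (rule measurable_completion)
  have "integrable lebesgue h"
    using int integrable_cong_AE[OF borel_measurable_integrable[OF int] hl ae] by simp
  then have "integrable lborel h" using integrable_completion[OF h(1)] by simp
  moreover have "(LINT y:{..x}|lborel. h y) = 0" for x
  proof -
    have m: "(\<lambda>y. indicat_real {..x} y *\<^sub>R h y) \<in> borel_measurable lborel"
      using h(1) by measurable
    have "(LINT y:{..x}|lborel. h y) = (LINT y|lebesgue. indicat_real {..x} y *\<^sub>R h y)"
      unfolding set_lebesgue_integral_def by (rule integral_completion[OF m, symmetric])
    also have "\<dots> = (LINT y|lebesgue. indicat_real {\<alpha>..min \<beta> x} y *\<^sub>R r y)"
    proof (rule integral_cong_AE)
      show "AE y in lebesgue. indicat_real {..x} y *\<^sub>R h y = indicat_real {\<alpha>..min \<beta> x} y *\<^sub>R r y"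
        using ae by eventually_elim (auto simp: indicator_def)
      show "(\<lambda>y. indicat_real {..x} y *\<^sub>R h y) \<in> borel_measurable lebesgue"
        using m by (rule measurable_completion)
      have "r absolutely_integrable_on {\<alpha>..min \<beta> x}"
        using r by (rule set_integrable_subset) auto
      then show "(\<lambda>y. indicat_real {\<alpha>..min \<beta> x} y *\<^sub>R r y) \<in> borel_measurable lebesgue"
        unfolding set_integrable_def by (rule borel_measurable_integrable)
    qed
    also have "\<dots> = integral {\<alpha>..min \<beta> x} r"
      using set_lebesgue_integral_eq_integral(2)[OF set_integrable_subset[OF r, of "{\<alpha>..min \<beta> x}"]]
      by (simp add: set_lebesgue_integral_def)
    also have "\<dots> = 0" by (rule zero) simp
    finally show ?thesis .
  qed
  ultimately have "AE x in lborel. h x = 0" by (rule AE_zero_of_interval_integrals)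
  then have "AE x in lebesgue. h x = 0" by (rule AE_completion)
  with ae show ?thesis by eventually_elim (auto simp: indicator_def)
qed

lemma AE_zero_of_Icc_integrals:
  fixes g :: "real \<Rightarrow> complex"
  assumes S: "open S" and g: "locally_integrable S g"
    and zero: "\<And>a b. a < b \<Longrightarrow> {a..b} \<subseteq> S \<Longrightarrow> integral {a..b} g = 0"
  shows "AE x in lebesgue_on S. g x = 0"
proof -
  obtain D where D: "countable D" "D \<subseteq> Pow S" "\<And>X. X \<in> D \<Longrightarrow> \<exists>a b. X = cbox a b" "\<Union>D = S"
    using open_countable_Union_open_cbox[OF S] by blast
  have "AE x in lebesgue. \<forall>X\<in>D. x \<in> X \<longrightarrow> g x = 0"
  proof (subst AE_ball_countable[OF D(1)], rule ballI)
    fix X assume X: "X \<in> D"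
    then obtain \<alpha> \<beta> where ab: "X = {\<alpha>..\<beta>}" using D(3) by (metis cbox_interval)
    have sub: "{\<alpha>..\<beta>} \<subseteq> S" using X D(2) ab by auto
    have gi: "g absolutely_integrable_on {\<alpha>..\<beta>}" using g sub by (rule locally_integrable_Icc)
    have gx: "integral {\<alpha>..x} g = 0" "g integrable_on {\<alpha>..x}" if "x \<le> \<beta>" for x
    proof -
      show "g integrable_on {\<alpha>..x}"
        using set_lebesgue_integral_eq_integral(1)[OF set_integrable_subset[OF gi, of "{\<alpha>..x}"]] that
        by simp
      consider "\<alpha> < x" | "\<alpha> = x" | "x < \<alpha>" by linarith
      then show "integral {\<alpha>..x} g = 0"
        using zero[of \<alpha> x] order_trans[OF _ sub, of "{\<alpha>..x}"] that by cases (auto simp: atLeastatMost_subset_iff)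
    qed
    have "AE x in lebesgue. x \<in> {\<alpha>..\<beta>} \<longrightarrow> Re (g x) = 0"
    proof (rule AE_zero_Icc_real)
      show "(\<lambda>x. Re (g x)) absolutely_integrable_on {\<alpha>..\<beta>}"
        using absolutely_integrable_linear[OF gi bounded_linear_Re] by (simp add: o_def)
      show "integral {\<alpha>..x} (\<lambda>x. Re (g x)) = 0" if "x \<le> \<beta>" for x
        using integral_linear[OF gx(2)[OF that] bounded_linear_Re] gx(1)[OF that] by (simp add: o_def)
    qed
    moreover have "AE x in lebesgue. x \<in> {\<alpha>..\<beta>} \<longrightarrow> Im (g x) = 0"
    proof (rule AE_zero_Icc_real)
      show "(\<lambda>x. Im (g x)) absolutely_integrable_on {\<alpha>..\<beta>}"
        using absolutely_integrable_linear[OF gi bounded_linear_Im] by (simp add: o_def)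
      show "integral {\<alpha>..x} (\<lambda>x. Im (g x)) = 0" if "x \<le> \<beta>" for x
        using integral_linear[OF gx(2)[OF that] bounded_linear_Im] gx(1)[OF that] by (simp add: o_def)
    qed
    ultimately show "AE x in lebesgue. x \<in> X \<longrightarrow> g x = 0"
      unfolding ab by eventually_elim (auto simp: complex_eq_iff)
  qed
  then have "AE x in lebesgue. x \<in> S \<longrightarrow> g x = 0"
    by eventually_elim (use D(4) in blast)
  then show ?thesis using S by (simp add: AE_restrict_space_iff)
qed

lemma bump_outside: "\<not> (a \<le> x \<and> x \<le> b) \<Longrightarrow> bump c a b x = 0"
  by (auto simp: bump_eq)

lemma bump_tendsto_indicator:
  "(\<lambda>n. bump (1 / (real n + 1)) a b x) \<longlonglongrightarrow> indicator {a<..<b} x"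
proof (cases "a < x \<and> x < b")
  case True
  have "(\<lambda>n. exp (- (1 / (real n + 1)) / (x - a)) * exp (- (1 / (real n + 1)) / (b - x))) \<longlonglongrightarrow>
      exp (- 0 / (x - a)) * exp (- 0 / (b - x))"
    using True LIMSEQ_inverse_real_of_nat
    by (intro tendsto_intros) (auto simp: inverse_eq_divide add.commute)
  then show ?thesis using True by (simp add: bump_eq)
next
  case False
  then show ?thesis by (auto simp: bump_eq indicator_def)
qed

text \<open>
  The fundamental lemma: bumps converge boundedly to the indicator function of an interval, so the
  integral over every compact subinterval vanishes.
\<close>

lemma AE_zero_of_test_integrals:
  fixes g :: "real \<Rightarrow> complex"
  assumes S: "open S" and g: "locally_integrable S g"
    and test: "\<And>\<phi>. test_function S \<phi> \<Longrightarrow>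
       (LINT x|lebesgue_on S. g x * complex_of_real (\<phi> x)) = 0"
  shows "AE x in lebesgue_on S. g x = 0"
proof (rule AE_zero_of_Icc_integrals[OF S g])
  fix a b :: real assume ab: "a < b" "{a..b} \<subseteq> S"
  let ?c = "\<lambda>n. 1 / (real n + 1)"
  have gi: "g absolutely_integrable_on {a..b}" using g ab(2) by (rule locally_integrable_Icc)
  have tf: "test_function S (bump (?c n) a b)" for n
    using ab by (intro test_function_bump) auto
  have F: "(\<lambda>x. of_real (bump (?c n) a b x) * g x) absolutely_integrable_on {a..b}" for n
    using test_functionD_continuous[OF tf[of n]]
    by (intro absolutely_integrable_continuous_mult gi continuous_on_of_real) (rule continuous_on_subset, auto)
  have zero: "integral {a..b} (\<lambda>x. of_real (bump (?c n) a b x) * g x) = 0" for n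
    using test[OF tf[of n]] lebesgue_on_integral_compact_support(2)[OF S ab(2) F[of n]]
    by (simp add: bump_outside mult.commute)
  have "(\<lambda>n. integral {a..b} (\<lambda>x. of_real (bump (?c n) a b x) * g x))
      \<longlonglongrightarrow> integral {a..b} (\<lambda>x. of_real (indicator {a<..<b} x) * g x)"
  proof (rule dominated_convergence(2))
    show "(\<lambda>x. of_real (bump (?c n) a b x) * g x) integrable_on {a..b}" for n
      using F set_lebesgue_integral_eq_integral(1) by blast
    show "(\<lambda>x. norm (g x)) integrable_on {a..b}"
      using gi by (simp add: absolutely_integrable_on_def)
    show "norm (of_real (bump (?c n) a b x) * g x) \<le> norm (g x)" for n x
      using bump_bounds[of "?c n" a b x] by (simp add: norm_mult mult_left_le_one_le)
    show "(\<lambda>n. of_real (bump (?c n) a b x) * g x) \<longlonglongrightarrow> of_real (indicator {a<..<b} x) * g x" for x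
      by (intro tendsto_intros bump_tendsto_indicator)
  qed
  then have "integral {a..b} (\<lambda>x. of_real (indicator {a<..<b} x) * g x) = 0"
    by (simp add: zero LIMSEQ_const_iff)
  then have "integral {a<..<b} (\<lambda>x. of_real (indicator {a<..<b} x) * g x) = 0"
    by (simp add: integral_open_interval_real)
  moreover have "integral {a<..<b} (\<lambda>x. of_real (indicator {a<..<b} x) * g x) = integral {a<..<b} g"
    by (rule integral_cong) simp
  ultimately show "integral {a..b} g = 0" by (simp add: integral_open_interval_real)
qed

text \<open>
  Du Bois-Reymond's lemma. Fix a bump \<open>\<chi>\<close>. Every test function \<open>\<psi>\<close> differs from a multiple of \<open>\<chi>\<close>
  by a function of mean zero, and the primitive of the latter is again a test function. So \<open>w\<close>
  integrates against \<open>\<psi>\<close> like the constant obtained from \<open>\<chi>\<close>.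
\<close>

lemma weak_deriv_zero_imp_const:
  fixes w :: "real \<Rightarrow> complex"
  assumes S: "open S" "is_interval S" and w: "locally_integrable S w"
    and test: "\<And>\<phi>. test_function S \<phi> \<Longrightarrow>
       (LINT x|lebesgue_on S. w x * complex_of_real (frechet_derivative \<phi> (at x) 1)) = 0"
  shows "\<exists>C. AE x in lebesgue_on S. w x = C"
proof (cases "S = {}")
  case True
  then show ?thesis by (auto simp: AE_restrict_space_iff)
next
  case False
  then obtain c where "c \<in> S" by blast
  then obtain e where e: "e > 0" "cball c e \<subseteq> S" using S(1) open_contains_cball by blast
  define a b where "a = c - e" and "b = c + e"
  have ab: "a < b" "{a..b} \<subseteq> S" using e by (auto simp: a_def b_def cball_eq_atLeastAtMost)
  have mult: "integrable (lebesgue_on S) (\<lambda>x. w x * of_real (\<phi> x))"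
    if tf: "test_function S \<phi>" for \<phi>
  proof -
    obtain \<alpha> \<beta> where s: "{\<alpha>..\<beta>} \<subseteq> S" "\<And>x. x \<notin> {\<alpha>..\<beta>} \<Longrightarrow> \<phi> x = 0"
      using test_function_support[OF tf S(2) False] by metis
    have "(\<lambda>x. of_real (\<phi> x) * w x) absolutely_integrable_on {\<alpha>..\<beta>}"
      using continuous_on_subset[OF test_functionD_continuous[OF tf]] s(1)
      by (intro absolutely_integrable_continuous_mult locally_integrable_Icc[OF w] continuous_on_of_real) auto
    from lebesgue_on_integral_compact_support(1)[OF S(1) s(1) this] s(2)
    show ?thesis by (simp add: mult.commute)
  qed
  define \<chi>0 where "\<chi>0 = bump 1 a b"
  have \<chi>0: "test_function S \<chi>0" unfolding \<chi>0_def using ab by (intro test_function_bump) auto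
  define I where "I = integral {a..b} \<chi>0"
  have "I > 0"
  proof -
    have c: "continuous_on {a..b} \<chi>0"
      using test_functionD_continuous[OF \<chi>0] continuous_on_subset by blast
    have "I \<ge> 0" unfolding I_def
      using bump_bounds[of 1 a b] by (intro integral_nonneg integrable_continuous_real c) (auto simp: \<chi>0_def)
    moreover have "I \<noteq> 0"
    proof
      assume "I = 0"
      then have "(\<chi>0 has_integral 0) (cbox a b)"
        using integrable_integral[OF integrable_continuous_real[OF c]] by (simp add: I_def)
      then have "\<chi>0 c = 0"
        using c bump_bounds[of 1 a b] e(1)
        by (intro has_integral_0_cbox_imp_0[of a b \<chi>0]) (auto simp: \<chi>0_def a_def b_def)
      then show False using e(1) by (auto simp: \<chi>0_def bump_eq a_def b_def)
    qed
    ultimately show ?thesis by simp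
  qed
  define C where "C = (LINT x|lebesgue_on S. w x * of_real (\<chi>0 x)) / of_real I"
  have "AE x in lebesgue_on S. w x - C = 0"
  proof (rule AE_zero_of_test_integrals[OF S(1)])
    show "locally_integrable S (\<lambda>x. w x - C)"
      unfolding locally_integrable_def
    proof (intro allI impI, elim conjE)
      fix K assume K: "compact K" "K \<subseteq> S"
      have "(\<lambda>x. C) absolutely_integrable_on K"
        using K by (intro absolutely_integrable_on_const) (auto intro: lmeasurable_compact)
      then show "(\<lambda>x. w x - C) absolutely_integrable_on K"
        using w K by (intro set_integral_diff) (auto simp: locally_integrable_def)
    qed
  next
    fix \<psi> assume \<psi>: "test_function S \<psi>"
    obtain \<alpha>1 \<beta>1 where s1: "\<alpha>1 \<le> \<beta>1" "{\<alpha>1..\<beta>1} \<subseteq> S" "\<And>x. x \<notin> {\<alpha>1..\<beta>1} \<Longrightarrow> \<psi> x = 0"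
      using test_function_support[OF \<psi> S(2) False] by metis
    define \<alpha> \<beta> where "\<alpha> = min a \<alpha>1" and "\<beta> = max b \<beta>1"
    have "\<alpha> \<in> S" "\<beta> \<in> S" using s1 ab by (auto simp: \<alpha>_def \<beta>_def min_def max_def)
    then have sub: "{\<alpha>..\<beta>} \<subseteq> S"
      using S(2) unfolding is_interval_1 by (meson atLeastAtMost_iff subsetI)
    have le: "\<alpha> \<le> \<beta>" using s1(1) ab(1) by (auto simp: \<alpha>_def \<beta>_def)
    have supp: "\<psi> x = 0" "\<chi>0 x = 0" if "x \<notin> {\<alpha>..\<beta>}" for x
      using that s1(3)[of x] by (auto simp: \<alpha>_def \<beta>_def \<chi>0_def bump_eq min_def max_def split: if_splits)
    have c\<psi>: "continuous_on A \<psi>" and c\<chi>: "continuous_on A \<chi>0" for A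
      using test_functionD_continuous[OF \<psi>] test_functionD_continuous[OF \<chi>0]
      by (auto intro: continuous_on_subset)
    define m where "m = integral {\<alpha>..\<beta>} \<psi> / I"
    define \<theta> where "\<theta> x = \<psi> x + - m * \<chi>0 x" for x
    have c\<theta>: "continuous_on A \<theta>" for A
      unfolding \<theta>_def[abs_def] by (intro continuous_intros c\<psi> c\<chi>)
    obtain F where "\<forall>x. - \<infinity> < ereal x \<longrightarrow> ereal x < \<infinity> \<longrightarrow> (F has_vector_derivative \<theta> x) (at x)"
      using einterval_antiderivative[of "-\<infinity>" "\<infinity>" \<theta>] c\<theta>[of UNIV]
      by (auto simp: continuous_on_eq_continuous_at)
    then have F: "(F has_real_derivative \<theta> x) (at x)" for x
      by (simp add: has_real_derivative_iff_has_vector_derivative)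
    have I\<chi>: "integral {\<alpha>..\<beta>} \<chi>0 = I"
    proof -
      have "(\<chi>0 has_integral I) {a..b}"
        unfolding I_def by (intro integrable_integral integrable_continuous_real c\<chi>)
      then have "(\<chi>0 has_integral I) {\<alpha>..\<beta>}"
        by (rule has_integral_on_superset) (auto simp: \<alpha>_def \<beta>_def \<chi>0_def bump_eq)
      then show ?thesis by (rule integral_unique)
    qed
    have abs\<psi>: "(\<lambda>x. complex_of_real (\<psi> x)) absolutely_integrable_on {\<alpha>..\<beta>}"
      by (intro absolutely_integrable_continuous_real continuous_intros c\<psi>)
    note lint\<psi> = lebesgue_on_integral_compact_support[OF S(1) sub abs\<psi>]
    have "integral {\<alpha>..\<beta>} (\<lambda>x. complex_of_real (\<psi> x)) = of_real (integral {\<alpha>..\<beta>} \<psi>)"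
      using integral_linear[OF integrable_continuous_real[OF c\<psi>] bounded_linear_of_real] by (simp add: o_def)
    then have I\<psi>: "of_real (integral {\<alpha>..\<beta>} \<psi>) = (LINT x|lebesgue_on S. complex_of_real (\<psi> x))"
      using lint\<psi>(2) supp(1) by auto
    have "F \<beta> - F \<alpha> = integral {\<alpha>..\<beta>} \<theta>"
      using fundamental_theorem_of_calculus[OF le, of F \<theta>] F
      by (intro integral_unique[symmetric])
        (auto simp: has_real_derivative_iff_has_vector_derivative[symmetric] intro: has_field_derivative_at_within)
    also have "\<dots> = integral {\<alpha>..\<beta>} \<psi> + - m * I"
      unfolding \<theta>_def[abs_def] I\<chi>[symmetric] using c\<psi> c\<chi>
      by (subst integral_add) (auto intro!: integrable_continuous_real continuous_intros)
    also have "\<dots> = 0" using \<open>I > 0\<close> by (simp add: m_def)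
    finally have F\<beta>: "F \<beta> = F \<alpha>" by simp
    have const: "F x = F \<alpha>" if "x \<notin> {\<alpha>..\<beta>}" for x
    proof -
      have cF: "continuous_on A F" for A
        by (meson DERIV_isCont F continuous_at_imp_continuous_on)
      have F0: "(F has_real_derivative 0) (at y)" if "y \<notin> {\<alpha>..\<beta>}" for y
        using F[of y] supp[OF that] by (simp add: \<theta>_def)
      have 1: "F x = F \<alpha>" if "x < \<alpha>"
        by (rule DERIV_isconst_end[OF that cF, symmetric]) (auto intro: F0)
      have 2: "F x = F \<beta>" if "x > \<beta>"
        by (rule DERIV_isconst_end[OF that cF]) (auto intro: F0)
      show ?thesis using 1 2 F\<beta> that by auto
    qed
    define \<phi> where "\<phi> x = F x - F \<alpha>" for x
    have \<phi>': "(\<phi> has_real_derivative \<theta> x) (at x)" for x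
      unfolding \<phi>_def[abs_def] using F[of x] by (auto intro!: derivative_eq_intros)
    have Ck\<theta>: "Ck k \<theta>" for k
      unfolding \<theta>_def[abs_def] using \<psi> \<chi>0
      by (intro Ck_add Ck_mult Ck_const) (auto simp: test_function_def)
    have "Ck k \<phi>" for k
      by (rule Ck_Suc_imp_Ck, rule Ck_Suc_realI[OF \<phi>'], rule Ck_mult[OF Ck\<theta> Ck_const])
    then have "test_function S \<phi>"
      using sub const by (auto simp: test_function_def \<phi>_def intro!: exI[of _ "{\<alpha>..\<beta>}"])
    from test[OF this] have "(LINT x|lebesgue_on S. w x * of_real (\<theta> x)) = 0"
      by (simp add: frechet_derivative_real[OF \<phi>'])
    moreover have "(\<lambda>x. w x * of_real (\<theta> x)) =
        (\<lambda>x. w x * of_real (\<psi> x) - of_real m * (w x * of_real (\<chi>0 x)))"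
      by (simp add: \<theta>_def fun_eq_iff algebra_simps)
    ultimately have "(LINT x|lebesgue_on S. w x * of_real (\<psi> x))
        = of_real m * (LINT x|lebesgue_on S. w x * of_real (\<chi>0 x))"
      using mult[OF \<psi>] mult[OF \<chi>0] by simp
    also have "\<dots> = C * of_real (integral {\<alpha>..\<beta>} \<psi>)"
      using \<open>I > 0\<close> by (simp add: C_def m_def field_simps)
    finally have main: "(LINT x|lebesgue_on S. w x * of_real (\<psi> x))
        = C * (LINT x|lebesgue_on S. complex_of_real (\<psi> x))" unfolding I\<psi> .
    have "integrable (lebesgue_on S) (\<lambda>x. complex_of_real (\<psi> x))"
      using lint\<psi>(1) supp(1) by auto
    then show "(LINT x|lebesgue_on S. (w x - C) * of_real (\<psi> x)) = 0"
      using mult[OF \<psi>] main by (simp add: left_diff_distrib)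
  qed
  then show ?thesis by (auto elim: eventually_mono)
qed

section \<open>Weakly differentiable functions are primitives\<close>

lemma borel_representative:
  fixes g :: "real \<Rightarrow> complex"
  assumes g: "integrable lebesgue g"
  obtains h where "integrable lborel h" "AE x in lebesgue. g x = h x"
proof -
  have m: "(\<lambda>x. Re (g x)) \<in> borel_measurable lebesgue" "(\<lambda>x. Im (g x)) \<in> borel_measurable lebesgue"
    using borel_measurable_integrable[OF g] by measurable
  obtain p q where p: "p \<in> borel_measurable lborel" "AE x in lborel. Re (g x) = p x"
    and q: "q \<in> borel_measurable lborel" "AE x in lborel. Im (g x) = q x"
    using completion_ex_borel_measurable_real[OF m(1)] completion_ex_borel_measurable_real[OF m(2)]
    by blast
  define h where "h x = Complex (p x) (q x)" for x
  have hm: "h \<in> borel_measurable lborel"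
    using p(1) q(1) unfolding h_def[abs_def] Complex_eq by measurable
  have ae: "AE x in lebesgue. g x = h x"
    using AE_completion[OF p(2)] AE_completion[OF q(2)]
    by eventually_elim (simp add: h_def complex_eq_iff)
  have "integrable lebesgue h"
    using g integrable_cong_AE[OF borel_measurable_integrable[OF g] measurable_completion[OF hm] ae] by simp
  then have "integrable lborel h" using integrable_completion[OF hm] by simp
  then show thesis using ae that by blast
qed

lemma integral_Icc_borel_representative:
  fixes g :: "real \<Rightarrow> complex"
  assumes g: "g absolutely_integrable_on {s..t}"
    and h: "integrable lborel h" "AE x in lebesgue. indicat_real {s..t} x *\<^sub>R g x = h x"
    and x: "x \<le> t"
  shows "integral {s..x} g = (LINT y|lborel. (if y \<le> x then h y else 0))"
proof -
  have gx: "g absolutely_integrable_on {s..x}"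
    using g by (rule set_integrable_subset) (use x in auto)
  have m: "(\<lambda>y. if y \<le> x then h y else 0) \<in> borel_measurable lborel"
    using borel_measurable_integrable[OF h(1)] by measurable
  have "integral {s..x} g = (LINT y|lebesgue. indicat_real {s..x} y *\<^sub>R g y)"
    using set_lebesgue_integral_eq_integral(2)[OF gx] by (simp add: set_lebesgue_integral_def)
  also have "\<dots> = (LINT y|lebesgue. (if y \<le> x then h y else 0))"
  proof (rule integral_cong_AE)
    show "(\<lambda>y. indicat_real {s..x} y *\<^sub>R g y) \<in> borel_measurable lebesgue"
      using gx unfolding set_integrable_def by (rule borel_measurable_integrable)
    show "(\<lambda>y. if y \<le> x then h y else 0) \<in> borel_measurable lebesgue"
      using m by (rule measurable_completion)
    show "AE y in lebesgue. indicat_real {s..x} y *\<^sub>R g y = (if y \<le> x then h y else 0)"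
      using h(2) by eventually_elim (use x in \<open>auto simp: indicator_def split: if_splits\<close>)
  qed
  also have "\<dots> = (LINT y|lborel. (if y \<le> x then h y else 0))"
    by (rule integral_completion[OF m])
  finally show ?thesis .
qed

text \<open>
  Integration by parts for primitives of integrable functions: the two summands are the integrals of
  \<open>u y * v x\<close> over the triangles below and above the diagonal.
\<close>

lemma fubini_triangle:
  fixes u v :: "real \<Rightarrow> complex"
  assumes u: "integrable lborel u" and v: "integrable lborel v"
  defines "A \<equiv> \<lambda>x. LINT y|lborel. (if y \<le> x then u y else 0)"
    and "B \<equiv> \<lambda>x. LINT y|lborel. (if y \<le> x then v y else 0)"
  shows "integrable lborel (\<lambda>x. A x * v x)" "integrable lborel (\<lambda>x. u x * B x)"
    "(LINT x|lborel. A x * v x) + (LINT x|lborel. u x * B x) = integral\<^sup>L lborel u * integral\<^sup>L lborel v"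
proof -
  have [measurable]: "u \<in> borel_measurable borel" "v \<in> borel_measurable borel"
    using borel_measurable_integrable[OF u] borel_measurable_integrable[OF v] by simp_all
  have cut: "integrable lborel (\<lambda>y. if P y then w y else 0)"
    if w: "integrable lborel w" and P: "Measurable.pred borel P" for P and w :: "real \<Rightarrow> complex"
  proof (rule Bochner_Integration.integrable_bound[OF w])
    show "(\<lambda>y. if P y then w y else 0) \<in> borel_measurable lborel"
      using borel_measurable_integrable[OF w] P by measurable
  qed auto
  let ?f = "\<lambda>(x, y). (if y \<le> x then u y else 0) * v x"
  have f: "integrable (lborel \<Otimes>\<^sub>M lborel) ?f"
  proof (rule lborel_pair.Fubini_integrable)
    show "?f \<in> borel_measurable (lborel \<Otimes>\<^sub>M lborel)" by measurable
    have "integrable lborel (\<lambda>x. norm (v x) * (LINT y|lborel. norm (u y)))"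
      using v by simp
    then show "integrable lborel (\<lambda>x. LINT y|lborel. norm (?f (x, y)))"
    proof (rule Bochner_Integration.integrable_bound)
      show "(\<lambda>x. LINT y|lborel. norm (?f (x, y))) \<in> borel_measurable lborel" by measurable
      show "AE x in lborel. norm (LINT y|lborel. norm (?f (x, y)))
          \<le> norm (norm (v x) * (LINT y|lborel. norm (u y)))"
      proof (rule AE_I2)
        fix x
        have "(LINT y|lborel. norm (if y \<le> x then u y else 0)) \<le> (LINT y|lborel. norm (u y))"
          by (intro integral_mono integrable_norm cut u) auto
        then have "(LINT y|lborel. norm (if y \<le> x then u y else 0)) * norm (v x)
            \<le> (LINT y|lborel. norm (u y)) * norm (v x)" by (rule mult_right_mono) simp
        then show "norm (LINT y|lborel. norm (?f (x, y))) \<le> norm (norm (v x) * (LINT y|lborel. norm (u y)))"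
          by (simp add: norm_mult mult.commute abs_mult)
      qed
    qed
    show "AE x in lborel. integrable lborel (\<lambda>y. ?f (x, y))"
      by (auto intro!: AE_I2 cut u integrable_mult_left)
  qed
  have "integrable lborel (\<lambda>x. LINT y|lborel. (if y \<le> x then u y else 0) * v x)"
    using lborel_pair.integrable_fst[OF f] by simp
  then show iA: "integrable lborel (\<lambda>x. A x * v x)" unfolding A_def
    by (simp add: integral_mult_left_zero)
  have tail: "(LINT x|lborel. (if y \<le> x then v x else 0)) = integral\<^sup>L lborel v - B y" for y
  proof -
    have "(LINT x|lborel. (if y \<le> x then v x else 0))
        = (LINT x|lborel. v x - (if x \<le> y then v x else 0))"
    proof (rule integral_cong_AE)
      show "AE x in lborel. (if y \<le> x then v x else 0) = v x - (if x \<le> y then v x else 0)"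
        using AE_lborel_singleton[of y] by eventually_elim auto
    qed measurable
    also have "\<dots> = integral\<^sup>L lborel v - B y"
      unfolding B_def by (intro Bochner_Integration.integral_diff v cut) measurable
    finally show ?thesis .
  qed
  have eq: "(LINT x|lborel. (if y \<le> x then u y else 0) * v x) = u y * (integral\<^sup>L lborel v - B y)" for y
  proof -
    have "(LINT x|lborel. (if y \<le> x then u y else 0) * v x)
        = (LINT x|lborel. u y * (if y \<le> x then v x else 0))"
      by (rule Bochner_Integration.integral_cong) auto
    then show ?thesis by (simp add: tail)
  qed
  have "integrable lborel (\<lambda>y. LINT x|lborel. (if y \<le> x then u y else 0) * v x)"
    using lborel_pair.integrable_snd[of "\<lambda>x y. (if y \<le> x then u y else 0) * v x"] f by simp
  then have iB': "integrable lborel (\<lambda>y. u y * (integral\<^sup>L lborel v - B y))" by (simp only: eq)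
  have iu: "integrable lborel (\<lambda>y. u y * integral\<^sup>L lborel v)" using u by simp
  from Bochner_Integration.integrable_diff[OF iu iB']
  show iB: "integrable lborel (\<lambda>x. u x * B x)" by (simp add: algebra_simps)
  have "(LINT x|lborel. A x * v x) = (LINT x|lborel. LINT y|lborel. (if y \<le> x then u y else 0) * v x)"
    unfolding A_def by (simp add: integral_mult_left_zero)
  also have "\<dots> = (LINT y|lborel. LINT x|lborel. (if y \<le> x then u y else 0) * v x)"
    using lborel_pair.Fubini_integral[of "\<lambda>x y. (if y \<le> x then u y else 0) * v x"] f by simp
  also have "\<dots> = (LINT y|lborel. u y * integral\<^sup>L lborel v - u y * B y)"
    by (simp add: eq right_diff_distrib)
  also have "\<dots> = integral\<^sup>L lborel u * integral\<^sup>L lborel v - (LINT y|lborel. u y * B y)"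
    using Bochner_Integration.integral_diff[OF iu iB] by simp
  finally show "(LINT x|lborel. A x * v x) + (LINT x|lborel. u x * B x)
      = integral\<^sup>L lborel u * integral\<^sup>L lborel v" by simp
qed

text \<open>
  Local absolute continuity of \<open>U\<close>, expressed through its derivative \<open>u\<close>, which matters only up to null
  sets.
\<close>

definition primitive_on :: "real set \<Rightarrow> (real \<Rightarrow> complex) \<Rightarrow> (real \<Rightarrow> complex) \<Rightarrow> bool" where
  "primitive_on S U u \<longleftrightarrow> (\<forall>s\<in>S. \<forall>t\<in>S. s \<le> t \<longrightarrow>
     u absolutely_integrable_on {s..t} \<and> U t - U s = integral {s..t} u)"

lemma primitive_onD:
  assumes "primitive_on S U u" "s \<in> S" "t \<in> S" "s \<le> t"
  shows "u absolutely_integrable_on {s..t}" "U t - U s = integral {s..t} u"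
  using assms by (auto simp: primitive_on_def)

lemma Icc_subset_interval: "is_interval S \<Longrightarrow> s \<in> S \<Longrightarrow> t \<in> S \<Longrightarrow> {s..t} \<subseteq> (S :: real set)"
  unfolding is_interval_1 by (meson atLeastAtMost_iff subsetI)

lemma primitive_on_continuous:
  assumes S: "open S" "is_interval S" and U: "primitive_on S U u"
  shows "continuous_on S U"
proof (rule continuous_at_imp_continuous_on, rule ballI)
  fix x assume "x \<in> S"
  then obtain e where e: "e > 0" "cball x e \<subseteq> S" using S(1) open_contains_cball by blast
  let ?s = "x - e" and ?t = "x + e"
  have st: "?s \<in> S" "?t \<in> S" "?s \<le> ?t" using e by (auto simp: cball_eq_atLeastAtMost)
  have "u integrable_on {?s..?t}"
    using primitive_onD(1)[OF U st] set_lebesgue_integral_eq_integral(1) by blast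
  then have "continuous_on {?s..?t} (\<lambda>y. U ?s + integral {?s..y} u)"
    by (intro continuous_intros indefinite_integral_continuous_1)
  moreover have "U ?s + integral {?s..y} u = U y" if "y \<in> {?s..?t}" for y
    using primitive_onD(2)[OF U st(1), of y] that subsetD[OF Icc_subset_interval[OF S(2) st(1,2)], of y]
    by (auto simp: algebra_simps)
  ultimately have "continuous_on {?s..?t} U" by (rule continuous_on_eq)
  then have "continuous_on {?s<..<?t} U" by (rule continuous_on_subset) auto
  then show "isCont U x" using e(1) by (simp add: continuous_on_eq_continuous_at)
qed

lemma primitive_on_mult:
  assumes S: "open S" "is_interval S" and U: "primitive_on S U u" and V: "primitive_on S V v"
  shows "primitive_on S (\<lambda>x. U x * V x) (\<lambda>x. U x * v x + u x * V x)"
  unfolding primitive_on_def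
proof (intro ballI impI)
  fix s t assume st: "s \<in> S" "t \<in> S" "s \<le> t"
  have sub: "{s..t} \<subseteq> S" using S(2) st by (intro Icc_subset_interval)
  note ui = primitive_onD(1)[OF U st] and vi = primitive_onD(1)[OF V st]
  have contU: "continuous_on {s..t} U" and contV: "continuous_on {s..t} V"
    using primitive_on_continuous[OF S] U V sub continuous_on_subset by blast+
  have Uv: "(\<lambda>x. U x * v x) absolutely_integrable_on {s..t}"
    by (rule absolutely_integrable_continuous_mult[OF vi contU])
  have uV: "(\<lambda>x. u x * V x) absolutely_integrable_on {s..t}"
    using absolutely_integrable_continuous_mult[OF ui contV] by (simp add: mult.commute)
  have "integrable lebesgue (\<lambda>x. indicat_real {s..t} x *\<^sub>R u x)" using ui by (simp add: set_integrable_def)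
  then obtain u0 where u0: "integrable lborel u0" "AE x in lebesgue. indicat_real {s..t} x *\<^sub>R u x = u0 x"
    by (rule borel_representative)
  have "integrable lebesgue (\<lambda>x. indicat_real {s..t} x *\<^sub>R v x)" using vi by (simp add: set_integrable_def)
  then obtain v0 where v0: "integrable lborel v0" "AE x in lebesgue. indicat_real {s..t} x *\<^sub>R v x = v0 x"
    by (rule borel_representative)
  define A B where "A x = (LINT y|lborel. (if y \<le> x then u0 y else 0))"
    and "B x = (LINT y|lborel. (if y \<le> x then v0 y else 0))" for x
  have A: "A x = U x - U s" if "x \<in> {s..t}" for x
    using integral_Icc_borel_representative[OF ui u0, of x] primitive_onD(2)[OF U st(1), of x] that sub
    by (auto simp: A_def)
  have B: "B x = V x - V s" if "x \<in> {s..t}" for x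
    using integral_Icc_borel_representative[OF vi v0, of x] primitive_onD(2)[OF V st(1), of x] that sub
    by (auto simp: B_def)
  note fub = fubini_triangle[OF u0(1) v0(1), folded A_def B_def]
  have transfer: "integral\<^sup>L lborel h = integral {s..t} g"
    if h: "integrable lborel h" and g: "g absolutely_integrable_on {s..t}"
      and ae: "AE x in lebesgue. indicat_real {s..t} x *\<^sub>R g x = h x"
    for g h :: "real \<Rightarrow> complex"
  proof -
    have "integral\<^sup>L lborel h = integral\<^sup>L lebesgue h"
      using borel_measurable_integrable[OF h] by (rule integral_completion[symmetric])
    also have "\<dots> = (LINT x|lebesgue. indicat_real {s..t} x *\<^sub>R g x)"
    proof (rule integral_cong_AE)
      show "h \<in> borel_measurable lebesgue"
        using borel_measurable_integrable[OF h] by (rule measurable_completion)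
      show "(\<lambda>x. indicat_real {s..t} x *\<^sub>R g x) \<in> borel_measurable lebesgue"
        using g unfolding set_integrable_def by (rule borel_measurable_integrable)
      show "AE x in lebesgue. h x = indicat_real {s..t} x *\<^sub>R g x"
        using ae by eventually_elim simp
    qed
    also have "\<dots> = integral {s..t} g"
      using set_lebesgue_integral_eq_integral(2)[OF g] by (simp add: set_lebesgue_integral_def)
    finally show ?thesis .
  qed
  have iu: "integral\<^sup>L lborel u0 = U t - U s"
    using transfer[OF u0(1) ui u0(2)] primitive_onD(2)[OF U st] by simp
  have iv: "integral\<^sup>L lborel v0 = V t - V s"
    using transfer[OF v0(1) vi v0(2)] primitive_onD(2)[OF V st] by simp
  have Av: "(\<lambda>x. (U x - U s) * v x) absolutely_integrable_on {s..t}"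
    by (intro absolutely_integrable_continuous_mult[OF vi] continuous_intros contU)
  have uB: "(\<lambda>x. u x * (V x - V s)) absolutely_integrable_on {s..t}"
    using absolutely_integrable_continuous_mult[OF ui, of "\<lambda>x. V x - V s"] contV
    by (simp add: mult.commute continuous_intros)
  have "integral {s..t} (\<lambda>x. (U x - U s) * v x) = (LINT x|lborel. A x * v0 x)"
    by (rule transfer[OF fub(1) Av, symmetric], use v0(2) in eventually_elim)
       (auto simp: A indicator_def split: if_splits)
  moreover have "integral {s..t} (\<lambda>x. u x * (V x - V s)) = (LINT x|lborel. u0 x * B x)"
    by (rule transfer[OF fub(2) uB, symmetric], use u0(2) in eventually_elim)
       (auto simp: B indicator_def split: if_splits)
  ultimately have main: "integral {s..t} (\<lambda>x. (U x - U s) * v x) + integral {s..t} (\<lambda>x. u x * (V x - V s))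
      = (U t - U s) * (V t - V s)"
    using fub(3) iu iv by simp
  have int: "g integrable_on {s..t}" if "g absolutely_integrable_on {s..t}" for g :: "real \<Rightarrow> complex"
    using that set_lebesgue_integral_eq_integral(1) by blast
  have e1: "integral {s..t} (\<lambda>x. (U x - U s) * v x) = integral {s..t} (\<lambda>x. U x * v x) - U s * (V t - V s)"
    using integral_diff[OF int[OF Uv] integrable_on_mult_right[OF int[OF vi], of "U s"]]
      primitive_onD(2)[OF V st] by (simp add: left_diff_distrib)
  have e2: "integral {s..t} (\<lambda>x. u x * (V x - V s)) = integral {s..t} (\<lambda>x. u x * V x) - (U t - U s) * V s"
    using integral_diff[OF int[OF uV] integrable_on_mult_left[OF int[OF ui], of "V s"]]
      primitive_onD(2)[OF U st] by (simp add: right_diff_distrib)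
  have "integral {s..t} (\<lambda>x. U x * v x) + integral {s..t} (\<lambda>x. u x * V x) = U t * V t - U s * V s"
    using main unfolding e1 e2 by (simp add: left_diff_distrib right_diff_distrib) (simp add: algebra_simps)
  then show "(\<lambda>x. U x * v x + u x * V x) absolutely_integrable_on {s..t} \<and>
      U t * V t - U s * V s = integral {s..t} (\<lambda>x. U x * v x + u x * V x)"
    using set_integral_add(1)[OF Uv uV] integral_add[OF int[OF Uv] int[OF uV]] by simp
qed

lemma primitive_on_linear:
  assumes h: "bounded_linear h" and U: "primitive_on S U u"
  shows "primitive_on S (\<lambda>x. h (U x)) (\<lambda>x. h (u x))"
  unfolding primitive_on_def
proof (intro ballI impI)
  fix s t assume st: "s \<in> S" "t \<in> S" "s \<le> t"
  note u = primitive_onD[OF U st]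
  show "(\<lambda>x. h (u x)) absolutely_integrable_on {s..t} \<and>
      h (U t) - h (U s) = integral {s..t} (\<lambda>x. h (u x))"
    using absolutely_integrable_linear[OF u(1) h] integral_linear[OF set_lebesgue_integral_eq_integral(1)[OF u(1)] h]
    by (simp add: o_def u(2)[symmetric] bounded_linear.linear[OF h] linear_diff)
qed

lemma primitive_on_cnj: "primitive_on S U u \<Longrightarrow> primitive_on S (\<lambda>x. cnj (U x)) (\<lambda>x. cnj (u x))"
  by (rule primitive_on_linear[OF bounded_linear_cnj])

lemma primitive_on_C1:
  assumes S: "is_interval S" and f: "\<And>x. x \<in> S \<Longrightarrow> (f has_real_derivative f' x) (at x)"
    and f': "continuous_on S f'"
  shows "primitive_on S (\<lambda>x. complex_of_real (f x)) (\<lambda>x. complex_of_real (f' x))"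
  unfolding primitive_on_def
proof (intro ballI impI conjI)
  fix s t assume st: "s \<in> S" "t \<in> S" "s \<le> t"
  have sub: "{s..t} \<subseteq> S" by (rule Icc_subset_interval[OF S st(1,2)])
  have c: "continuous_on {s..t} f'" using f' sub by (rule continuous_on_subset)
  show "(\<lambda>x. complex_of_real (f' x)) absolutely_integrable_on {s..t}"
    by (intro absolutely_integrable_continuous_real continuous_intros c)
  have "((\<lambda>x. complex_of_real (f' x)) has_integral complex_of_real (f t) - complex_of_real (f s)) {s..t}"
  proof (rule fundamental_theorem_of_calculus[OF st(3)])
    fix x assume "x \<in> {s..t}"
    then have "(f has_vector_derivative f' x) (at x)"
      using f sub by (auto simp: has_real_derivative_iff_has_vector_derivative[symmetric])
    from bounded_linear.has_vector_derivative[OF bounded_linear_of_real this]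
    show "((\<lambda>x. complex_of_real (f x)) has_vector_derivative complex_of_real (f' x)) (at x within {s..t})"
      by (rule has_vector_derivative_at_within)
  qed
  then show "complex_of_real (f t) - complex_of_real (f s) = integral {s..t} (\<lambda>x. complex_of_real (f' x))"
    by (rule integral_unique[symmetric])
qed

lemma locally_integrableI_Icc:
  fixes f :: "real \<Rightarrow> complex"
  assumes S: "is_interval S"
    and f: "\<And>s t. s \<in> S \<Longrightarrow> t \<in> S \<Longrightarrow> s \<le> t \<Longrightarrow> f absolutely_integrable_on {s..t}"
  shows "locally_integrable S f"
  unfolding locally_integrable_def
proof (intro allI impI, elim conjE)
  fix K :: "real set" assume K: "compact K" "K \<subseteq> S"
  show "f absolutely_integrable_on K"
  proof (cases "K = {}")
    case False
    obtain s where s: "s \<in> K" "\<And>x. x \<in> K \<Longrightarrow> s \<le> x" using compact_attains_inf[OF K(1) False] by blast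
    obtain t where t: "t \<in> K" "\<And>x. x \<in> K \<Longrightarrow> x \<le> t" using compact_attains_sup[OF K(1) False] by blast
    have "f absolutely_integrable_on {s..t}" using s t K(2) by (intro f) auto
    then show ?thesis
      by (rule set_integrable_subset) (use s t K(1) in \<open>auto intro: fmeasurableD lmeasurable_compact\<close>)
  qed simp
qed

lemma locally_integrable_continuous:
  fixes f :: "real \<Rightarrow> complex"
  assumes "is_interval S" "continuous_on S f" shows "locally_integrable S f"
  using assms
  by (intro locally_integrableI_Icc absolutely_integrable_continuous_real)
    (auto intro: continuous_on_subset dest: Icc_subset_interval)

lemma frechet_derivative_zero_outside:
  fixes \<phi> :: "real \<Rightarrow> real"
  assumes "\<And>x. x \<notin> {\<alpha>..\<beta>} \<Longrightarrow> \<phi> x = 0" "x \<notin> {\<alpha>..\<beta>}"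
  shows "frechet_derivative \<phi> (at x) 1 = 0"
proof -
  have "\<forall>\<^sub>F y in nhds x. y \<in> - {\<alpha>..\<beta>}"
    using assms(2) by (intro eventually_nhds_in_open) (auto simp: closed_def[symmetric])
  then have "\<forall>\<^sub>F y in nhds x. \<phi> y = 0" by eventually_elim (simp add: assms(1))
  then have "(\<phi> has_real_derivative 0) (at x)"
    using DERIV_cong_ev[of x x \<phi> "\<lambda>x. 0" 0 0] by simp
  then show ?thesis by (simp add: frechet_derivative_real)
qed

lemma has_weak_derivD:
  assumes "has_weak_deriv S e u g"
  shows "locally_integrable S u" "locally_integrable S g"
    "\<And>\<phi>. test_function S \<phi> \<Longrightarrow> (LINT x|lebesgue_on S. u x * complex_of_real (frechet_derivative \<phi> (at x) e))
      = - (LINT x|lebesgue_on S. g x * complex_of_real (\<phi> x))"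
  using assms unfolding has_weak_deriv_def by blast+

lemma has_weak_deriv_primitive:
  assumes S: "open S" "is_interval S" and U: "primitive_on S U u"
  shows "has_weak_deriv S 1 U u"
  unfolding has_weak_deriv_def
proof (intro conjI allI impI)
  have contU: "continuous_on S U" using primitive_on_continuous[OF S U] .
  show "locally_integrable S U" by (rule locally_integrable_continuous[OF S(2) contU])
  show "locally_integrable S u" by (rule locally_integrableI_Icc[OF S(2) primitive_onD(1)[OF U]])
  fix \<phi> assume \<phi>: "test_function S \<phi>"
  show "(LINT x|lebesgue_on S. U x * complex_of_real (frechet_derivative \<phi> (at x) 1))
      = - (LINT x|lebesgue_on S. u x * complex_of_real (\<phi> x))"
  proof (cases "S = {}")
    case True
    have "space (lebesgue_on S) = {}" using True by simp
    then show ?thesis by (simp only: Bochner_Integration.integral_empty minus_zero)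
  next
    case False
    obtain \<alpha>0 \<beta>0 where s0: "\<alpha>0 \<le> \<beta>0" "{\<alpha>0..\<beta>0} \<subseteq> S" "\<And>x. x \<notin> {\<alpha>0..\<beta>0} \<Longrightarrow> \<phi> x = 0"
      using test_function_support[OF \<phi> S(2) False] by metis
    obtain d e where de: "d > 0" "cball \<alpha>0 d \<subseteq> S" "e > 0" "cball \<beta>0 e \<subseteq> S"
      using S(1) s0(1,2) open_contains_cball by (metis atLeastAtMost_iff order_refl subsetD)
    \<comment> \<open>Enlarging the interval makes \<open>\<phi>\<close> vanish at its end points.\<close>
    define \<alpha> \<beta> where "\<alpha> = \<alpha>0 - d" and "\<beta> = \<beta>0 + e"
    have ab: "\<alpha> \<in> S" "\<beta> \<in> S" "\<alpha> \<le> \<beta>"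
      using de s0(1) by (auto simp: \<alpha>_def \<beta>_def cball_eq_atLeastAtMost)
    have sub: "{\<alpha>..\<beta>} \<subseteq> S" by (rule Icc_subset_interval[OF S(2) ab(1,2)])
    have z: "\<phi> \<alpha> = 0" "\<phi> \<beta> = 0" using s0(3) de by (auto simp: \<alpha>_def \<beta>_def)
    obtain \<phi>' where \<phi>': "\<And>x. (\<phi> has_real_derivative \<phi>' x) (at x)" "continuous_on UNIV \<phi>'"
      "\<And>x. frechet_derivative \<phi> (at x) 1 = \<phi>' x"
      using test_function_deriv[OF \<phi>] by metis
    have out: "\<phi> x = 0" "\<phi>' x = 0" if "x \<notin> {\<alpha>..\<beta>}" for x
    proof -
      have "x \<notin> {\<alpha>0..\<beta>0}" using that de by (auto simp: \<alpha>_def \<beta>_def)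
      then show "\<phi> x = 0" "\<phi>' x = 0"
        using s0(3) frechet_derivative_zero_outside[of \<alpha>0 \<beta>0 \<phi> x] \<phi>'(3) by auto
    qed
    have c\<phi>: "continuous_on A \<phi>" and c\<phi>': "continuous_on A \<phi>'" for A
      using test_functionD_continuous[OF \<phi>] \<phi>'(2) by (auto intro: continuous_on_subset)
    have prim: "primitive_on S (\<lambda>x. complex_of_real (\<phi> x)) (\<lambda>x. complex_of_real (\<phi>' x))"
      by (rule primitive_on_C1[OF S(2) \<phi>'(1) c\<phi>'])
    have a1: "(\<lambda>x. U x * complex_of_real (\<phi>' x)) absolutely_integrable_on {\<alpha>..\<beta>}"
      by (intro absolutely_integrable_continuous_real continuous_intros c\<phi>' continuous_on_subset[OF contU sub])
    have a2: "(\<lambda>x. u x * complex_of_real (\<phi> x)) absolutely_integrable_on {\<alpha>..\<beta>}"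
      using absolutely_integrable_continuous_mult[OF primitive_onD(1)[OF U ab], of "\<lambda>x. complex_of_real (\<phi> x)"]
        c\<phi> by (simp add: mult.commute continuous_on_of_real)
    have "integral {\<alpha>..\<beta>} (\<lambda>x. U x * complex_of_real (\<phi>' x) + u x * complex_of_real (\<phi> x)) = 0"
      using primitive_onD(2)[OF primitive_on_mult[OF S U prim] ab] z by simp
    then have "integral {\<alpha>..\<beta>} (\<lambda>x. U x * complex_of_real (\<phi>' x))
        = - integral {\<alpha>..\<beta>} (\<lambda>x. u x * complex_of_real (\<phi> x))"
      using integral_add[OF set_lebesgue_integral_eq_integral(1)[OF a1] set_lebesgue_integral_eq_integral(1)[OF a2]]
      by (simp add: eq_neg_iff_add_eq_0)
    then show ?thesis
      using lebesgue_on_integral_compact_support(2)[OF S(1) sub a1]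
        lebesgue_on_integral_compact_support(2)[OF S(1) sub a2] out by (simp add: \<phi>'(3))
  qed
qed

lemma primitive_on_indefinite:
  assumes S: "open S" "is_interval S" and g: "locally_integrable S g" and c: "c \<in> S"
  shows "primitive_on S (\<lambda>x. if c \<le> x then integral {c..x} g else - integral {x..c} g) g"
  unfolding primitive_on_def
proof (intro ballI impI conjI)
  fix s t assume st: "s \<in> S" "t \<in> S" "s \<le> t"
  have a: "g absolutely_integrable_on {x..y}" if "x \<in> S" "y \<in> S" for x y
    using that by (intro locally_integrable_Icc[OF g] Icc_subset_interval[OF S(2)])
  then have i: "g integrable_on {x..y}" if "x \<in> S" "y \<in> S" for x y
    using that set_lebesgue_integral_eq_integral(1) by blast
  show "g absolutely_integrable_on {s..t}" by (rule a[OF st(1,2)])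
  consider "c \<le> s" | "s < c" "c \<le> t" | "t < c" by linarith
  then show "(if c \<le> t then integral {c..t} g else - integral {t..c} g)
      - (if c \<le> s then integral {c..s} g else - integral {s..c} g) = integral {s..t} g"
  proof cases
    case 1
    then show ?thesis
      using Henstock_Kurzweil_Integration.integral_combine[OF 1 st(3) i[OF c st(2)]] st(3) by (simp add: algebra_simps)
  next
    case 2
    then show ?thesis
      using Henstock_Kurzweil_Integration.integral_combine[of s c t g] i[OF st(1,2)] by (simp add: algebra_simps)
  next
    case 3
    then show ?thesis
      using Henstock_Kurzweil_Integration.integral_combine[of s t c g] i[OF st(1) c] st(3) by (simp add: algebra_simps)
  qed
qed

lemma integrable_test_mult:
  fixes w :: "real \<Rightarrow> complex"
  assumes S: "open S" "is_interval S" and w: "locally_integrable S w"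
    and f: "continuous_on UNIV f" "{\<alpha>..\<beta>} \<subseteq> S" "\<And>x. x \<notin> {\<alpha>..\<beta>} \<Longrightarrow> f x = 0"
  shows "integrable (lebesgue_on S) (\<lambda>x. w x * complex_of_real (f x))"
proof -
  have "(\<lambda>x. of_real (f x) * w x) absolutely_integrable_on {\<alpha>..\<beta>}"
    using continuous_on_subset[OF f(1)]
    by (intro absolutely_integrable_continuous_mult locally_integrable_Icc[OF w f(2)] continuous_on_of_real) auto
  from lebesgue_on_integral_compact_support(1)[OF S(1) f(2) this] f(3)
  show ?thesis by (simp add: mult.commute)
qed

lemma locally_integrable_diff:
  "locally_integrable S f \<Longrightarrow> locally_integrable S g \<Longrightarrow> locally_integrable S (\<lambda>x. f x - g x)"
  by (auto simp: locally_integrable_def intro: set_integral_diff(1))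

text \<open>
  The difference of \<open>u\<close> and a primitive of \<open>g\<close> has weak derivative zero, hence is constant.
\<close>

lemma has_weak_deriv_imp_primitive:
  assumes S: "open S" "is_interval S" "S \<noteq> {}" and u: "has_weak_deriv S 1 u g"
  obtains U where "primitive_on S U g" "AE x in lebesgue_on S. u x = U x"
proof -
  obtain c where c: "c \<in> S" using S(3) by blast
  note lu = has_weak_derivD(1)[OF u] and lg = has_weak_derivD(2)[OF u]
  define G where "G x = (if c \<le> x then integral {c..x} g else - integral {x..c} g)" for x
  have G: "primitive_on S G g"
    unfolding G_def[abs_def] by (rule primitive_on_indefinite[OF S(1,2) lg c])
  have wG: "has_weak_deriv S 1 G g" by (rule has_weak_deriv_primitive[OF S(1,2) G])
  note lG = has_weak_derivD(1)[OF wG]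
  have "\<exists>C. AE x in lebesgue_on S. u x - G x = C"
  proof (rule weak_deriv_zero_imp_const[OF S(1,2) locally_integrable_diff[OF lu lG]])
    fix \<phi> assume \<phi>: "test_function S \<phi>"
    obtain \<alpha> \<beta> where s: "\<alpha> \<le> \<beta>" "{\<alpha>..\<beta>} \<subseteq> S" "\<And>x. x \<notin> {\<alpha>..\<beta>} \<Longrightarrow> \<phi> x = 0"
      using test_function_support[OF \<phi> S(2,3)] by metis
    obtain \<phi>' where \<phi>': "\<And>x. (\<phi> has_real_derivative \<phi>' x) (at x)" "continuous_on UNIV \<phi>'"
      "\<And>x. frechet_derivative \<phi> (at x) 1 = \<phi>' x"
      using test_function_deriv[OF \<phi>] by metis
    have out: "\<phi>' x = 0" if "x \<notin> {\<alpha>..\<beta>}" for x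
      using frechet_derivative_zero_outside[of \<alpha> \<beta> \<phi> x] s(3) that \<phi>'(3) by metis
    have "integrable (lebesgue_on S) (\<lambda>x. u x * complex_of_real (\<phi>' x))"
      "integrable (lebesgue_on S) (\<lambda>x. G x * complex_of_real (\<phi>' x))"
      using integrable_test_mult[OF S(1,2) lu \<phi>'(2) s(2) out] integrable_test_mult[OF S(1,2) lG \<phi>'(2) s(2) out]
      by auto
    moreover have "(LINT x|lebesgue_on S. u x * complex_of_real (\<phi>' x))
        = (LINT x|lebesgue_on S. G x * complex_of_real (\<phi>' x))"
      using has_weak_derivD(3)[OF u \<phi>] has_weak_derivD(3)[OF wG \<phi>] by (simp add: \<phi>'(3))
    ultimately show "(LINT x|lebesgue_on S. (u x - G x) * complex_of_real (frechet_derivative \<phi> (at x) 1)) = 0"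
      by (simp add: \<phi>'(3) left_diff_distrib)
  qed
  then obtain C where C: "AE x in lebesgue_on S. u x - G x = C" by blast
  have "primitive_on S (\<lambda>x. G x + C) g" using G by (simp add: primitive_on_def)
  moreover have "AE x in lebesgue_on S. u x = G x + C"
    using C by eventually_elim (simp add: algebra_simps)
  ultimately show thesis by (rule that)
qed

lemma has_weak_deriv_unique:
  fixes u :: "real \<Rightarrow> complex"
  assumes S: "open S" "is_interval S" and g: "has_weak_deriv S 1 u g" and h: "has_weak_deriv S 1 u h"
  shows "AE x in lebesgue_on S. g x = h x"
proof (cases "S = {}")
  case False
  note lg = has_weak_derivD(2)[OF g] and lh = has_weak_derivD(2)[OF h]
  have "AE x in lebesgue_on S. g x - h x = 0"
  proof (rule AE_zero_of_test_integrals[OF S(1) locally_integrable_diff[OF lg lh]])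
    fix \<phi> assume \<phi>: "test_function S \<phi>"
    obtain \<alpha> \<beta> where s: "\<alpha> \<le> \<beta>" "{\<alpha>..\<beta>} \<subseteq> S" "\<And>x. x \<notin> {\<alpha>..\<beta>} \<Longrightarrow> \<phi> x = 0"
      using test_function_support[OF \<phi> S(2) False] by metis
    note c = test_functionD_continuous[OF \<phi>]
    have "integrable (lebesgue_on S) (\<lambda>x. g x * complex_of_real (\<phi> x))"
      "integrable (lebesgue_on S) (\<lambda>x. h x * complex_of_real (\<phi> x))"
      using integrable_test_mult[OF S lg c s(2,3)] integrable_test_mult[OF S lh c s(2,3)] by auto
    then show "(LINT x|lebesgue_on S. (g x - h x) * complex_of_real (\<phi> x)) = 0"
      using has_weak_derivD(3)[OF g \<phi>] has_weak_derivD(3)[OF h \<phi>] by (simp add: left_diff_distrib)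
  qed
  then show ?thesis by eventually_elim simp
qed (auto simp: AE_restrict_space_iff)

lemma weak_deriv_works:
  fixes u :: "real \<Rightarrow> complex"
  assumes S: "open S" "is_interval S" and g: "has_weak_deriv S 1 u g"
  shows "has_weak_deriv S 1 u (weak_deriv S 1 u)"
    and "AE x in lebesgue_on S. weak_deriv S 1 u x = g x"
proof -
  show "has_weak_deriv S 1 u (weak_deriv S 1 u)"
    unfolding weak_deriv_def by (rule someI[of "has_weak_deriv S 1 u", OF g])
  from has_weak_deriv_unique[OF S this g] show "AE x in lebesgue_on S. weak_deriv S 1 u x = g x" .
qed

section \<open>A positive solution of the eigenvalue equation gives the lowest eigenvalue\<close>

lemma measurable_lebesgue_on_AE:
  fixes f g :: "real \<Rightarrow> complex"
  assumes S: "S \<in> sets lebesgue" and f: "f \<in> borel_measurable (lebesgue_on S)"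
    and ae: "AE x in lebesgue_on S. f x = g x"
  shows "g \<in> borel_measurable (lebesgue_on S)"
proof -
  have "(\<lambda>x. if x \<in> S then f x else 0) \<in> borel_measurable lebesgue"
    using f borel_measurable_if[OF S] by blast
  moreover have "AE x in lebesgue. (if x \<in> S then f x else 0) = (if x \<in> S then g x else 0)"
  proof -
    have "AE x in lebesgue. x \<in> S \<longrightarrow> f x = g x" using ae S by (simp add: AE_restrict_space_iff)
    then show ?thesis by eventually_elim auto
  qed
  ultimately have "(\<lambda>x. if x \<in> S then g x else 0) \<in> borel_measurable lebesgue"
    by (rule borel_measurable_AE)
  then show ?thesis using borel_measurable_if[OF S] by blast
qed

lemma borel_measurable_cnj [measurable]:
  "f \<in> borel_measurable N \<Longrightarrow> (\<lambda>x. cnj (f x)) \<in> borel_measurable N"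
  by (rule measurable_compose[OF _ borel_measurable_continuous_onI]) (auto intro: continuous_intros)

text \<open>
  Both one-dimensional problems are of this form: weight \<open>r\<close> on the unit interval for the radial
  operators, weight 1 on the half-line for de Gennes' operator.
\<close>

locale weighted_interval =
  fixes S :: "real set" and \<rho> p :: "real \<Rightarrow> real"
  assumes openS: "open S" and intervalS: "is_interval S" and nonemptyS: "S \<noteq> {}"
    and cont_weight: "continuous_on S \<rho>" and weight_pos: "\<And>r. r \<in> S \<Longrightarrow> \<rho> r > 0"
    and cont_p: "continuous_on S p"
begin

definition M :: "real measure" where
  "M = density (lebesgue_on S) (\<lambda>r. ennreal (\<rho> r))"

lemma S_lebesgue [simp]: "S \<in> sets lebesgue" using openS by simp

lemma cont_measurable: "continuous_on S h \<Longrightarrow> h \<in> borel_measurable (lebesgue_on S)"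
  for h :: "real \<Rightarrow> 'b::euclidean_space"
  by (rule continuous_imp_measurable_on_sets_lebesgue) auto

lemma weight_measurable [measurable]: "\<rho> \<in> borel_measurable (lebesgue_on S)"
  by (rule cont_measurable[OF cont_weight])

lemma p_measurable [measurable]: "p \<in> borel_measurable (lebesgue_on S)"
  by (rule cont_measurable[OF cont_p])

lemma measurable_M [simp]: "borel_measurable M = borel_measurable (lebesgue_on S)"
  by (auto simp: M_def measurable_def)

lemma AE_M: "(AE x in M. P x) \<longleftrightarrow> (AE x in lebesgue_on S. P x)"
proof -
  have "(AE x in M. P x) \<longleftrightarrow> (AE x in lebesgue_on S. 0 < ennreal (\<rho> x) \<longrightarrow> P x)"
    unfolding M_def by (rule AE_density) measurable
  also have "\<dots> \<longleftrightarrow> (AE x in lebesgue_on S. P x)"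
    by (rule AE_cong) (simp add: weight_pos)
  finally show ?thesis .
qed

lemma weight_AE: "AE x in lebesgue_on S. 0 \<le> \<rho> x"
  by (rule AE_I2) (simp add: weight_pos less_imp_le)

lemma integrable_M:
  fixes h :: "real \<Rightarrow> 'b::{banach, second_countable_topology}"
  assumes "h \<in> borel_measurable (lebesgue_on S)"
  shows "integrable M h \<longleftrightarrow> integrable (lebesgue_on S) (\<lambda>r. \<rho> r *\<^sub>R h r)"
  unfolding M_def using assms weight_AE by (intro integrable_density) auto

lemma integral_M:
  fixes h :: "real \<Rightarrow> 'b::{banach, second_countable_topology}"
  assumes "h \<in> borel_measurable (lebesgue_on S)"
  shows "integral\<^sup>L M h = (LINT r|lebesgue_on S. \<rho> r *\<^sub>R h r)"
  unfolding M_def using assms weight_AE by (intro integral_density) auto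

lemma L2_M: "h \<in> L2 M \<longleftrightarrow> h \<in> borel_measurable (lebesgue_on S) \<and>
    integrable (lebesgue_on S) (\<lambda>r. \<rho> r * (cmod (h r))\<^sup>2)"
  unfolding L2_def
  by (auto simp: integrable_M[of "\<lambda>x. (cmod (h x))\<^sup>2"])

lemma weighted_product_integrable:
  fixes a b :: "real \<Rightarrow> complex"
  assumes "a \<in> borel_measurable (lebesgue_on S)" "b \<in> borel_measurable (lebesgue_on S)"
    and "integrable (lebesgue_on S) (\<lambda>r. \<rho> r * (cmod (a r))\<^sup>2)"
    and "integrable (lebesgue_on S) (\<lambda>r. \<rho> r * (cmod (b r))\<^sup>2)"
  shows "integrable (lebesgue_on S) (\<lambda>r. of_real (\<rho> r) * (a r * cnj (b r)))"
proof (rule Bochner_Integration.integrable_bound[OF Bochner_Integration.integrable_add[OF assms(3,4)]])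
  show "(\<lambda>r. of_real (\<rho> r) * (a r * cnj (b r))) \<in> borel_measurable (lebesgue_on S)"
    using assms(1,2) by measurable
  show "AE r in lebesgue_on S. norm (of_real (\<rho> r) * (a r * cnj (b r)))
      \<le> norm (\<rho> r * (cmod (a r))\<^sup>2 + \<rho> r * (cmod (b r))\<^sup>2)"
  proof (rule AE_I2)
    fix r assume "r \<in> space (lebesgue_on S)"
    then have r: "\<rho> r > 0" by (simp add: weight_pos)
    have "2 * (cmod (a r) * cmod (b r)) \<le> (cmod (a r))\<^sup>2 + (cmod (b r))\<^sup>2"
      using sum_squares_bound[of "cmod (a r)" "cmod (b r)"] by simp
    moreover have "0 \<le> cmod (a r) * cmod (b r)" by simp
    ultimately have "cmod (a r) * cmod (b r) \<le> (cmod (a r))\<^sup>2 + (cmod (b r))\<^sup>2" by linarith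
    then show "norm (of_real (\<rho> r) * (a r * cnj (b r)))
      \<le> norm (\<rho> r * (cmod (a r))\<^sup>2 + \<rho> r * (cmod (b r))\<^sup>2)"
      using r by (simp add: norm_mult distrib_left[symmetric])
  qed
qed

text \<open>
  Form domain elements are replaced by their locally absolutely continuous representatives, to which
  boundary terms and the product rule apply.
\<close>

lemma domain_primitive:
  assumes v: "v \<in> neumann_domain S M p"
  obtains V where "primitive_on S V (weak_deriv S 1 v)"
    "AE x in lebesgue_on S. v x = V x"
    "continuous_on S V"
    "weak_deriv S 1 v \<in> borel_measurable (lebesgue_on S)"
    "integrable (lebesgue_on S) (\<lambda>r. \<rho> r * (cmod (V r))\<^sup>2)"
    "integrable (lebesgue_on S) (\<lambda>r. \<rho> r * (cmod (weak_deriv S 1 v r))\<^sup>2)"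
    "integrable (lebesgue_on S) (\<lambda>r. \<rho> r * (cmod (of_real (p r) * V r))\<^sup>2)"
proof -
  from v obtain g where g: "g \<in> L2 M" "has_weak_deriv S 1 v g" and vL: "v \<in> L2 M"
    and pv: "(\<lambda>r. complex_of_real (p r) * v r) \<in> L2 M"
    by (auto simp: neumann_domain_def)
  let ?G = "weak_deriv S 1 v"
  note W = weak_deriv_works[OF openS intervalS g(2)]
  obtain V where V: "primitive_on S V ?G" "AE x in lebesgue_on S. v x = V x"
    using has_weak_deriv_imp_primitive[OF openS intervalS nonemptyS W(1)] by blast
  have cV: "continuous_on S V" by (rule primitive_on_continuous[OF openS intervalS V(1)])
  have gm: "g \<in> borel_measurable (lebesgue_on S)" "integrable (lebesgue_on S) (\<lambda>r. \<rho> r * (cmod (g r))\<^sup>2)"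
    using g(1) by (auto simp: L2_M)
  have Gm: "?G \<in> borel_measurable (lebesgue_on S)"
    by (rule measurable_lebesgue_on_AE[OF _ gm(1)]) (use W(2) in \<open>auto elim: eventually_mono\<close>)
  have vm: "v \<in> borel_measurable (lebesgue_on S)" and Vm: "V \<in> borel_measurable (lebesgue_on S)"
    using vL cont_measurable[OF cV] by (auto simp: L2_M)
  have "integrable (lebesgue_on S) (\<lambda>r. \<rho> r * (cmod (V r))\<^sup>2)"
  proof (subst integrable_cong_AE)
    show "AE r in lebesgue_on S. \<rho> r * (cmod (V r))\<^sup>2 = \<rho> r * (cmod (v r))\<^sup>2"
      using V(2) by eventually_elim simp
    show "integrable (lebesgue_on S) (\<lambda>r. \<rho> r * (cmod (v r))\<^sup>2)" using vL by (simp add: L2_M)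
  qed (use vm Vm in measurable)
  moreover have "integrable (lebesgue_on S) (\<lambda>r. \<rho> r * (cmod (?G r))\<^sup>2)"
  proof (subst integrable_cong_AE)
    show "AE r in lebesgue_on S. \<rho> r * (cmod (?G r))\<^sup>2 = \<rho> r * (cmod (g r))\<^sup>2"
      using W(2) by eventually_elim simp
  qed (use gm Gm in measurable)
  moreover have "integrable (lebesgue_on S) (\<lambda>r. \<rho> r * (cmod (of_real (p r) * V r))\<^sup>2)"
  proof (subst integrable_cong_AE)
    show "AE r in lebesgue_on S. \<rho> r * (cmod (of_real (p r) * V r))\<^sup>2 = \<rho> r * (cmod (of_real (p r) * v r))\<^sup>2"
      using V(2) by eventually_elim simp
    show "integrable (lebesgue_on S) (\<lambda>r. \<rho> r * (cmod (of_real (p r) * v r))\<^sup>2)"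
      using pv by (simp add: L2_M)
  qed (use vm Vm in measurable)
  ultimately show thesis using that[OF V cV Gm] by blast
qed

lemma neumann_form_eq:
  assumes u: "AE x in lebesgue_on S. u x = U x" "weak_deriv S 1 u \<in> borel_measurable (lebesgue_on S)"
      "continuous_on S U" "AE x in lebesgue_on S. weak_deriv S 1 u x = u1 x"
      "u1 \<in> borel_measurable (lebesgue_on S)"
      "u \<in> borel_measurable (lebesgue_on S)"
    and v: "AE x in lebesgue_on S. v x = V x" "weak_deriv S 1 v \<in> borel_measurable (lebesgue_on S)"
      "continuous_on S V" "v \<in> borel_measurable (lebesgue_on S)"
  shows "neumann_form S M p u v = (LINT r|lebesgue_on S.
     of_real (\<rho> r) * (u1 r * cnj (weak_deriv S 1 v r))
     + of_real (\<rho> r) * (of_real (p r) * U r * cnj (of_real (p r) * V r)))"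
proof -
  have m [measurable]: "U \<in> borel_measurable (lebesgue_on S)" "V \<in> borel_measurable (lebesgue_on S)"
    using u(3) v(3) by (auto intro: cont_measurable)
  note [measurable] = u(2,5,6) v(2,4)
  let ?h = "\<lambda>r. weak_deriv S 1 u r * cnj (weak_deriv S 1 v r) + complex_of_real ((p r)\<^sup>2) * u r * cnj (v r)"
  have "neumann_form S M p u v = (LINT r|lebesgue_on S. \<rho> r *\<^sub>R ?h r)"
    unfolding neumann_form_def by (rule integral_M) measurable
  also have "\<dots> = (LINT r|lebesgue_on S.
     of_real (\<rho> r) * (u1 r * cnj (weak_deriv S 1 v r))
     + of_real (\<rho> r) * (of_real (p r) * U r * cnj (of_real (p r) * V r)))"
  proof (rule integral_cong_AE)
    show "AE r in lebesgue_on S. \<rho> r *\<^sub>R ?h r = of_real (\<rho> r) * (u1 r * cnj (weak_deriv S 1 v r))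
     + of_real (\<rho> r) * (of_real (p r) * U r * cnj (of_real (p r) * V r))"
      using u(1,4) v(1)
      by eventually_elim (simp add: scaleR_conv_of_real algebra_simps power2_eq_square)
  qed measurable
  finally show ?thesis .
qed

lemma integral_exhaust:
  fixes F :: "real \<Rightarrow> complex" and s t :: "nat \<Rightarrow> real"
  assumes F: "integrable (lebesgue_on S) F"
    and st: "\<And>k. s k \<in> S" "\<And>k. t k \<in> S"
    and exh: "\<And>x. x \<in> S \<Longrightarrow> \<forall>\<^sub>F k in sequentially. s k \<le> x \<and> x \<le> t k"
  shows "(\<lambda>k. integral {s k..t k} F) \<longlonglongrightarrow> integral\<^sup>L (lebesgue_on S) F"
proof -
  have sub: "{s k..t k} \<subseteq> S" for k by (rule Icc_subset_interval[OF intervalS st])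
  have Fi: "integrable lebesgue (\<lambda>x. indicat_real S x *\<^sub>R F x)"
    using F by (simp add: integrable_restrict_space)
  have ai: "F absolutely_integrable_on {s k..t k}" for k
  proof -
    have "F absolutely_integrable_on S" using Fi by (simp add: set_integrable_def)
    then show ?thesis by (rule set_integrable_subset) (use sub in auto)
  qed
  have "(\<lambda>k. LINT x|lebesgue. indicat_real {s k..t k} x *\<^sub>R F x)
      \<longlonglongrightarrow> (LINT x|lebesgue. indicat_real S x *\<^sub>R F x)"
  proof (rule integral_dominated_convergence)
    show "integrable lebesgue (\<lambda>x. norm (indicat_real S x *\<^sub>R F x))" using Fi by (rule integrable_norm)
    show "(\<lambda>x. indicat_real S x *\<^sub>R F x) \<in> borel_measurable lebesgue" using Fi by (rule borel_measurable_integrable)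
    show "(\<lambda>x. indicat_real {s k..t k} x *\<^sub>R F x) \<in> borel_measurable lebesgue" for k
      using ai[of k] unfolding set_integrable_def by (rule borel_measurable_integrable)
    show "AE x in lebesgue. norm (indicat_real {s k..t k} x *\<^sub>R F x) \<le> norm (indicat_real S x *\<^sub>R F x)" for k
      using sub[of k] by (intro AE_I2) (auto simp: indicator_def)
    show "AE x in lebesgue. (\<lambda>k. indicat_real {s k..t k} x *\<^sub>R F x) \<longlonglongrightarrow> indicat_real S x *\<^sub>R F x"
    proof (rule AE_I2)
      fix x
      show "(\<lambda>k. indicat_real {s k..t k} x *\<^sub>R F x) \<longlonglongrightarrow> indicat_real S x *\<^sub>R F x"
      proof (cases "x \<in> S")
        case True
        have "\<forall>\<^sub>F k in sequentially. indicat_real {s k..t k} x *\<^sub>R F x = indicat_real S x *\<^sub>R F x"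
          using exh[OF True] by (rule eventually_mono) (simp add: True)
        then show ?thesis by (rule tendsto_eventually)
      next
        case False
        then have "indicat_real {s k..t k} x = 0" for k using sub[of k] by (auto simp: indicator_def)
        then show ?thesis using False by simp
      qed
    qed
  qed
  moreover have "(LINT x|lebesgue. indicat_real {s k..t k} x *\<^sub>R F x) = integral {s k..t k} F" for k
    using set_lebesgue_integral_eq_integral(2)[OF ai] by (simp add: set_lebesgue_integral_def)
  ultimately show ?thesis by (simp add: integral_restrict_space)
qed

end

text \<open>
  A positive solution \<open>f\<close> of the eigenvalue equation, with finite energy. The last assumption says
  that along sequences exhausting the interval two kinds of boundary terms vanish for every function
  of finite energy: those from integrating by parts against \<open>f\<close>, and those in Picone's identity.
  Sequences suffice, and at a singular end point they are all that integrability provides.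
\<close>

locale positive_ground_state = weighted_interval +
  fixes f f1 :: "real \<Rightarrow> real" and lam :: real
  assumes f_pos: "\<And>r. r \<in> S \<Longrightarrow> f r > 0"
    and f_deriv: "\<And>r. r \<in> S \<Longrightarrow> (f has_real_derivative f1 r) (at r)"
    and cont_f1: "continuous_on S f1"
    and f_ode: "\<And>r. r \<in> S \<Longrightarrow>
      ((\<lambda>r. \<rho> r * f1 r) has_real_derivative ((p r)\<^sup>2 - lam) * (\<rho> r * f r)) (at r)"
    and f_int: "integrable (lebesgue_on S) (\<lambda>r. \<rho> r * (f r)\<^sup>2)"
      "integrable (lebesgue_on S) (\<lambda>r. \<rho> r * (f1 r)\<^sup>2)"
      "integrable (lebesgue_on S) (\<lambda>r. \<rho> r * (p r * f r)\<^sup>2)"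
    and boundary: "\<And>V G. primitive_on S V G \<Longrightarrow> continuous_on S V \<Longrightarrow>
      G \<in> borel_measurable (lebesgue_on S) \<Longrightarrow>
      integrable (lebesgue_on S) (\<lambda>r. \<rho> r * (cmod (V r))\<^sup>2) \<Longrightarrow>
      integrable (lebesgue_on S) (\<lambda>r. \<rho> r * (cmod (G r))\<^sup>2) \<Longrightarrow>
      integrable (lebesgue_on S) (\<lambda>r. \<rho> r * (cmod (of_real (p r) * V r))\<^sup>2) \<Longrightarrow>
      \<exists>s t :: nat \<Rightarrow> real. (\<forall>k. s k \<in> S \<and> t k \<in> S \<and> s k \<le> t k) \<and>
        (\<forall>x\<in>S. \<forall>\<^sub>F k in sequentially. s k \<le> x \<and> x \<le> t k) \<and>
        (\<lambda>k. \<rho> (s k) * f1 (s k) * cmod (V (s k))) \<longlonglongrightarrow> 0 \<and>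
        (\<lambda>k. \<rho> (t k) * f1 (t k) * cmod (V (t k))) \<longlonglongrightarrow> 0 \<and>
        (\<lambda>k. \<rho> (s k) * f1 (s k) / f (s k) * (cmod (V (s k)))\<^sup>2) \<longlonglongrightarrow> 0 \<and>
        (\<lambda>k. \<rho> (t k) * f1 (t k) / f (t k) * (cmod (V (t k)))\<^sup>2) \<longlonglongrightarrow> 0"
begin

lemma cont_f: "continuous_on S f"
  by (meson DERIV_isCont continuous_at_imp_continuous_on f_deriv)

lemma form_identity:
  assumes V: "primitive_on S V G" "continuous_on S V" "G \<in> borel_measurable (lebesgue_on S)"
    "integrable (lebesgue_on S) (\<lambda>r. \<rho> r * (cmod (V r))\<^sup>2)"
    "integrable (lebesgue_on S) (\<lambda>r. \<rho> r * (cmod (G r))\<^sup>2)"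
    "integrable (lebesgue_on S) (\<lambda>r. \<rho> r * (cmod (of_real (p r) * V r))\<^sup>2)"
  shows "(LINT r|lebesgue_on S. of_real (\<rho> r) * (of_real (f1 r) * cnj (G r))
     + of_real (\<rho> r) * (of_real (p r) * of_real (f r) * cnj (of_real (p r) * V r)))
    = (LINT r|lebesgue_on S. of_real (\<rho> r) * (of_real (lam * f r) * cnj (V r)))"
proof -
  have m [measurable]: "V \<in> borel_measurable (lebesgue_on S)" "f \<in> borel_measurable (lebesgue_on S)"
    "f1 \<in> borel_measurable (lebesgue_on S)"
    using V(2) cont_f cont_f1 by (auto intro: cont_measurable)
  note [measurable] = V(3)
  have i1: "integrable (lebesgue_on S) (\<lambda>r. of_real (\<rho> r) * (of_real (f1 r) * cnj (G r)))"
    using f_int V by (intro weighted_product_integrable) auto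
  have i2: "integrable (lebesgue_on S) (\<lambda>r. of_real (\<rho> r) * (of_real (p r) * of_real (f r) * cnj (of_real (p r) * V r)))"
    using f_int V by (intro weighted_product_integrable) (auto simp: norm_mult power_mult_distrib)
  have i3': "integrable (lebesgue_on S) (\<lambda>r. of_real (\<rho> r) * (of_real (f r) * cnj (V r)))"
    using f_int V by (intro weighted_product_integrable) auto
  have i3: "integrable (lebesgue_on S) (\<lambda>r. of_real (\<rho> r) * (of_real (lam * f r) * cnj (V r)))"
    using integrable_mult_right[OF i3', of "of_real lam"] by (simp add: mult_ac)
  let ?F = "\<lambda>r. of_real (\<rho> r) * (of_real (f1 r) * cnj (G r))
     + of_real (\<rho> r) * (of_real (p r) * of_real (f r) * cnj (of_real (p r) * V r))
     - of_real (\<rho> r) * (of_real (lam * f r) * cnj (V r))"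
  have iF: "integrable (lebesgue_on S) ?F" using i1 i2 i3 by auto
  obtain s t :: "nat \<Rightarrow> real" where st: "\<And>k. s k \<in> S" "\<And>k. t k \<in> S" "\<And>k. s k \<le> t k"
    and exh: "\<And>x. x \<in> S \<Longrightarrow> \<forall>\<^sub>F k in sequentially. s k \<le> x \<and> x \<le> t k"
    and lims: "(\<lambda>k. \<rho> (s k) * f1 (s k) * cmod (V (s k))) \<longlonglongrightarrow> 0"
      "(\<lambda>k. \<rho> (t k) * f1 (t k) * cmod (V (t k))) \<longlonglongrightarrow> 0"
    using boundary[OF V] by blast
  have "continuous_on S (\<lambda>r. ((p r)\<^sup>2 - lam) * (\<rho> r * f r))"
    by (intro continuous_intros cont_p cont_weight cont_f)
  from primitive_on_mult[OF openS intervalS primitive_on_C1[OF intervalS f_ode this] primitive_on_cnj[OF V(1)]]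
  have prim: "primitive_on S (\<lambda>r. of_real (\<rho> r * f1 r) * cnj (V r)) ?F"
    by (simp add: algebra_simps power2_eq_square)
  have "(\<lambda>k. integral {s k..t k} ?F) \<longlonglongrightarrow> integral\<^sup>L (lebesgue_on S) ?F"
    by (rule integral_exhaust[OF iF st(1,2) exh])
  moreover have "(\<lambda>k. integral {s k..t k} ?F) \<longlonglongrightarrow> 0 - 0"
    unfolding primitive_onD(2)[OF prim st, symmetric]
    by (intro tendsto_diff; rule tendsto_norm_zero_cancel)
       (use tendsto_rabs_zero[OF lims(1)] tendsto_rabs_zero[OF lims(2)] in \<open>simp_all add: norm_mult abs_mult\<close>)
  ultimately have "integral\<^sup>L (lebesgue_on S) ?F = 0" using LIMSEQ_unique by force
  then show ?thesis using i1 i2 i3 by simp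
qed

text \<open>
  Picone's identity: up to the derivative of \<open>\<rho> (f1 / f) |V|\<^sup>2\<close>, whose boundary values tend to zero,
  the energy density minus \<open>lam \<rho> |V|\<^sup>2\<close> is \<open>\<rho> |G - (f1 / f) V|\<^sup>2\<close>.
\<close>

lemma form_lower_bound:
  assumes V: "primitive_on S V G" "continuous_on S V" "G \<in> borel_measurable (lebesgue_on S)"
    "integrable (lebesgue_on S) (\<lambda>r. \<rho> r * (cmod (V r))\<^sup>2)"
    "integrable (lebesgue_on S) (\<lambda>r. \<rho> r * (cmod (G r))\<^sup>2)"
    "integrable (lebesgue_on S) (\<lambda>r. \<rho> r * (cmod (of_real (p r) * V r))\<^sup>2)"
  shows "lam * (LINT r|lebesgue_on S. \<rho> r * (cmod (V r))\<^sup>2)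
    \<le> (LINT r|lebesgue_on S. \<rho> r * (cmod (G r))\<^sup>2) + (LINT r|lebesgue_on S. \<rho> r * (cmod (of_real (p r) * V r))\<^sup>2)"
proof -
  let ?E = "\<lambda>r. \<rho> r * (cmod (G r))\<^sup>2 + \<rho> r * (cmod (of_real (p r) * V r))\<^sup>2 - lam * (\<rho> r * (cmod (V r))\<^sup>2)"
  let ?Ec = "\<lambda>r. complex_of_real (?E r)"
  have iE: "integrable (lebesgue_on S) ?E" using V(4-6) by auto
  then have iEc: "integrable (lebesgue_on S) ?Ec" by (rule integrable_of_real)
  obtain s t :: "nat \<Rightarrow> real" where st: "\<And>k. s k \<in> S" "\<And>k. t k \<in> S" "\<And>k. s k \<le> t k"
    and exh: "\<And>x. x \<in> S \<Longrightarrow> \<forall>\<^sub>F k in sequentially. s k \<le> x \<and> x \<le> t k"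
    and lims: "(\<lambda>k. \<rho> (s k) * f1 (s k) / f (s k) * (cmod (V (s k)))\<^sup>2) \<longlonglongrightarrow> 0"
      "(\<lambda>k. \<rho> (t k) * f1 (t k) / f (t k) * (cmod (V (t k)))\<^sup>2) \<longlonglongrightarrow> 0"
    using boundary[OF V] by blast
  define \<phi> \<phi>' where "\<phi> r = \<rho> r * f1 r / f r"
    and "\<phi>' r = ((p r)\<^sup>2 - lam) * \<rho> r - \<rho> r * (f1 r / f r)\<^sup>2" for r
  have d\<phi>: "(\<phi> has_real_derivative \<phi>' r) (at r)" if r: "r \<in> S" for r
    unfolding \<phi>_def[abs_def] \<phi>'_def
    by (rule DERIV_cong[OF DERIV_divide[OF f_ode[OF r] f_deriv[OF r]]])
       (use f_pos[OF r] in \<open>simp_all add: divide_simps power2_eq_square\<close>)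
  have c\<phi>': "continuous_on S \<phi>'"
    unfolding \<phi>'_def[abs_def]
    by (intro continuous_intros cont_p cont_weight cont_f cont_f1) (use f_pos in force)
  let ?D = "\<lambda>r. of_real (\<phi> r) * (V r * cnj (G r) + G r * cnj (V r)) + of_real (\<phi>' r) * (V r * cnj (V r))"
  have prim: "primitive_on S (\<lambda>r. of_real (\<phi> r) * (V r * cnj (V r))) ?D"
    by (rule primitive_on_mult[OF openS intervalS primitive_on_C1[OF intervalS d\<phi> c\<phi>']
          primitive_on_mult[OF openS intervalS V(1) primitive_on_cnj[OF V(1)]]])
  have pointwise: "Re (?D r) \<le> ?E r" if r: "r \<in> S" for r
  proof -
    define q where "q = f1 r / f r"
    have "0 \<le> \<rho> r * (cmod (G r - of_real q * V r))\<^sup>2" using weight_pos[OF r] by simp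
    also have "\<dots> = ?E r - Re (?D r)"
    proof -
      have "\<phi> r = \<rho> r * q" by (simp add: \<phi>_def q_def)
      then show ?thesis
        unfolding cmod_power2 \<phi>'_def q_def[symmetric] by (simp add: algebra_simps power2_eq_square)
    qed
    finally show ?thesis by simp
  qed
  have le: "Re (integral {s k..t k} ?D) \<le> Re (integral {s k..t k} ?Ec)" for k
  proof -
    have sub: "{s k..t k} \<subseteq> S" by (rule Icc_subset_interval[OF intervalS st(1,2)])
    have D: "?D integrable_on {s k..t k}"
      using primitive_onD(1)[OF prim st] set_lebesgue_integral_eq_integral(1) by blast
    have "?Ec absolutely_integrable_on S" using iEc by (simp add: set_integrable_def integrable_restrict_space)
    then have "?Ec absolutely_integrable_on {s k..t k}" by (rule set_integrable_subset) (use sub in auto)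
    then have E: "?Ec integrable_on {s k..t k}" using set_lebesgue_integral_eq_integral(1) by blast
    have "integral {s k..t k} (Re \<circ> ?D) \<le> integral {s k..t k} (Re \<circ> ?Ec)"
      using pointwise sub
      by (intro integral_le integrable_linear[OF D bounded_linear_Re] integrable_linear[OF E bounded_linear_Re]) auto
    then show ?thesis
      using integral_linear[OF D bounded_linear_Re] integral_linear[OF E bounded_linear_Re] by simp
  qed
  have "(\<lambda>k. integral {s k..t k} ?D) \<longlonglongrightarrow> 0 - 0"
    unfolding primitive_onD(2)[OF prim st, symmetric]
    by (intro tendsto_diff; rule tendsto_norm_zero_cancel)
       (use tendsto_rabs_zero[OF lims(1)] tendsto_rabs_zero[OF lims(2)] in
         \<open>simp_all add: norm_mult abs_mult \<phi>_def power2_eq_square norm_divide abs_divide\<close>)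
  from tendsto_Re[OF this] have "(\<lambda>k. Re (integral {s k..t k} ?D)) \<longlonglongrightarrow> 0" by simp
  moreover have "(\<lambda>k. Re (integral {s k..t k} ?Ec)) \<longlonglongrightarrow> Re (integral\<^sup>L (lebesgue_on S) ?Ec)"
    by (intro tendsto_Re integral_exhaust[OF iEc st(1,2) exh])
  ultimately have "0 \<le> Re (integral\<^sup>L (lebesgue_on S) ?Ec)" using le LIMSEQ_le by blast
  then have "0 \<le> integral\<^sup>L (lebesgue_on S) ?E"
    unfolding integral_complex_of_real Re_complex_of_real .
  then show ?thesis using V(4-6) by simp
qed

lemma real_weak_deriv: "has_weak_deriv S 1 (\<lambda>r. complex_of_real (f r)) (\<lambda>r. complex_of_real (f1 r))"
  by (rule has_weak_deriv_primitive[OF openS intervalS primitive_on_C1[OF intervalS f_deriv cont_f1]])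

lemma f_in_domain: "(\<lambda>r. complex_of_real (f r)) \<in> neumann_domain S M p"
proof -
  have m [measurable]: "f \<in> borel_measurable (lebesgue_on S)" "f1 \<in> borel_measurable (lebesgue_on S)"
    using cont_f cont_f1 by (auto intro: cont_measurable)
  show ?thesis unfolding neumann_domain_def
    using f_int real_weak_deriv
    by (auto simp: L2_M norm_mult power_mult_distrib intro!: bexI[of _ "\<lambda>r. complex_of_real (f1 r)"])
qed

lemma eigenvalue_lam:
  "is_eigenvalue M (form_operator M (neumann_domain S M p) (neumann_form S M p)) (complex_of_real lam)"
  unfolding is_eigenvalue_def
proof (intro exI conjI)
  let ?f = "\<lambda>r. complex_of_real (f r)"
  have m [measurable]: "f \<in> borel_measurable (lebesgue_on S)" "f1 \<in> borel_measurable (lebesgue_on S)"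
    using cont_f cont_f1 by (auto intro: cont_measurable)
  note W = weak_deriv_works[OF openS intervalS real_weak_deriv]
  have Wm: "weak_deriv S 1 ?f \<in> borel_measurable (lebesgue_on S)"
    by (rule measurable_lebesgue_on_AE[of _ "\<lambda>r. complex_of_real (f1 r)"])
       (use W(2) in \<open>auto elim: eventually_mono\<close>)
  show "form_operator M (neumann_domain S M p) (neumann_form S M p) ?f (\<lambda>x. complex_of_real lam * ?f x)"
    unfolding form_operator_def
  proof (intro conjI ballI)
    show "?f \<in> neumann_domain S M p" by (rule f_in_domain)
    show "(\<lambda>x. complex_of_real lam * ?f x) \<in> L2 M"
      using integrable_mult_right[OF f_int(1), of "lam\<^sup>2"]
      by (simp add: L2_M norm_mult power_mult_distrib mult_ac)
    fix v assume v: "v \<in> neumann_domain S M p"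
    have vm [measurable]: "v \<in> borel_measurable (lebesgue_on S)"
      using v by (auto simp: neumann_domain_def L2_M)
    obtain V where V: "primitive_on S V (weak_deriv S 1 v)"
      "AE x in lebesgue_on S. v x = V x" "continuous_on S V"
      "weak_deriv S 1 v \<in> borel_measurable (lebesgue_on S)"
      "integrable (lebesgue_on S) (\<lambda>r. \<rho> r * (cmod (V r))\<^sup>2)"
      "integrable (lebesgue_on S) (\<lambda>r. \<rho> r * (cmod (weak_deriv S 1 v r))\<^sup>2)"
      "integrable (lebesgue_on S) (\<lambda>r. \<rho> r * (cmod (of_real (p r) * V r))\<^sup>2)"
      by (rule domain_primitive[OF v])
    have Vm [measurable]: "V \<in> borel_measurable (lebesgue_on S)" by (rule cont_measurable[OF V(3)])
    have "neumann_form S M p ?f v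
       = (LINT r|lebesgue_on S. of_real (\<rho> r) * (of_real (f1 r) * cnj (weak_deriv S 1 v r))
     + of_real (\<rho> r) * (of_real (p r) * of_real (f r) * cnj (of_real (p r) * V r)))"
      by (rule neumann_form_eq[OF _ Wm _ W(2) _ _ V(2,4,3) vm]) (auto intro!: continuous_intros cont_f)
    also have "\<dots> = (LINT r|lebesgue_on S. of_real (\<rho> r) * (of_real (lam * f r) * cnj (V r)))"
      by (rule form_identity[OF V(1,3,4,5,6,7)])
    also have "\<dots> = (LINT r|lebesgue_on S. \<rho> r *\<^sub>R (complex_of_real lam * ?f r * cnj (v r)))"
    proof (rule integral_cong_AE)
      show "AE r in lebesgue_on S. of_real (\<rho> r) * (of_real (lam * f r) * cnj (V r))
          = \<rho> r *\<^sub>R (complex_of_real lam * ?f r * cnj (v r))"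
        using V(2) by eventually_elim (simp add: scaleR_conv_of_real)
    qed measurable
    also have "\<dots> = L2_inner M (\<lambda>x. complex_of_real lam * ?f x) v"
      unfolding L2_inner_def by (rule integral_M[symmetric]) measurable
    finally show "neumann_form S M p ?f v = L2_inner M (\<lambda>x. complex_of_real lam * ?f x) v" .
  qed
  show "\<not> (AE x in M. ?f x = 0)"
  proof
    assume "AE x in M. ?f x = 0"
    then have "AE x in lebesgue. x \<in> S \<longrightarrow> f x = 0" by (simp add: AE_M AE_restrict_space_iff)
    then have "AE x in lebesgue. x \<notin> S"
      by eventually_elim (use f_pos in force)
    then have "negligible S" by (simp add: negligible_iff_null_sets AE_iff_null_sets[symmetric])
    then show False using openS nonemptyS open_not_negligible by blast
  qed
qed

lemma eigenvalue_ge_lam: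
  assumes "is_eigenvalue M (form_operator M (neumann_domain S M p) (neumann_form S M p)) (complex_of_real x)"
  shows "lam \<le> x"
proof -
  obtain u where u: "u \<in> neumann_domain S M p"
      "neumann_form S M p u u = L2_inner M (\<lambda>r. complex_of_real x * u r) u"
      "\<not> (AE x in M. u x = 0)"
    using assms by (auto simp: is_eigenvalue_def form_operator_def)
  have um [measurable]: "u \<in> borel_measurable (lebesgue_on S)"
    using u(1) by (auto simp: neumann_domain_def L2_M)
  obtain V where V: "primitive_on S V (weak_deriv S 1 u)"
      "AE x in lebesgue_on S. u x = V x" "continuous_on S V"
      "weak_deriv S 1 u \<in> borel_measurable (lebesgue_on S)"
      "integrable (lebesgue_on S) (\<lambda>r. \<rho> r * (cmod (V r))\<^sup>2)"
      "integrable (lebesgue_on S) (\<lambda>r. \<rho> r * (cmod (weak_deriv S 1 u r))\<^sup>2)"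
      "integrable (lebesgue_on S) (\<lambda>r. \<rho> r * (cmod (of_real (p r) * V r))\<^sup>2)"
    by (rule domain_primitive[OF u(1)])
  have Vm [measurable]: "V \<in> borel_measurable (lebesgue_on S)" by (rule cont_measurable[OF V(3)])
  let ?N = "LINT r|lebesgue_on S. \<rho> r * (cmod (V r))\<^sup>2"
  let ?G = "weak_deriv S 1 u"
  have sq: "w * cnj w = complex_of_real ((cmod w)\<^sup>2)" for w by (rule complex_norm_square[symmetric])
  have "neumann_form S M p u u = (LINT r|lebesgue_on S. of_real (\<rho> r) * (?G r * cnj (?G r))
     + of_real (\<rho> r) * (of_real (p r) * V r * cnj (of_real (p r) * V r)))"
    by (rule neumann_form_eq[OF V(2,4,3) _ V(4) um V(2,4,3) um]) simp
  also have "\<dots> = (LINT r|lebesgue_on S. complex_of_real (\<rho> r * (cmod (?G r))\<^sup>2 + \<rho> r * (cmod (of_real (p r) * V r))\<^sup>2))"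
    unfolding sq by simp
  also have "\<dots> = complex_of_real ((LINT r|lebesgue_on S. \<rho> r * (cmod (?G r))\<^sup>2)
      + (LINT r|lebesgue_on S. \<rho> r * (cmod (of_real (p r) * V r))\<^sup>2))"
    unfolding integral_complex_of_real using V(6,7) by simp
  finally have lhs: "neumann_form S M p u u = complex_of_real ((LINT r|lebesgue_on S. \<rho> r * (cmod (?G r))\<^sup>2)
      + (LINT r|lebesgue_on S. \<rho> r * (cmod (of_real (p r) * V r))\<^sup>2))" .
  have "L2_inner M (\<lambda>r. complex_of_real x * u r) u = (LINT r|lebesgue_on S. \<rho> r *\<^sub>R (complex_of_real x * u r * cnj (u r)))"
    unfolding L2_inner_def by (rule integral_M) measurable
  also have "\<dots> = (LINT r|lebesgue_on S. complex_of_real (x * (\<rho> r * (cmod (V r))\<^sup>2)))"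
  proof (rule integral_cong_AE)
    show "AE r in lebesgue_on S. \<rho> r *\<^sub>R (complex_of_real x * u r * cnj (u r)) = complex_of_real (x * (\<rho> r * (cmod (V r))\<^sup>2))"
      using V(2) by eventually_elim (simp add: scaleR_conv_of_real mult.assoc sq mult.left_commute del: of_real_power)
  qed measurable
  also have "\<dots> = complex_of_real (x * ?N)" unfolding integral_complex_of_real by simp
  finally have rhs: "L2_inner M (\<lambda>r. complex_of_real x * u r) u = complex_of_real (x * ?N)" .
  have "(LINT r|lebesgue_on S. \<rho> r * (cmod (?G r))\<^sup>2)
      + (LINT r|lebesgue_on S. \<rho> r * (cmod (of_real (p r) * V r))\<^sup>2) = x * ?N"
    using trans[OF lhs[symmetric] trans[OF u(2) rhs]] by (rule of_real_eq_iff[THEN iffD1])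
  then have le: "lam * ?N \<le> x * ?N"
    using form_lower_bound[OF V(1,3,4,5,6,7)] by simp
  have nn: "AE r in lebesgue_on S. 0 \<le> \<rho> r * (cmod (V r))\<^sup>2"
    by (rule AE_I2) (simp add: weight_pos less_imp_le)
  have "?N \<noteq> 0"
  proof
    assume "?N = 0"
    then have "AE r in lebesgue_on S. \<rho> r * (cmod (V r))\<^sup>2 = 0"
      using integral_nonneg_eq_0_iff_AE[OF V(5) nn] by simp
    then have "AE r in lebesgue_on S. V r = 0"
      using AE_space by eventually_elim (use weight_pos in force)
    with V(2) have "AE r in lebesgue_on S. u r = 0" by eventually_elim simp
    then show False using u(3) by (simp add: AE_M)
  qed
  moreover have "?N \<ge> 0" using nn by (rule integral_nonneg_AE)
  ultimately have "?N > 0" by simp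
  then show "lam \<le> x" using le by simp
qed

theorem neumann_lowest_eq: "neumann_lowest S M p = lam"
  unfolding neumann_lowest_def lowest_eigenvalue_def
  using eigenvalue_lam eigenvalue_ge_lam by (rule Least_equality)

end

section \<open>Kummer's function\<close>

definition kummer_coeff :: "real \<Rightarrow> real \<Rightarrow> nat \<Rightarrow> real" where
  "kummer_coeff a c k = pochhammer a k / (pochhammer c k * fact k)"

text \<open>
  Kummer's confluent hypergeometric function \<open>M(a, c, z)\<close>, and below its derivative in \<open>z\<close>.
\<close>

definition kummer :: "real \<Rightarrow> real \<Rightarrow> real \<Rightarrow> real" where
  "kummer a c z = (\<Sum>k. kummer_coeff a c k * z ^ k)"

definition kummer' :: "real \<Rightarrow> real \<Rightarrow> real \<Rightarrow> real" where
  "kummer' a c z = a / c * kummer (a + 1) (c + 1) z"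

lemma kummer_coeff_Suc:
  assumes "c > 0"
  shows "(real k + 1) * (c + real k) * kummer_coeff a c (Suc k) = (a + real k) * kummer_coeff a c k"
  using assms pochhammer_pos[OF assms, of k]
  by (simp add: kummer_coeff_def pochhammer_Suc divide_simps)

lemma summable_kummer:
  assumes "c > 0"
  shows "summable (\<lambda>k. kummer_coeff a c k * z ^ k)"
proof -
  obtain n0 :: nat where n0: "real n0 > 1 + \<bar>a\<bar> + 2 * \<bar>z\<bar> * (1 + \<bar>a\<bar>)"
    using reals_Archimedean2 by blast
  show ?thesis
  proof (rule summable_ratio_test[of "1/2" n0])
    fix n assume n: "n \<ge> n0"
    let ?u = "kummer_coeff a c n * z ^ n" and ?s = "kummer_coeff a c (Suc n) * z ^ Suc n"
    have pos: "(real n + 1) * (c + real n) > 0" using assms by simp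
    have eq: "(real n + 1) * (c + real n) * ?s = (a + real n) * z * ?u"
      using arg_cong[OF kummer_coeff_Suc[OF assms, of n a], of "\<lambda>x. x * (z * z ^ n)"]
      by (simp add: mult_ac)
    have nn: "real n > 1 + \<bar>a\<bar> + 2 * \<bar>z\<bar> * (1 + \<bar>a\<bar>)" using n n0 by linarith
    have "\<bar>a + real n\<bar> * \<bar>z\<bar> \<le> (\<bar>a\<bar> + 1) * (real n + 1) * \<bar>z\<bar>"
      by (intro mult_right_mono) (auto simp: algebra_simps intro!: order_trans[OF abs_triangle_ineq])
    also have "\<dots> \<le> (real n + 1) * (real n / 2)"
    proof -
      have "2 * \<bar>z\<bar> * (1 + \<bar>a\<bar>) \<le> real n" using nn by linarith
      then have "(real n + 1) * (2 * \<bar>z\<bar> * (1 + \<bar>a\<bar>)) \<le> (real n + 1) * real n"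
        by (intro mult_left_mono) auto
      then show ?thesis by (simp add: algebra_simps)
    qed
    also have "\<dots> \<le> (real n + 1) * (c + real n) / 2" using assms by (simp add: field_simps)
    finally have le: "\<bar>a + real n\<bar> * \<bar>z\<bar> \<le> (real n + 1) * (c + real n) / 2" .
    have "(real n + 1) * (c + real n) * \<bar>?s\<bar> = \<bar>a + real n\<bar> * \<bar>z\<bar> * \<bar>?u\<bar>"
      using arg_cong[OF eq, of abs] assms by (simp add: abs_mult mult_ac)
    also have "\<dots> \<le> (real n + 1) * (c + real n) / 2 * \<bar>?u\<bar>"
      using le by (rule mult_right_mono) simp
    finally have "(real n + 1) * (c + real n) * \<bar>?s\<bar> \<le> (real n + 1) * (c + real n) * (1/2 * \<bar>?u\<bar>)"
      by simp
    then show "norm ?s \<le> 1/2 * norm ?u" using pos by (simp only: mult_le_cancel_left_pos real_norm_def)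
  qed simp
qed

lemma kummer_sums:
  assumes "c > 0" shows "(\<lambda>k. kummer_coeff a c k * z ^ k) sums kummer a c z"
  unfolding kummer_def using summable_kummer[OF assms] by (rule summable_sums)

lemma kummer_coeff_diffs:
  assumes "c > 0"
  shows "diffs (kummer_coeff a c) k = a / c * kummer_coeff (a + 1) (c + 1) k"
proof -
  have "pochhammer (c + 1) k > 0" using assms by (intro pochhammer_pos) simp
  then show ?thesis
    using assms by (simp add: diffs_def kummer_coeff_def pochhammer_rec divide_simps)
qed

lemma kummer'_sums:
  assumes "c > 0" shows "(\<lambda>k. diffs (kummer_coeff a c) k * z ^ k) sums kummer' a c z"
  unfolding kummer'_def kummer_coeff_diffs[OF assms]
  using sums_mult[OF kummer_sums[of "c + 1" "a + 1" z], of "a / c"] assms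
  by (simp add: mult.assoc)

lemma kummer_deriv:
  assumes "c > 0" shows "(kummer a c has_real_derivative kummer' a c z) (at z)"
proof -
  have "((\<lambda>z. \<Sum>k. kummer_coeff a c k * z ^ k) has_real_derivative
      (\<Sum>k. diffs (kummer_coeff a c) k * z ^ k)) (at z)"
    by (rule termdiffs_strong_converges_everywhere) (rule summable_kummer[OF assms])
  then show ?thesis
    unfolding kummer_def[abs_def] sums_unique[OF kummer'_sums[OF assms], symmetric] .
qed

lemma kummer'_deriv:
  assumes "c > 0"
  shows "(kummer' a c has_real_derivative a / c * kummer' (a + 1) (c + 1) z) (at z)"
  unfolding kummer'_def[of a c, abs_def]
  using assms by (intro DERIV_cmult kummer_deriv) simp

lemma kummer_ode:
  assumes "c > 0"
  shows "z * (a / c * kummer' (a + 1) (c + 1) z) = a * kummer a c z - (c - z) * kummer' a c z"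
proof -
  let ?e = "kummer_coeff a c"
  have shift: "(\<lambda>k. real k * h k * z ^ k) sums (z * s)" if "(\<lambda>k. diffs h k * z ^ k) sums s" for h s
  proof -
    have "(\<lambda>k. real (Suc k) * h (Suc k) * z ^ Suc k) sums (z * s)"
      using sums_mult[OF that, of z] by (simp add: diffs_def mult_ac)
    then show ?thesis using sums_Suc_iff[of "\<lambda>k. real k * h k * z ^ k" "z * s"] by simp
  qed
  have d2: "(\<lambda>k. diffs (diffs ?e) k * z ^ k) sums (a / c * kummer' (a + 1) (c + 1) z)"
  proof -
    have "diffs (diffs ?e) = (\<lambda>k. a / c * diffs (kummer_coeff (a + 1) (c + 1)) k)"
      using kummer_coeff_diffs[OF assms, of a] by (simp add: diffs_def fun_eq_iff mult_ac)
    then show ?thesis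
      using sums_mult[OF kummer'_sums[of "c + 1" "a + 1" z], of "a / c"] assms
      by (simp add: mult.assoc)
  qed
  have "(\<lambda>k. real k * diffs ?e k * z ^ k + c * (diffs ?e k * z ^ k) - real k * ?e k * z ^ k
          - a * (?e k * z ^ k))
        sums (z * (a / c * kummer' (a + 1) (c + 1) z) + c * kummer' a c z - z * kummer' a c z
          - a * kummer a c z)"
    by (intro sums_diff sums_add sums_mult shift[OF d2] shift[OF kummer'_sums[OF assms]]
        kummer'_sums[OF assms] kummer_sums[OF assms])
  moreover have "real k * diffs ?e k * z ^ k + c * (diffs ?e k * z ^ k) - real k * ?e k * z ^ k
          - a * (?e k * z ^ k) = 0" for k
  proof -
    have "real k * diffs ?e k * z ^ k + c * (diffs ?e k * z ^ k) - real k * ?e k * z ^ k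
          - a * (?e k * z ^ k) =
       ((real k + 1) * (c + real k) * ?e (Suc k) - (a + real k) * ?e k) * z ^ k"
      by (simp add: diffs_def algebra_simps)
    then show ?thesis using kummer_coeff_Suc[OF assms, of k a] by simp
  qed
  ultimately have "(\<lambda>k. 0) sums (z * (a / c * kummer' (a + 1) (c + 1) z) + c * kummer' a c z
          - z * kummer' a c z - a * kummer a c z)"
    by (simp only:)
  from sums_unique2[OF this sums_zero]
  have "z * (a / c * kummer' (a + 1) (c + 1) z) + c * kummer' a c z - z * kummer' a c z
          - a * kummer a c z = 0" .
  then show ?thesis by (simp add: algebra_simps)
qed

text \<open>
  This contiguous relation is the analytic form of raising the angular momentum by one at fixed
  energy.
\<close>

lemma kummer_contiguous:
  assumes "c > 0"
  shows "kummer a c z - kummer' a c z = (c - a) / c * kummer a (c + 1) z"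
proof -
  have "(\<lambda>k. kummer_coeff a c k * z ^ k - diffs (kummer_coeff a c) k * z ^ k) sums
      (kummer a c z - kummer' a c z)"
    by (intro sums_diff kummer_sums kummer'_sums assms)
  moreover have "kummer_coeff a c k * z ^ k - diffs (kummer_coeff a c) k * z ^ k
      = (c - a) / c * (kummer_coeff a (c + 1) k * z ^ k)" for k
  proof -
    have p: "pochhammer (c + 1) k > 0" "pochhammer c k > 0"
      using assms by (auto intro!: pochhammer_pos)
    have r: "c * pochhammer (c + 1) k = (c + real k) * pochhammer c k"
      using pochhammer_rec[of c k] pochhammer_Suc[of c k] by (simp add: mult.commute)
    have "kummer_coeff a c k - diffs (kummer_coeff a c) k
        = pochhammer a k / fact k * (1 / pochhammer c k - (a + real k) / ((c + real k) * pochhammer c k))"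
      using assms p
      by (simp add: kummer_coeff_def diffs_def pochhammer_Suc divide_simps, simp add: algebra_simps)
    also have "1 / pochhammer c k - (a + real k) / ((c + real k) * pochhammer c k)
        = (c - a) / ((c + real k) * pochhammer c k)"
      using assms p by (simp add: divide_simps)
    also have "\<dots> = (c - a) / (c * pochhammer (c + 1) k)" by (simp only: r)
    finally have "kummer_coeff a c k - diffs (kummer_coeff a c) k
        = (c - a) / c * kummer_coeff a (c + 1) k"
      by (simp add: kummer_coeff_def[of _ _ k] mult_ac)
    then show ?thesis by (simp add: left_diff_distrib[symmetric])
  qed
  ultimately have "(\<lambda>k. (c - a) / c * (kummer_coeff a (c + 1) k * z ^ k)) sums
      (kummer a c z - kummer' a c z)" by simp
  moreover have "(\<lambda>k. (c - a) / c * (kummer_coeff a (c + 1) k * z ^ k)) sums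
      ((c - a) / c * kummer a (c + 1) z)"
    using assms by (intro sums_mult kummer_sums) simp
  ultimately show ?thesis by (rule sums_unique2)
qed

lemma kummer_ge_1:
  assumes "a \<ge> 0" "c > 0" "z \<ge> 0" shows "kummer a c z \<ge> 1"
proof -
  have "(\<Sum>k<1. kummer_coeff a c k * z ^ k) \<le> (\<Sum>k. kummer_coeff a c k * z ^ k)"
  proof (rule sum_le_suminf[OF summable_kummer[OF assms(2)]])
    fix k
    have "pochhammer a k \<ge> 0" "pochhammer c k > 0"
      using assms by (auto simp: pochhammer_prod intro!: prod_nonneg prod_pos add_pos_nonneg)
    then show "0 \<le> kummer_coeff a c k * z ^ k" using assms by (simp add: kummer_coeff_def)
  qed simp
  then show ?thesis by (simp add: kummer_def kummer_coeff_def)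
qed

lemma kummer_zero [simp]: "kummer a c 0 = 1"
  unfolding kummer_def using powser_zero[of "kummer_coeff a c"] by (simp add: kummer_coeff_def)

lemma continuous_on_kummer_param:
  assumes "c > 0"
  shows "continuous_on UNIV (\<lambda>(a, z). kummer a c z)"
proof -
  have "continuous_on ({-A..A} \<times> {-A..A}) (\<lambda>(a, z). kummer a c z)" if A: "A > 0" for A
  proof (rule uniform_limit_theorem[where F = sequentially
        and f = "\<lambda>n (a, z). \<Sum>k<n. kummer_coeff a c k * z ^ k"])
    have "continuous_on ({-A..A} \<times> {-A..A}) (\<lambda>x. \<Sum>k<n. kummer_coeff (fst x) c k * snd x ^ k)" for n
      unfolding kummer_coeff_def pochhammer_prod
      using pochhammer_pos[OF assms]
      by (intro continuous_intros) (auto simp: pochhammer_prod[symmetric] less_imp_neq[THEN not_sym])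
    then show "\<forall>\<^sub>F n in sequentially. continuous_on ({-A..A} \<times> {-A..A})
        (\<lambda>(a, z). \<Sum>k<n. kummer_coeff a c k * z ^ k)"
      by (simp add: case_prod_unfold)
    have "uniform_limit ({-A..A} \<times> {-A..A}) (\<lambda>n x. \<Sum>k<n. kummer_coeff (fst x) c k * snd x ^ k)
        (\<lambda>x. \<Sum>k. kummer_coeff (fst x) c k * snd x ^ k) sequentially"
    proof (rule Weierstrass_m_test)
      show "summable (\<lambda>k. kummer_coeff A c k * A ^ k)" by (rule summable_kummer[OF assms])
      fix k x assume "x \<in> {-A..A} \<times> {-A..A}"
      then have x: "\<bar>fst x\<bar> \<le> A" "\<bar>snd x\<bar> \<le> A" by (auto simp: mem_Times_iff abs_le_iff)
      have "\<bar>pochhammer (fst x) k\<bar> \<le> pochhammer A k"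
        unfolding pochhammer_prod abs_prod
        using x by (intro prod_mono) auto
      moreover have "\<bar>snd x ^ k\<bar> \<le> A ^ k" using x by (simp add: power_abs power_mono)
      moreover have "pochhammer c k > 0" by (rule pochhammer_pos[OF assms])
      ultimately have "\<bar>pochhammer (fst x) k\<bar> / (pochhammer c k * fact k) * \<bar>snd x ^ k\<bar>
          \<le> pochhammer A k / (pochhammer c k * fact k) * A ^ k"
        using A by (intro mult_mono divide_right_mono) (auto intro!: divide_nonneg_pos order_less_imp_le[OF pochhammer_pos])
      then show "norm (kummer_coeff (fst x) c k * snd x ^ k) \<le> kummer_coeff A c k * A ^ k"
        using \<open>pochhammer c k > 0\<close> by (simp add: kummer_coeff_def abs_mult)
    qed
    then show "uniform_limit ({-A..A} \<times> {-A..A}) (\<lambda>n (a, z). \<Sum>k<n. kummer_coeff a c k * z ^ k)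
        (\<lambda>(a, z). kummer a c z) sequentially"
      by (simp add: case_prod_unfold kummer_def)
  qed simp
  note cont = this
  show ?thesis
  proof (rule continuous_at_imp_continuous_on, rule ballI)
    fix x :: "real \<times> real"
    let ?A = "\<bar>fst x\<bar> + \<bar>snd x\<bar> + 1"
    have "continuous_on ({-?A<..<?A} \<times> {-?A<..<?A}) (\<lambda>(a, z). kummer a c z)"
      by (rule continuous_on_subset[OF cont[of ?A]]) auto
    moreover have "x \<in> {-?A<..<?A} \<times> {-?A<..<?A}" by (cases x) (auto simp: abs_if)
    moreover have "open ({-?A<..<?A} \<times> {-?A<..<?A})" by (intro open_Times) auto
    ultimately show "isCont (\<lambda>(a, z). kummer a c z) x"
      using continuous_on_eq_continuous_at by blast
  qed
qed

lemma continuous_on_kummer [continuous_intros]: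
  assumes "c > 0" "continuous_on S f" "continuous_on S g"
  shows "continuous_on S (\<lambda>x. kummer (f x) c (g x))"
  using continuous_on_compose2[OF continuous_on_kummer_param[OF assms(1)]
      continuous_on_Pair[OF assms(2,3)]] by simp

lemma continuous_on_kummer' [continuous_intros]:
  assumes "c > 0" "continuous_on S f" "continuous_on S g"
  shows "continuous_on S (\<lambda>x. kummer' (f x) c (g x))"
  unfolding kummer'_def using assms by (intro continuous_intros) auto

section \<open>The logarithmic derivative of the regular radial solution\<close>

text \<open>
  The logarithmic derivative \<open>z f' / f\<close> of \<open>f = z\<^bsup>n/2\<^esup> e\<^bsup>-z/2\<^esup> M((1-\<eta>)/2, n+1, z)\<close>.
\<close>

definition fiber_slope :: "real \<Rightarrow> nat \<Rightarrow> real \<Rightarrow> real" where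
  "fiber_slope \<eta> n z = (real n - z) / 2
     + z * kummer' ((1 - \<eta>) / 2) (real n + 1) z / kummer ((1 - \<eta>) / 2) (real n + 1) z"

lemma fiber_slope_riccati:
  assumes "\<eta> \<le> 1" "z > 0"
  shows "(fiber_slope \<eta> n has_real_derivative
           (((z - real n)\<^sup>2 - 2 * \<eta> * z) / 4 - (fiber_slope \<eta> n z)\<^sup>2) / z) (at z)"
proof -
  define a c where "a = (1 - \<eta>) / 2" and "c = real n + 1"
  have c: "c > 0" by (simp add: c_def)
  define M M1 M2 where "M = kummer a c z" and "M1 = kummer' a c z"
    and "M2 = a / c * kummer' (a + 1) (c + 1) z"
  have M: "M > 0" using kummer_ge_1[of a c z] assms c by (simp add: M_def a_def)
  have ode: "z * M2 = a * M - (c - z) * M1"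
    using kummer_ode[OF c, of z a] by (simp add: M_def M1_def M2_def)
  have "((\<lambda>z. (real n - z) / 2 + z * kummer' a c z / kummer a c z) has_real_derivative
      - 1 / 2 + ((M1 + z * M2) * M - z * M1 * M1) / (M * M)) (at z)"
    unfolding M_def M1_def M2_def
    using M by (auto intro!: derivative_eq_intros kummer_deriv kummer'_deriv c simp: M_def)
  moreover have "- 1 / 2 + ((M1 + z * M2) * M - z * M1 * M1) / (M * M)
      = (((z - real n)\<^sup>2 - 2 * \<eta> * z) / 4 - ((real n - z) / 2 + z * M1 / M)\<^sup>2) / z"
    unfolding ode using M assms(2)
    by (simp add: divide_simps a_def c_def) (simp add: algebra_simps power2_eq_square)
  ultimately show ?thesis
    by (simp add: fiber_slope_def[abs_def] a_def c_def M_def M1_def)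
qed

text \<open>
  The contiguous relation and its derivative express \<open>z M'/M\<close> for \<open>n + 1\<close> as a Moebius function of
  \<open>m = z M'/M\<close> for \<open>n\<close>.
\<close>

lemma fiber_slope_Suc:
  fixes n :: nat
  assumes "0 \<le> \<eta>" "\<eta> \<le> 1" "z > 0"
  defines "m \<equiv> fiber_slope \<eta> n z - (real n - z) / 2"
  shows "m < z"
    and "fiber_slope \<eta> (Suc n) z =
      (real n + 1 - z) / 2 + ((real n + 1) * m - (1 - \<eta>) / 2 * z) / (z - m)"
proof -
  define a c where "a = (1 - \<eta>) / 2" and "c = real n + 1"
  have c: "c > 0" "a < c" "0 \<le> a" using assms by (simp_all add: c_def a_def)
  define M M1 L L1 where "M = kummer a c z" and "M1 = kummer' a c z"
    and "L = kummer a (c + 1) z" and "L1 = kummer' a (c + 1) z"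
  have M: "M > 0" "L > 0"
    using kummer_ge_1[of a c z] kummer_ge_1[of a "c + 1" z] assms(3) c by (simp_all add: M_def L_def)
  have cont: "M - M1 = (c - a) / c * L"
    using kummer_contiguous[OF c(1), of a z] by (simp add: M_def M1_def L_def)
  have "((\<lambda>z. kummer a c z - kummer' a c z) has_real_derivative
      M1 - a / c * kummer' (a + 1) (c + 1) z) (at z)"
    unfolding M1_def by (intro derivative_intros kummer_deriv kummer'_deriv c)
  moreover have "((\<lambda>z. kummer a c z - kummer' a c z) has_real_derivative (c - a) / c * L1) (at z)"
    unfolding kummer_contiguous[OF c(1)] L1_def using c
    by (intro DERIV_cmult kummer_deriv) simp
  ultimately have "M1 - a / c * kummer' (a + 1) (c + 1) z = (c - a) / c * L1"
    by (rule DERIV_unique)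
  then have "z * M1 - z * (a / c * kummer' (a + 1) (c + 1) z) = z * ((c - a) / c * L1)"
    by (metis right_diff_distrib)
  then have cont': "c * M1 - a * M = z * ((c - a) / c * L1)"
    unfolding kummer_ode[OF c(1)] by (simp add: M_def M1_def algebra_simps)
  have mM: "m = z * M1 / M" by (simp add: m_def fiber_slope_def M_def M1_def a_def c_def)
  have "M - M1 > 0" unfolding cont using c M by simp
  then show "m < z" using M assms(3) by (simp add: mM divide_simps)
  have "((real n + 1) * m - (1 - \<eta>) / 2 * z) / (z - m) = (c * M1 - a * M) / (M - M1)"
    using M assms(3) \<open>M - M1 > 0\<close> by (simp add: mM a_def c_def divide_simps) (simp add: algebra_simps)
  also have "\<dots> = z * L1 / L" unfolding cont cont' using c M by simp
  finally show "fiber_slope \<eta> (Suc n) z =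
      (real n + 1 - z) / 2 + ((real n + 1) * m - (1 - \<eta>) / 2 * z) / (z - m)"
    by (simp add: fiber_slope_def L_def L1_def a_def c_def add.commute)
qed

lemma fiber_slope_common_zero:
  assumes "0 \<le> \<eta>" "\<eta> \<le> 1" "z > 0"
    and "fiber_slope \<eta> n z = 0" "fiber_slope \<eta> (Suc n) z = 0"
  shows "(z - real n) * (z - real n - 1) = 2 * \<eta> * z"
proof -
  have "(real n + 1 - z) / 2 + ((real n + 1) * ((z - real n) / 2) - (1 - \<eta>) / 2 * z) / (z - (z - real n) / 2) = 0"
    using fiber_slope_Suc(2)[OF assms(1-3), of n] assms(4,5) by (simp add: minus_divide_left)
  moreover have "z - (z - real n) / 2 > 0" using assms(3) by (simp add: field_simps)
  ultimately have "(real n + 1 - z) * (z + real n) + 2 * ((real n + 1) * (z - real n) - (1 - \<eta>) * z) = 0"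
    by (simp add: divide_simps) (simp add: algebra_simps)
  then show ?thesis by (simp add: algebra_simps)
qed

text \<open>
  On the curve where simultaneous zeros can occur, the Moebius map fixes zero and preserves the sign.
\<close>

lemma fiber_slope_ladder:
  assumes "0 \<le> \<eta>" "\<eta> \<le> 1" "z > 0"
    and res: "(z - real n) * (z - real n - 1) = 2 * \<eta> * z"
  shows "\<exists>q>0. fiber_slope \<eta> (Suc n) z = q * fiber_slope \<eta> n z"
proof -
  define m where "m = fiber_slope \<eta> n z - (real n - z) / 2"
  have m: "m < z" using fiber_slope_Suc(1)[OF assms(1-3), of n] by (simp add: m_def)
  have w: "m - (z - real n) / 2 = fiber_slope \<eta> n z" by (simp add: m_def diff_divide_distrib)
  have "(real n + 1) * m - (1 - \<eta>) / 2 * z - (z - real n - 1) / 2 * (z - m)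
     = (z + real n + 1) / 2 * (m - (z - real n) / 2)
        + ((z - real n) * (z + real n + 1) - 2 * (1 - \<eta>) * z - 2 * (z - real n - 1) * z) / 4"
    by (simp add: algebra_simps divide_simps)
  also have "(z - real n) * (z + real n + 1) - 2 * (1 - \<eta>) * z - 2 * (z - real n - 1) * z
     = 2 * \<eta> * z - (z - real n) * (z - real n - 1)"
    by (simp add: algebra_simps)
  also have "\<dots> = 0" using res by simp
  finally have "(real n + 1) * m - (1 - \<eta>) / 2 * z
      = (z + real n + 1) / 2 * fiber_slope \<eta> n z + (z - real n - 1) / 2 * (z - m)"
    unfolding w by simp
  moreover have nz: "z - m \<noteq> 0" using m by simp
  moreover have shift: "x = y + (z - k - 1) / 2 \<Longrightarrow> (k + 1 - z) / 2 + x = y" for x y k :: real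
    by (simp add: field_simps)
  ultimately have "((real n + 1) * m - (1 - \<eta>) / 2 * z) / (z - m)
      = (z + real n + 1) / 2 * fiber_slope \<eta> n z / (z - m) + (z - real n - 1) / 2"
    by (simp only: add_divide_distrib nonzero_mult_div_cancel_right[OF nz])
  then have "fiber_slope \<eta> (Suc n) z = (z + real n + 1) / 2 * fiber_slope \<eta> n z / (z - m)"
    unfolding fiber_slope_Suc(2)[OF assms(1-3), of n, folded m_def] by (rule shift)
  then have "fiber_slope \<eta> (Suc n) z = (z + real n + 1) / 2 / (z - m) * fiber_slope \<eta> n z"
    by (simp only: times_divide_eq_left)
  moreover have "(z + real n + 1) / 2 / (z - m) > 0" using m assms(3) by simp
  ultimately show ?thesis by blast
qed

lemma strict_gronwall_pos:
  fixes u u' h :: "real \<Rightarrow> real"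
  assumes "a < b" and u: "continuous_on {a..b} u" and h: "continuous_on {a..b} h"
    and der: "\<And>x. a < x \<Longrightarrow> x < b \<Longrightarrow> (u has_real_derivative u' x) (at x)"
    and less: "\<And>x. a < x \<Longrightarrow> x < b \<Longrightarrow> u' x > h x * u x"
    and "u a \<ge> 0"
  shows "u b > 0"
proof -
  obtain H where H: "\<And>x. x \<in> {a..b} \<Longrightarrow> (H has_vector_derivative h x) (at x within {a..b})"
    using antiderivative_continuous[OF h] by blast
  have contH: "continuous_on {a..b} H"
    using H by (meson continuous_on_eq_continuous_within has_vector_derivative_continuous)
  have derH: "(H has_real_derivative h x) (at x)" if "a < x" "x < b" for x
    using H[of x] that
    by (simp add: has_real_derivative_iff_has_vector_derivative at_within_Icc_at)
  have "u a * exp (- H a) < u b * exp (- H b)"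
  proof (rule DERIV_pos_imp_increasing_open[OF assms(1)])
    show "continuous_on {a..b} (\<lambda>x. u x * exp (- H x))"
      by (intro continuous_intros u contH)
    fix x assume x: "a < x" "x < b"
    have "((\<lambda>x. u x * exp (- H x)) has_real_derivative (u' x - h x * u x) * exp (- H x)) (at x)"
      by (rule derivative_eq_intros refl der[OF x] derH[OF x])+ (simp add: algebra_simps)
    moreover have "(u' x - h x * u x) * exp (- H x) > 0" using less[OF x] by simp
    ultimately show "\<exists>y. ((\<lambda>x. u x * exp (- H x)) has_real_derivative y) (at x) \<and> 0 < y" by blast
  qed
  moreover have "0 \<le> u a * exp (- H a)" using assms(6) by simp
  ultimately have "0 < u b * exp (- H b)" by linarith
  then show ?thesis by (simp add: zero_less_mult_iff)
qed

text \<open>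
  The solution of angular momentum \<open>N\<close> is followed from the point belonging to \<open>(N-1, N)\<close> to the
  one belonging to \<open>(N, N+1)\<close>. With \<open>d = z - N\<close> and \<open>v = d\<^sup>2 - 2 \<eta> z\<close> these are the points where
  \<open>v = -d\<close> and \<open>v = d\<close>, and \<open>v / 4\<close> is the inhomogeneity of the Riccati equation. The function
  \<open>\<sigma> = - d (d\<^sup>2 - v\<^sup>2) / (8 z (d\<^sup>2 + 2 \<eta> N))\<close> vanishes at both points and is a strict lower solution
  between them, so a slope that starts above \<open>\<sigma>\<close> ends strictly above it.
\<close>

lemma fiber_slope_propagation:
  assumes \<eta>: "0 < \<eta>" "\<eta> < 1" and N: "N \<ge> 1"
    and zm: "zm > real N" "(zm - real N) * (zm - real N + 1) = 2 * \<eta> * zm"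
    and zp: "zp > real N" "(zp - real N) * (zp - real N - 1) = 2 * \<eta> * zp"
    and start: "fiber_slope \<eta> N zm \<ge> 0"
  shows "zm < zp" and "fiber_slope \<eta> N zp > 0"
proof -
  define n where "n = real N"
  have n: "n \<ge> 1" using N by (simp add: n_def)
  define dm dp where "dm = zm - n" and "dp = zp - n"
  have dmp: "dm > 0" "dp > 0" using zm zp by (simp_all add: dm_def dp_def n_def)
  have eqm: "dm * (dm + 1 - 2 * \<eta>) = 2 * \<eta> * n" and eqp: "dp * (dp - 1 - 2 * \<eta>) = 2 * \<eta> * n"
    using zm(2) zp(2) by (simp_all add: dm_def dp_def n_def algebra_simps)
  have "2 * \<eta> * n > 0" using \<eta> n by simp
  then have posm: "dm + 1 - 2 * \<eta> > 0" and posp: "dp - 1 - 2 * \<eta> > 0"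
    using eqm eqp dmp by (metis zero_less_mult_pos)+
  \<comment> \<open>The factorizations below show \<open>\<bar>v\<bar> < d\<close> strictly between the two end points.\<close>
  define v where "v z = (z - n)\<^sup>2 - 2 * \<eta> * z" for z
  have fm: "(z - n) + v z = (z - n - dm) * (z - n + (dm + 1 - 2 * \<eta>))" for z
    using eqm by (simp add: v_def power2_eq_square algebra_simps)
  have fp: "(z - n) - v z = (dp - (z - n)) * (z - n + (dp - 1 - 2 * \<eta>))" for z
    using eqp by (simp add: v_def power2_eq_square algebra_simps)
  show less: "zm < zp"
  proof -
    have "dm + v zm = 0" using fm[of zm] by (simp add: dm_def)
    then have "(dp - dm) * (dm + (dp - 1 - 2 * \<eta>)) > 0"
      using fp[of zm] dmp by (simp add: dm_def)
    then have "dp - dm > 0" using dmp posp by (simp add: zero_less_mult_iff)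
    then show ?thesis by (simp add: dm_def dp_def)
  qed
  define P where "P z = (z - n)\<^sup>2 + 2 * \<eta> * n" for z
  have P: "P z > 0" for z
    using \<open>2 * \<eta> * n > 0\<close> by (simp add: P_def add_nonneg_pos)
  define \<sigma> where "\<sigma> z = - ((z - n) * ((z - n)\<^sup>2 - (v z)\<^sup>2)) / (8 * z * P z)" for z
  define \<sigma>' where "\<sigma>' z =
    (- (((z - n)\<^sup>2 - (v z)\<^sup>2) + (z - n) * (2 * (z - n) - 2 * v z * (2 * (z - n) - 2 * \<eta>))) * (8 * z * P z)
     + ((z - n) * ((z - n)\<^sup>2 - (v z)\<^sup>2)) * (8 * P z + 8 * z * (2 * (z - n)))) / (8 * z * P z)\<^sup>2" for z
  have d\<sigma>: "(\<sigma> has_real_derivative \<sigma>' z) (at z)" if "z > 0" for z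
  proof -
    have quotient: "(- x * d - - y * e) / (d * d) = (- x * d + y * e) / d\<^sup>2" for x y d e :: real
      by (simp add: power2_eq_square)
    have dv: "(v has_real_derivative 2 * (z - n) - 2 * \<eta>) (at z)"
      unfolding v_def[abs_def] by (auto intro!: derivative_eq_intros)
    have dP: "(P has_real_derivative 2 * (z - n)) (at z)"
      unfolding P_def[abs_def] by (auto intro!: derivative_eq_intros)
    have num: "((\<lambda>z. - ((z - n) * ((z - n)\<^sup>2 - (v z)\<^sup>2))) has_real_derivative
        - (((z - n)\<^sup>2 - (v z)\<^sup>2) + (z - n) * (2 * (z - n) - 2 * v z * (2 * (z - n) - 2 * \<eta>)))) (at z)"
      by (auto intro!: derivative_eq_intros dv)
    have den: "((\<lambda>z. 8 * z * P z) has_real_derivative 8 * P z + 8 * z * (2 * (z - n))) (at z)"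
      by (auto intro!: derivative_eq_intros dP)
    have "8 * z * P z \<noteq> 0" using that P[of z] by simp
    from DERIV_divide[OF num den this] show ?thesis
      unfolding \<sigma>_def[abs_def] \<sigma>'_def
      by (rule DERIV_cong) (rule quotient)
  qed
  have ident: "z * \<sigma>' z - v z / 4 + (\<sigma> z)\<^sup>2 =
      ((z - n)\<^sup>2 - (v z)\<^sup>2) / (8 * P z) *
       ((z - n) / z + 2 * (z - n)\<^sup>2 / P z - 3 + (z - n)\<^sup>2 * ((z - n)\<^sup>2 - (v z)\<^sup>2) / (8 * z\<^sup>2 * P z))"
    if z: "z > 0" for z
  proof -
    define d p w where "d = z - n" and "p = P z" and "w = v z"
    have pw: "p > 0" "p = w + 2 * \<eta> * (n + z)" "w = d\<^sup>2 - 2 * \<eta> * z"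
      using P by (simp_all add: p_def w_def P_def v_def d_def algebra_simps)
    have nz: "n = z - d" by (simp add: d_def)
    have pw2: "p = d\<^sup>2 + 2 * \<eta> * (z - d)" by (simp add: p_def P_def d_def)
    have s1: "z * \<sigma>' z = (- ((d\<^sup>2 - w\<^sup>2) + d * (2 * d - 2 * w * (2 * d - 2 * \<eta>))) * z * p
        + d * (d\<^sup>2 - w\<^sup>2) * (p + 2 * z * d)) / (8 * z * p\<^sup>2)"
      using z pw(1) unfolding \<sigma>'_def d_def[symmetric] p_def[symmetric] w_def[symmetric]
      by (simp add: divide_simps) (simp add: algebra_simps power2_eq_square)
    have s2: "(\<sigma> z)\<^sup>2 = d\<^sup>2 * (d\<^sup>2 - w\<^sup>2)\<^sup>2 / (64 * z\<^sup>2 * p\<^sup>2)"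
      unfolding \<sigma>_def d_def[symmetric] p_def[symmetric] w_def[symmetric]
      by (simp add: power_divide power_mult_distrib)
    have "d * (2 * d - 2 * w * (2 * d - 2 * \<eta>)) = 2 * d\<^sup>2 - 2 * w * (p + w)"
      by (simp add: pw2 pw(3) algebra_simps power2_eq_square)
    then have s3: "z * \<sigma>' z - w / 4 = (d\<^sup>2 - w\<^sup>2) * (d * p + 2 * z * d\<^sup>2 - 3 * z * p) / (8 * z * p\<^sup>2)"
      unfolding s1 using z pw(1)
      by (simp add: divide_simps) (simp add: algebra_simps power2_eq_square)
    show ?thesis unfolding d_def[symmetric] p_def[symmetric] w_def[symmetric] s3 s2
      using z pw(1) by (simp add: divide_simps) (simp add: algebra_simps power2_eq_square)
  qed
  have strict: "z * \<sigma>' z < v z / 4 - (\<sigma> z)\<^sup>2" if z: "zm < z" "z < zp" for z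
  proof -
    define d where "d = z - n"
    have d: "d > 0" "d > dm" "d < dp" using z dmp by (simp_all add: d_def dm_def dp_def)
    have z0: "z > 0" "d < z" using d n by (simp_all add: d_def)
    have p1: "d + v z > 0" unfolding d_def fm using d posm dmp by (intro mult_pos_pos) (auto simp: d_def)
    have p2: "d - v z > 0" unfolding d_def fp using d posp dmp by (intro mult_pos_pos) (auto simp: d_def)
    have D: "d\<^sup>2 - (v z)\<^sup>2 > 0"
      using mult_pos_pos[OF p1 p2] by (simp add: algebra_simps power2_eq_square)
    \<comment> \<open>The bracket in the identity is less than \<open>x + x\<^sup>2 / 8 - 1\<close> with \<open>x = d / z\<close>, negative for \<open>x < 4 / 5\<close>.\<close>
    have "d * d - 3 * d < 2 * n"
    proof -
      have "d * (d - 1) < 2 * \<eta> * z" using p2 by (simp add: v_def d_def power2_eq_square algebra_simps)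
      also have "\<dots> < 2 * z" using \<eta> z0 by simp
      finally show ?thesis by (simp add: d_def algebra_simps)
    qed
    have "d < 4 * n"
    proof (rule ccontr)
      assume "\<not> d < 4 * n"
      then have "(d - 3) * d \<ge> 1 * d" using n d(1) by (intro mult_right_mono) auto
      then have "d \<le> d * d - 3 * d" by (simp only: left_diff_distrib mult_1)
      with \<open>d * d - 3 * d < 2 * n\<close> \<open>\<not> d < 4 * n\<close> n show False by linarith
    qed
    then have q: "d / z < 4 / 5" using z0 by (simp add: d_def field_simps)
    have dP: "d\<^sup>2 < P z" using \<open>2 * \<eta> * n > 0\<close> by (simp add: P_def d_def)
    have "d\<^sup>2 / P z * (2 + (d\<^sup>2 - (v z)\<^sup>2) / (8 * z\<^sup>2)) \<le> 1 * (2 + (4/5)\<^sup>2 / 8)"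
    proof (rule mult_mono)
      show "d\<^sup>2 / P z \<le> 1" using dP P[of z] by simp
      have "(d\<^sup>2 - (v z)\<^sup>2) / (8 * z\<^sup>2) \<le> (d / z)\<^sup>2 / 8" using z0 by (simp add: power_divide divide_simps)
      also have "(d / z)\<^sup>2 \<le> (4/5)\<^sup>2" using q d z0 by (intro power_mono) auto
      finally show "2 + (d\<^sup>2 - (v z)\<^sup>2) / (8 * z\<^sup>2) \<le> 2 + (4/5)\<^sup>2 / 8" by simp
    qed (use D z0 in auto)
    moreover have "d\<^sup>2 / P z * (2 + (d\<^sup>2 - (v z)\<^sup>2) / (8 * z\<^sup>2))
        = 2 * d\<^sup>2 / P z + d\<^sup>2 * (d\<^sup>2 - (v z)\<^sup>2) / (8 * z\<^sup>2 * P z)"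
      by (simp add: distrib_left mult_ac)
    ultimately have "d / z + 2 * d\<^sup>2 / P z - 3 + d\<^sup>2 * (d\<^sup>2 - (v z)\<^sup>2) / (8 * z\<^sup>2 * P z) < 0"
      using q by (simp add: power2_eq_square)
    then have "(d\<^sup>2 - (v z)\<^sup>2) / (8 * P z) * (d / z + 2 * d\<^sup>2 / P z - 3 + d\<^sup>2 * (d\<^sup>2 - (v z)\<^sup>2) / (8 * z\<^sup>2 * P z)) < 0"
      using D P[of z] by (intro mult_pos_neg) auto
    then show ?thesis using ident[OF z0(1)] by (simp add: d_def)
  qed
  have zpos: "z > 0" if "z \<in> {zm..zp}" for z using that zm n by (simp add: n_def)
  let ?w = "fiber_slope \<eta> N"
  have contw: "continuous_on {zm..zp} ?w" and cont\<sigma>: "continuous_on {zm..zp} \<sigma>"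
    by (meson DERIV_isCont continuous_at_imp_continuous_on fiber_slope_riccati less_imp_le zpos \<eta> d\<sigma>)+
  have "?w zp - \<sigma> zp > 0"
  proof (rule strict_gronwall_pos[OF less, of "\<lambda>z. ?w z - \<sigma> z" "\<lambda>z. - (?w z + \<sigma> z) / z"
        "\<lambda>z. (v z / 4 - (?w z)\<^sup>2) / z - \<sigma>' z"])
    show "continuous_on {zm..zp} (\<lambda>z. ?w z - \<sigma> z)" by (intro continuous_intros contw cont\<sigma>)
    show "continuous_on {zm..zp} (\<lambda>z. - (?w z + \<sigma> z) / z)"
      using zpos by (intro continuous_intros contw cont\<sigma>) force
    fix z assume z: "zm < z" "z < zp"
    then have z0: "z > 0" using zpos by simp
    show "((\<lambda>z. ?w z - \<sigma> z) has_real_derivative (v z / 4 - (?w z)\<^sup>2) / z - \<sigma>' z) (at z)"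
      using fiber_slope_riccati[OF less_imp_le[OF \<eta>(2)] z0, of N] d\<sigma>[OF z0]
      by (auto intro!: DERIV_diff simp: v_def n_def)
    show "- (?w z + \<sigma> z) / z * (?w z - \<sigma> z) < (v z / 4 - (?w z)\<^sup>2) / z - \<sigma>' z"
      using strict[OF z] z0 by (simp add: divide_simps) (simp add: algebra_simps power2_eq_square)
  next
    have "dm\<^sup>2 - (v zm)\<^sup>2 = (dm + v zm) * (dm - v zm)" by (simp add: algebra_simps power2_eq_square)
    then have "\<sigma> zm = 0" using fm[of zm] by (simp add: \<sigma>_def dm_def)
    then show "?w zm - \<sigma> zm \<ge> 0" using start by simp
  qed
  moreover have "\<sigma> zp = 0"
  proof -
    have "dp\<^sup>2 - (v zp)\<^sup>2 = (dp + v zp) * (dp - v zp)" by (simp add: algebra_simps power2_eq_square)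
    then show ?thesis using fp[of zp] by (simp add: \<sigma>_def dp_def)
  qed
  ultimately show "?w zp > 0" by simp
qed

section \<open>The radial eigenvalues\<close>

text \<open>
  At a regular end point finite energy keeps \<open>V\<close> bounded.
\<close>

lemma (in weighted_interval) primitive_increment_bound:
  assumes V: "primitive_on S V G" "G \<in> borel_measurable (lebesgue_on S)"
    "integrable (lebesgue_on S) (\<lambda>r. \<rho> r * (cmod (G r))\<^sup>2)"
    and ct: "c \<in> S" "t \<in> S" "c \<le> t" and m: "m > 0" "\<And>x. x \<in> {c..t} \<Longrightarrow> m \<le> \<rho> x"
  shows "cmod (V t - V c) \<le> (t - c) + (LINT r|lebesgue_on S. \<rho> r * (cmod (G r))\<^sup>2) / m"
proof -
  have sub: "{c..t} \<subseteq> S" by (rule Icc_subset_interval[OF intervalS ct(1,2)])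
  have aG: "G absolutely_integrable_on {c..t}" by (rule primitive_onD(1)[OF V(1) ct])
  let ?e = "\<lambda>r. \<rho> r * (cmod (G r))\<^sup>2"
  have aS: "?e absolutely_integrable_on S" using V(3) by (simp add: set_integrable_def integrable_restrict_space)
  have ae: "?e absolutely_integrable_on {c..t}" by (rule set_integrable_subset[OF aS]) (use sub in auto)
  have ie: "?e integrable_on {c..t}" "?e integrable_on S"
    using ae aS set_lebesgue_integral_eq_integral(1) by blast+
  have "cmod (V t - V c) \<le> integral {c..t} (\<lambda>x. 1 + ?e x / m)"
    unfolding primitive_onD(2)[OF V(1) ct]
  proof (rule integral_norm_bound_integral)
    show "G integrable_on {c..t}" using aG set_lebesgue_integral_eq_integral(1) by blast
    show "(\<lambda>x. 1 + ?e x / m) integrable_on {c..t}"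
      by (intro integrable_add integrable_on_divide ie(1)) auto
    fix x assume x: "x \<in> {c..t}"
    have "cmod (G x) \<le> 1 + (cmod (G x))\<^sup>2"
      using zero_le_power2[of "cmod (G x) - 1/2"] by (simp add: power2_eq_square algebra_simps)
    also have "(cmod (G x))\<^sup>2 \<le> ?e x / m"
      using m(1) mult_right_mono[OF m(2)[OF x], of "(cmod (G x))\<^sup>2"] by (simp add: pos_le_divide_eq mult.commute)
    finally show "norm (G x) \<le> 1 + ?e x / m" by simp
  qed
  also have "\<dots> = (t - c) + integral {c..t} ?e / m"
    using ct(3) ie(1) by (subst integral_add) (auto intro: integrable_on_divide)
  also have "integral {c..t} ?e \<le> integral S ?e"
    using sub ie weight_pos by (intro integral_subset_le) (auto simp: less_imp_le)
  also have "integral S ?e = (LINT r|lebesgue_on S. ?e r)"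
    using V(3) by (simp add: lebesgue_integral_eq_integral)
  finally show ?thesis using m(1) by (simp add: divide_right_mono)
qed

text \<open>
  Otherwise \<open>I\<close> would dominate a multiple of \<open>1 / s\<close> near 0.
\<close>

lemma small_near_zero:
  fixes I :: "real \<Rightarrow> real"
  assumes I: "integrable (lebesgue_on {0<..<1}) I" and nn: "\<And>r. 0 < r \<Longrightarrow> r < 1 \<Longrightarrow> I r \<ge> 0"
    and "\<delta> > 0" "\<epsilon> > 0"
  shows "\<exists>s. 0 < s \<and> s < \<delta> \<and> s < 1 \<and> s * I s < \<epsilon>"
proof (rule ccontr)
  assume *: "\<not> ?thesis"
  define d where "d = min \<delta> 1 / 2"
  have d: "0 < d" "d < \<delta>" "d < 1" using assms(3) by (auto simp: d_def min_def)
  have ge: "I s \<ge> \<epsilon> / s" if "0 < s" "s \<le> d" for s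
  proof -
    have "\<not> s * I s < \<epsilon>" using * that d by (meson le_less_trans)
    then show ?thesis using that by (simp add: pos_divide_le_eq mult.commute)
  qed
  have aS: "I absolutely_integrable_on {0<..<1}"
    using I by (simp add: set_integrable_def integrable_restrict_space)
  then have iS: "I integrable_on {0<..<1}" using set_lebesgue_integral_eq_integral(1) by blast
  have bound: "\<epsilon> * (ln d - ln a) \<le> integral {0<..<1} I" if a: "0 < a" "a \<le> d" for a
  proof -
    have "((\<lambda>s. \<epsilon> / s) has_integral \<epsilon> * ln d - \<epsilon> * ln a) {a..d}"
      by (rule fundamental_theorem_of_calculus[OF a(2)])
         (use a in \<open>auto intro!: derivative_eq_intros simp: has_real_derivative_iff_has_vector_derivative[symmetric]\<close>)
    moreover have "I absolutely_integrable_on {a..d}"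
      by (rule set_integrable_subset[OF aS]) (use a d in auto)
    then have ia: "I integrable_on {a..d}" using set_lebesgue_integral_eq_integral(1) by blast
    ultimately have "\<epsilon> * ln d - \<epsilon> * ln a \<le> integral {a..d} I"
      using ge a by (intro has_integral_le[OF _ integrable_integral[OF ia]]) auto
    also have "\<dots> \<le> integral {0<..<1} I"
      using a d ia iS nn by (intro integral_subset_le) auto
    finally show ?thesis by (simp add: right_diff_distrib)
  qed
  define J where "J = integral {0<..<1} I"
  have J: "J \<ge> 0" using bound[of d] d by (simp add: J_def)
  have "ln (d * exp (- ((J + 1) / \<epsilon>))) = ln d - (J + 1) / \<epsilon>"
    using d by (simp add: ln_mult)
  moreover have "d * exp (- ((J + 1) / \<epsilon>)) \<le> d" using d J assms(4) by (simp add: mult_left_le)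
  ultimately have "\<epsilon> * ((J + 1) / \<epsilon>) \<le> J"
    using bound[of "d * exp (- ((J + 1) / \<epsilon>))"] d by (simp add: J_def)
  then show False using assms(4) by simp
qed

lemma integrable_unit_interval:
  fixes h :: "real \<Rightarrow> real"
  assumes "continuous_on {0..1} h" "\<And>r. 0 < r \<Longrightarrow> r < 1 \<Longrightarrow> k r = h r"
  shows "integrable (lebesgue_on {0<..<1}) k"
proof -
  have "h absolutely_integrable_on {0..1}" by (rule absolutely_integrable_continuous_real[OF assms(1)])
  then have "h absolutely_integrable_on {0<..<1}" by (rule set_integrable_subset) auto
  then have "integrable (lebesgue_on {0<..<1}) h" by (simp add: set_integrable_def integrable_restrict_space)
  then show ?thesis using assms(2) by (subst Bochner_Integration.integrable_cong[of _ _ k h]) auto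
qed

lemma fiber_slope_bound:
  assumes "0 \<le> \<eta>" "\<eta> \<le> 1" "z > 0"
  shows "\<bar>2 * fiber_slope \<eta> n z\<bar> \<le> real n + z"
proof -
  define m where "m = fiber_slope \<eta> n z - (real n - z) / 2"
  have "m < z" using fiber_slope_Suc(1)[OF assms, of n] by (simp add: m_def)
  moreover have "m \<ge> 0"
    using assms kummer_ge_1[of "(1 - \<eta>) / 2" "real n + 1" z]
      kummer_ge_1[of "(1 - \<eta>) / 2 + 1" "real n + 1 + 1" z]
    by (auto simp: m_def fiber_slope_def kummer'_def intro!: divide_nonneg_nonneg mult_nonneg_nonneg)
  moreover have "2 * fiber_slope \<eta> n z = real n - z + 2 * m" by (simp add: m_def field_simps)
  ultimately show ?thesis by auto
qed

definition fiber_state :: "real \<Rightarrow> nat \<Rightarrow> real \<Rightarrow> real \<Rightarrow> real" where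
  "fiber_state \<eta> n b r =
     r ^ n * exp (- b * r\<^sup>2 / 4) * kummer ((1 - \<eta>) / 2) (real n + 1) (b * r\<^sup>2 / 2)"

lemma fiber_state_pos:
  "\<eta> \<le> 1 \<Longrightarrow> b > 0 \<Longrightarrow> r > 0 \<Longrightarrow> fiber_state \<eta> n b r > 0"
  using kummer_ge_1[of "(1 - \<eta>) / 2" "real n + 1" "b * r\<^sup>2 / 2"] by (simp add: fiber_state_def)

lemma fiber_state_deriv:
  assumes "\<eta> \<le> 1" "b > 0" "r > 0"
  shows "(fiber_state \<eta> n b has_real_derivative
     2 * fiber_slope \<eta> n (b * r\<^sup>2 / 2) / r * fiber_state \<eta> n b r) (at r)"
proof -
  define a c where "a = (1 - \<eta>) / 2" and "c = real n + 1"
  have c: "c > 0" by (simp add: c_def)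
  define K K1 where "K = kummer a c (b * r\<^sup>2 / 2)" and "K1 = kummer' a c (b * r\<^sup>2 / 2)"
  have K: "K > 0" using kummer_ge_1[of a c "b * r\<^sup>2 / 2"] assms c by (simp add: K_def a_def)
  have dK: "((\<lambda>r. kummer a c (b * r\<^sup>2 / 2)) has_real_derivative K1 * (b * r)) (at r)"
    unfolding K1_def by (rule DERIV_chain2[OF kummer_deriv[OF c]]) (auto intro!: derivative_eq_intros)
  have dE: "((\<lambda>r. exp (- b * r\<^sup>2 / 4)) has_real_derivative exp (- b * r\<^sup>2 / 4) * (- b * r / 2)) (at r)"
    by (auto intro!: derivative_eq_intros)
  have dP: "((\<lambda>r. r ^ n) has_real_derivative real n * r ^ n / r) (at r)"
    using DERIV_pow[of n r] assms(3) by (cases n) auto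
  have "((\<lambda>r. r ^ n * exp (- b * r\<^sup>2 / 4) * kummer a c (b * r\<^sup>2 / 2)) has_real_derivative
     (real n * r ^ n / r * exp (- b * r\<^sup>2 / 4) + exp (- b * r\<^sup>2 / 4) * (- b * r / 2) * r ^ n) * K
      + K1 * (b * r) * (r ^ n * exp (- b * r\<^sup>2 / 4))) (at r)"
    unfolding K_def by (intro DERIV_mult dK dE dP)
  moreover have "2 * fiber_slope \<eta> n (b * r\<^sup>2 / 2) / r * fiber_state \<eta> n b r
     = (real n * r ^ n / r * exp (- b * r\<^sup>2 / 4) + exp (- b * r\<^sup>2 / 4) * (- b * r / 2) * r ^ n) * K
      + K1 * (b * r) * (r ^ n * exp (- b * r\<^sup>2 / 4))"
    unfolding fiber_slope_def fiber_state_def a_def[symmetric] c_def[symmetric] K_def[symmetric] K1_def[symmetric]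
    using K assms(3) by (simp add: divide_simps) (simp add: algebra_simps power2_eq_square)
  ultimately show ?thesis by (simp add: fiber_state_def[abs_def] a_def c_def)
qed

lemma fiber_state_ode:
  assumes "\<eta> \<le> 1" "b > 0" "r > 0"
  shows "((\<lambda>r. 2 * fiber_slope \<eta> n (b * r\<^sup>2 / 2) * fiber_state \<eta> n b r) has_real_derivative
     ((real n / r - b / 2 * r)\<^sup>2 - b * \<eta>) * (r * fiber_state \<eta> n b r)) (at r)"
proof -
  define z where "z = b * r\<^sup>2 / 2"
  define w F where "w = fiber_slope \<eta> n z" and "F = fiber_state \<eta> n b r"
  have z: "z > 0" using assms by (simp add: z_def)
  have dw: "((\<lambda>r. fiber_slope \<eta> n (b * r\<^sup>2 / 2)) has_real_derivative
      (((z - real n)\<^sup>2 - 2 * \<eta> * z) / 4 - w\<^sup>2) / z * (b * r)) (at r)"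
    unfolding w_def z_def
    by (rule DERIV_chain2[OF fiber_slope_riccati]) (use assms in \<open>auto intro!: derivative_eq_intros\<close>)
  have "((\<lambda>r. 2 * fiber_slope \<eta> n (b * r\<^sup>2 / 2) * fiber_state \<eta> n b r) has_real_derivative
     2 * ((((z - real n)\<^sup>2 - 2 * \<eta> * z) / 4 - w\<^sup>2) / z * (b * r)) * F + 2 * w / r * F * (2 * w)) (at r)"
    unfolding F_def w_def z_def
    by (rule DERIV_mult[OF DERIV_cmult[OF dw[unfolded w_def z_def]] fiber_state_deriv[OF assms]])
  moreover have "2 * ((((z - real n)\<^sup>2 - 2 * \<eta> * z) / 4 - w\<^sup>2) / z * (b * r)) * F + 2 * w / r * F * (2 * w)
      = ((real n / r - b / 2 * r)\<^sup>2 - b * \<eta>) * (r * F)"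
  proof -
    have "b * r / z = 2 / r" using assms by (simp add: z_def field_simps power2_eq_square)
    then have "X / z * (b * r) = X * (2 / r)" for X by (metis times_divide_eq_left times_divide_eq_right mult.commute)
    moreover have "(real n / r - b / 2 * r) = (real n - z) / r"
      using assms(3) by (simp add: z_def field_simps power2_eq_square)
    moreover have "b = 2 * z / r\<^sup>2" using assms(3) by (simp add: z_def)
    ultimately show ?thesis
      using assms(3) by (simp only:) (simp add: field_simps power2_eq_square)
  qed
  ultimately show ?thesis by (simp add: F_def)
qed

text \<open>
  At \<open>r = 1\<close> the boundary terms vanish by the Neumann condition. At \<open>r = 0\<close> they are bounded by
  multiples of \<open>r\<close> times the energy density and of the square root of this product;
  \<open>small_near_zero\<close> provides a sequence along which it tends to zero.
\<close>

lemma fiber_ground_state: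
  assumes \<eta>: "0 < \<eta>" "\<eta> < 1" and b: "b > 0" and zero: "fiber_slope \<eta> n (b / 2) = 0"
  shows "positive_ground_state {0<..<1} (\<lambda>r. r) (\<lambda>r. real n / r - b / 2 * r)
     (fiber_state \<eta> n b) (\<lambda>r. 2 * fiber_slope \<eta> n (b * r\<^sup>2 / 2) / r * fiber_state \<eta> n b r) (b * \<eta>)"
proof -
  let ?S = "{0<..<1::real}"
  let ?p = "\<lambda>r. real n / r - b / 2 * r"
  let ?w = "\<lambda>r. fiber_slope \<eta> n (b * r\<^sup>2 / 2)"
  let ?f = "fiber_state \<eta> n b"
  let ?f1 = "\<lambda>r. 2 * ?w r / r * ?f r"
  let ?K = "\<lambda>r. kummer ((1 - \<eta>) / 2) (real n + 1) (b * r\<^sup>2 / 2)"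
  let ?K1 = "\<lambda>r. kummer' ((1 - \<eta>) / 2) (real n + 1) (b * r\<^sup>2 / 2)"
  let ?E = "\<lambda>r. exp (- b * r\<^sup>2 / 4)"
  have Kpos: "?K r > 0" for r using kummer_ge_1[of "(1 - \<eta>) / 2" "real n + 1" "b * r\<^sup>2 / 2"] \<eta> b by simp
  interpret weighted_interval ?S "\<lambda>r. r" ?p
    by standard (auto intro!: continuous_intros simp: is_interval_oo)
  have pow: "real n * r ^ n / r = real n * r ^ (n - 1)" if "r > 0" for r
    using that by (cases n) auto
  define g1 where "g1 r = (real n * r ^ (n - 1) - b * r / 2 * r ^ n) * (?E r * ?K r) + r ^ n * ?E r * (b * r * ?K1 r)" for r
  define gp where "gp r = (real n * r ^ (n - 1) - b / 2 * r * r ^ n) * (?E r * ?K r)" for r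
  have f1: "?f1 r = g1 r" if "r > 0" for r
  proof -
    have "?f1 r = (real n * r ^ n / r - b * r / 2 * r ^ n) * (?E r * ?K r) + r ^ n * ?E r * (b * r * ?K1 r)"
      using that Kpos[of r] by (simp add: fiber_slope_def fiber_state_def divide_simps)
        (simp add: algebra_simps power2_eq_square)
    then show ?thesis by (simp add: g1_def pow[OF that])
  qed
  have pf: "?p r * ?f r = gp r" if "r > 0" for r
  proof -
    have "?p r * ?f r = (real n * r ^ n / r - b / 2 * r * r ^ n) * (?E r * ?K r)"
      by (simp add: fiber_state_def algebra_simps)
    then show ?thesis by (simp add: gp_def pow[OF that])
  qed
  have cK: "continuous_on A ?K" "continuous_on A ?K1" "continuous_on A ?E" for A
    by (intro continuous_intros; simp)+
  have cf: "continuous_on A ?f" and cg1: "continuous_on A g1" and cgp: "continuous_on A gp" for A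
    unfolding fiber_state_def[abs_def] g1_def[abs_def] gp_def[abs_def]
    by (intro continuous_intros cK; simp)+
  obtain C where C: "\<And>r. r \<in> {0..1} \<Longrightarrow> \<bar>g1 r\<bar> \<le> C" "C \<ge> 0"
  proof -
    have "bounded (g1 ` {0..1})"
      by (intro compact_imp_bounded compact_continuous_image cg1) auto
    then obtain B where B: "\<forall>x\<in>g1 ` {0..1}. norm x \<le> B"
      unfolding bounded_iff by blast
    have "\<bar>g1 r\<bar> \<le> \<bar>B\<bar>" if "r \<in> {0..1}" for r
      using B that by (metis abs_ge_self imageI order_trans real_norm_def)
    from that[OF this abs_ge_zero] show thesis .
  qed
  show ?thesis
  proof
    fix r assume r: "r \<in> ?S"
    then show "?f r > 0" using \<eta> b by (intro fiber_state_pos) auto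
    show "(?f has_real_derivative ?f1 r) (at r)" using r \<eta> b by (intro fiber_state_deriv) auto
    have "((\<lambda>r. 2 * ?w r * ?f r) has_real_derivative ((?p r)\<^sup>2 - b * \<eta>) * (r * ?f r)) (at r)"
      using r \<eta> b by (intro fiber_state_ode) auto
    moreover have "\<forall>\<^sub>F x in nhds r. 2 * ?w x * ?f x = x * ?f1 x"
      by (rule eventually_mono[OF eventually_nhds_in_open[of ?S r]]) (use r in auto)
    ultimately show "((\<lambda>r. r * ?f1 r) has_real_derivative ((?p r)\<^sup>2 - b * \<eta>) * (r * ?f r)) (at r)"
      using DERIV_cong_ev[of r r "\<lambda>r. 2 * ?w r * ?f r" "\<lambda>r. r * ?f1 r"] by simp
  next
    show "continuous_on ?S ?f1"
      by (rule continuous_on_eq[OF cg1], rule f1[symmetric]) simp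
    show "integrable (lebesgue_on ?S) (\<lambda>r. r * (?f r)\<^sup>2)"
      by (rule integrable_unit_interval[of "\<lambda>r. r * (?f r)\<^sup>2"]) (auto intro!: continuous_intros cf)
    show "integrable (lebesgue_on ?S) (\<lambda>r. r * (?f1 r)\<^sup>2)"
      by (rule integrable_unit_interval[of "\<lambda>r. r * (g1 r)\<^sup>2"]) (auto intro!: continuous_intros cg1 simp only: f1)
    show "integrable (lebesgue_on ?S) (\<lambda>r. r * (?p r * ?f r)\<^sup>2)"
      by (rule integrable_unit_interval[of "\<lambda>r. r * (gp r)\<^sup>2"]) (auto intro!: continuous_intros cgp simp only: pf)
  next
    fix V G :: "real \<Rightarrow> complex"
    assume V: "primitive_on ?S V G" "continuous_on ?S V"
      and Gm: "G \<in> borel_measurable (lebesgue_on ?S)"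
      and V': "integrable (lebesgue_on ?S) (\<lambda>r. r * (cmod (V r))\<^sup>2)"
      "integrable (lebesgue_on ?S) (\<lambda>r. r * (cmod (G r))\<^sup>2)"
      "integrable (lebesgue_on ?S) (\<lambda>r. r * (cmod (of_real (?p r) * V r))\<^sup>2)"
    let ?I = "\<lambda>r. r * (cmod (V r))\<^sup>2 + r * (cmod (of_real (?p r) * V r))\<^sup>2"
    have I: "r * ?I r = r\<^sup>2 * (1 + (?p r)\<^sup>2) * (cmod (V r))\<^sup>2" for r
    proof -
      have aux: "r * (r * c + r * (q * c)) = r\<^sup>2 * (1 + q) * c" for q c :: real
        by (simp add: power2_eq_square algebra_simps)
      show ?thesis unfolding norm_mult power_mult_distrib norm_of_real power2_abs by (rule aux)
    qed
    \<comment> \<open>The second bound keeps \<open>b r\<^sup>2 / 2\<close> at most \<open>1 / 2\<close>, away from the zero of the potential if \<open>n > 0\<close>.\<close>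
    define d where "d k = min (1 / (real k + 3)) (1 / (1 + b))" for k
    have d: "d k > 0" for k using b by (simp add: d_def)
    have "\<exists>s. \<forall>k. 0 < s k \<and> s k < d k \<and> s k < 1 \<and> s k * ?I (s k) < 1 / (real k + 1)"
      by (rule choice, rule allI, rule small_near_zero) (use V'(1,3) d in auto)
    then obtain s where s: "\<And>k. 0 < s k" "\<And>k. s k < d k" "\<And>k. s k < 1"
      "\<And>k. s k * ?I (s k) < 1 / (real k + 1)" by blast
    define t where "t k = 1 - 1 / (real k + 3)" for k
    have sk3: "s k < 1 / (real k + 3)" for k using s(2)[of k] by (simp add: d_def)
    have k3: "1 / (real k + 3) \<le> 1 / 3" for k by (simp add: divide_simps)
    have t: "2 / 3 \<le> t k" "t k < 1" for k using k3[of k] by (auto simp: t_def)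
    have sb: "b * (s k)\<^sup>2 / 2 \<le> 1 / 2" for k
    proof -
      have "s k * (1 + b) < 1" using s(2)[of k] b by (simp add: d_def pos_less_divide_eq)
      then have "b * s k \<le> 1" using s(1)[of k] by (simp add: algebra_simps)
      then have "(b * s k) * s k \<le> 1 * 1" using s(1,3)[of k] by (intro mult_mono) auto
      then show ?thesis by (simp add: power2_eq_square)
    qed
    have lim0: "(\<lambda>k. 1 / (real k + 1)) \<longlonglongrightarrow> 0" "(\<lambda>k. 1 / (real k + 3)) \<longlonglongrightarrow> 0"
      using LIMSEQ_inverse_real_of_nat LIMSEQ_ignore_initial_segment[OF LIMSEQ_inverse_real_of_nat, of 2]
      by (simp_all add: inverse_eq_divide add_ac)
    have tlim: "t \<longlonglongrightarrow> 1" using tendsto_diff[OF tendsto_const lim0(2), of 1] by (simp add: t_def[abs_def])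
    have Vs: "(s k * cmod (V (s k)))\<^sup>2 \<le> 1 / (real k + 1)" for k
    proof -
      have "(s k * cmod (V (s k)))\<^sup>2 \<le> (s k)\<^sup>2 * (1 + (?p (s k))\<^sup>2) * (cmod (V (s k)))\<^sup>2"
        by (auto simp: power_mult_distrib algebra_simps)
      then show ?thesis using s(4)[of k] I[of "s k"] by linarith
    qed
    have s1: "(\<lambda>k. s k * ?f1 (s k) * cmod (V (s k))) \<longlonglongrightarrow> 0"
    proof (rule Lim_null_comparison)
      show "\<forall>\<^sub>F k in sequentially. norm (s k * ?f1 (s k) * cmod (V (s k))) \<le> C * sqrt (1 / (real k + 1))"
      proof (rule always_eventually, rule allI)
        fix k
        have "\<bar>?f1 (s k)\<bar> \<le> C" using f1[OF s(1)] C(1)[of "s k"] s(1,3)[of k] by simp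
        moreover have "s k * cmod (V (s k)) \<le> sqrt (1 / (real k + 1))" using Vs by (rule real_le_rsqrt)
        ultimately have "\<bar>?f1 (s k)\<bar> * (s k * cmod (V (s k))) \<le> C * sqrt (1 / (real k + 1))"
          using C(2) s(1)[of k] by (intro mult_mono) (auto simp: less_imp_le)
        then show "norm (s k * ?f1 (s k) * cmod (V (s k))) \<le> C * sqrt (1 / (real k + 1))"
          using s(1)[of k] by (simp add: abs_mult mult_ac)
      qed
      show "(\<lambda>k. C * sqrt (1 / (real k + 1))) \<longlonglongrightarrow> 0"
        using tendsto_mult[OF tendsto_const tendsto_real_sqrt[OF lim0(1)], of C] by simp
    qed
    have quot: "r * ?f1 r / ?f r = 2 * ?w r" if "r > 0" for r
      using that fiber_state_pos[of \<eta> b r n] \<eta> b by simp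
    have s2: "(\<lambda>k. s k * ?f1 (s k) / ?f (s k) * (cmod (V (s k)))\<^sup>2) \<longlonglongrightarrow> 0"
    proof (rule Lim_null_comparison)
      show "\<forall>\<^sub>F k in sequentially. norm (s k * ?f1 (s k) / ?f (s k) * (cmod (V (s k)))\<^sup>2)
          \<le> (8 + b) * (1 / (real k + 1))"
      proof (rule always_eventually, rule allI)
        fix k
        define z where "z = b * (s k)\<^sup>2 / 2"
        have z: "z > 0" "z \<le> 1 / 2" using b s(1)[of k] sb[of k] by (simp_all add: z_def)
        have "(s k)\<^sup>2 * (?p (s k))\<^sup>2 = (s k * ?p (s k))\<^sup>2" by (simp add: power_mult_distrib)
        also have "s k * ?p (s k) = real n - z"
          using s(1)[of k] by (simp add: z_def field_simps power2_eq_square)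
        finally have sp: "(s k)\<^sup>2 * (?p (s k))\<^sup>2 = (real n - z)\<^sup>2" .
        have "real n + z \<le> 8 * (real n - z)\<^sup>2 + z"
        proof (cases "n = 0")
          case False
          then have n: "real n \<ge> 1" by simp
          have "(real n - z) * (real n - z) \<ge> (1/2) * (real n / 2)"
            using n z by (intro mult_mono) auto
          then show ?thesis using n by (simp add: power2_eq_square)
        qed simp
        also have "\<dots> \<le> (8 + b) * ((s k)\<^sup>2 * (1 + (?p (s k))\<^sup>2))"
        proof -
          have "(8 + b) * ((s k)\<^sup>2 * (1 + (?p (s k))\<^sup>2)) = (8 + b) * ((s k)\<^sup>2 + (real n - z)\<^sup>2)"
            by (simp only: distrib_left sp mult_1_right)
          moreover have "0 \<le> b * (real n - z)\<^sup>2" "0 \<le> b * (s k)\<^sup>2" using b by simp_all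
          moreover have "2 * z = b * (s k)\<^sup>2" by (simp add: z_def)
          moreover have "(8 + b) * ((s k)\<^sup>2 + (real n - z)\<^sup>2)
              = 8 * (s k)\<^sup>2 + 8 * (real n - z)\<^sup>2 + b * (s k)\<^sup>2 + b * (real n - z)\<^sup>2"
            by (simp only: distrib_left distrib_right add_ac)
          moreover have "0 \<le> (s k)\<^sup>2" by simp
          ultimately show ?thesis using z by linarith
        qed
        finally have "\<bar>2 * ?w (s k)\<bar> \<le> (8 + b) * ((s k)\<^sup>2 * (1 + (?p (s k))\<^sup>2))"
          using fiber_slope_bound[of \<eta> z n] \<eta> z by (simp add: z_def)
        then have "\<bar>2 * ?w (s k)\<bar> * (cmod (V (s k)))\<^sup>2
            \<le> (8 + b) * ((s k)\<^sup>2 * (1 + (?p (s k))\<^sup>2)) * (cmod (V (s k)))\<^sup>2"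
          by (rule mult_right_mono) simp
        also have "\<dots> = (8 + b) * (s k * ?I (s k))" by (simp only: I mult.assoc)
        also have "\<dots> \<le> (8 + b) * (1 / (real k + 1))"
          using s(4)[of k] b by (intro mult_left_mono) auto
        finally show "norm (s k * ?f1 (s k) / ?f (s k) * (cmod (V (s k)))\<^sup>2) \<le> (8 + b) * (1 / (real k + 1))"
          unfolding quot[OF s(1)] by (simp add: abs_mult)
      qed
      show "(\<lambda>k. (8 + b) * (1 / (real k + 1))) \<longlonglongrightarrow> 0"
        using tendsto_mult[OF tendsto_const lim0(1), of "8 + b"] by simp
    qed
    define B where "B = cmod (V (2/3)) + 1 + (LINT r|lebesgue_on ?S. r * (cmod (G r))\<^sup>2) / (2/3)"
    have Vt: "cmod (V (t k)) \<le> B" for k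
    proof -
      have "cmod (V (t k) - V (2/3)) \<le> (t k - 2/3) + (LINT r|lebesgue_on ?S. r * (cmod (G r))\<^sup>2) / (2/3)"
        using t[of k] by (intro primitive_increment_bound[OF V(1) Gm V'(2)]) auto
      moreover have "cmod (V (t k)) \<le> cmod (V (2/3)) + cmod (V (t k) - V (2/3))"
        using norm_triangle_ineq[of "V (2/3)" "V (t k) - V (2/3)"] by simp
      ultimately show ?thesis using t(2)[of k] unfolding B_def by linarith
    qed
    then have B: "B \<ge> 0" using norm_ge_zero order_trans by blast
    have g11: "g1 1 = 0" using f1[of 1] zero by simp
    have wlim: "(\<lambda>k. 2 * ?w (t k)) \<longlonglongrightarrow> 0"
    proof -
      have "isCont ?w 1"
        by (intro isCont_o2[OF _ DERIV_isCont[OF fiber_slope_riccati]]) (use \<eta> b in \<open>auto intro!: continuous_intros\<close>)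
      from isCont_tendsto_compose[OF this tlim] show ?thesis
        using tendsto_mult[OF tendsto_const, of "\<lambda>k. ?w (t k)" 0 sequentially 2] zero by simp
    qed
    have t1: "(\<lambda>k. t k * ?f1 (t k) * cmod (V (t k))) \<longlonglongrightarrow> 0"
    proof (rule Lim_null_comparison)
      show "\<forall>\<^sub>F k in sequentially. norm (t k * ?f1 (t k) * cmod (V (t k))) \<le> \<bar>t k * g1 (t k)\<bar> * B"
      proof (rule always_eventually, rule allI)
        fix k
        have "t k > 0" using t(1)[of k] by simp
        from f1[OF this] show "norm (t k * ?f1 (t k) * cmod (V (t k))) \<le> \<bar>t k * g1 (t k)\<bar> * B"
          using Vt[of k] by (simp only:) (simp add: abs_mult mult_left_mono)
      qed
      have "isCont g1 1" using cg1[of UNIV] by (simp add: continuous_on_eq_continuous_at)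
      from isCont_tendsto_compose[OF this tlim] have "(\<lambda>k. g1 (t k)) \<longlonglongrightarrow> 0" by (simp add: g11)
      from tendsto_mult[OF tlim this] have "(\<lambda>k. t k * g1 (t k)) \<longlonglongrightarrow> 0" by simp
      from tendsto_mult[OF tendsto_rabs_zero[OF this] tendsto_const, of B]
      show "(\<lambda>k. \<bar>t k * g1 (t k)\<bar> * B) \<longlonglongrightarrow> 0" by simp
    qed
    have t2: "(\<lambda>k. t k * ?f1 (t k) / ?f (t k) * (cmod (V (t k)))\<^sup>2) \<longlonglongrightarrow> 0"
    proof (rule Lim_null_comparison)
      show "\<forall>\<^sub>F k in sequentially. norm (t k * ?f1 (t k) / ?f (t k) * (cmod (V (t k)))\<^sup>2)
          \<le> \<bar>2 * ?w (t k)\<bar> * B\<^sup>2"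
      proof (rule always_eventually, rule allI)
        fix k
        have "t k > 0" using t(1)[of k] by simp
        from quot[OF this] show "norm (t k * ?f1 (t k) / ?f (t k) * (cmod (V (t k)))\<^sup>2) \<le> \<bar>2 * ?w (t k)\<bar> * B\<^sup>2"
          using power_mono[OF Vt[of k], of 2] by (simp only:) (simp add: abs_mult mult_left_mono)
      qed
      from tendsto_mult[OF tendsto_rabs_zero[OF wlim] tendsto_const, of "B\<^sup>2"]
      show "(\<lambda>k. \<bar>2 * ?w (t k)\<bar> * B\<^sup>2) \<longlonglongrightarrow> 0" by simp
    qed
    show "\<exists>s t. (\<forall>k. s k \<in> ?S \<and> t k \<in> ?S \<and> s k \<le> t k) \<and>
        (\<forall>x\<in>?S. \<forall>\<^sub>F k in sequentially. s k \<le> x \<and> x \<le> t k) \<and>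
        (\<lambda>k. s k * ?f1 (s k) * cmod (V (s k))) \<longlonglongrightarrow> 0 \<and>
        (\<lambda>k. t k * ?f1 (t k) * cmod (V (t k))) \<longlonglongrightarrow> 0 \<and>
        (\<lambda>k. s k * ?f1 (s k) / ?f (s k) * (cmod (V (s k)))\<^sup>2) \<longlonglongrightarrow> 0 \<and>
        (\<lambda>k. t k * ?f1 (t k) / ?f (t k) * (cmod (V (t k)))\<^sup>2) \<longlonglongrightarrow> 0"
    proof (rule exI[of _ s], rule exI[of _ t], intro conjI s1 s2 t1 t2 allI ballI)
      show "s k \<in> ?S" "t k \<in> ?S" for k using s(1,3)[of k] t[of k] by auto
      show "s k \<le> t k" for k using sk3[of k] k3[of k] t(1)[of k] by linarith
      fix x assume x: "x \<in> ?S"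
      have "\<forall>\<^sub>F k in sequentially. 1 / (real k + 3) < x" "\<forall>\<^sub>F k in sequentially. x < t k"
        using x order_tendstoD(2)[OF lim0(2)] order_tendstoD(1)[OF tlim] by auto
      then show "\<forall>\<^sub>F k in sequentially. s k \<le> x \<and> x \<le> t k"
        by eventually_elim (use sk3 in \<open>auto intro: less_imp_le less_trans\<close>)
    qed
  qed
qed

theorem fiber_lambda_eq:
  assumes "0 < \<eta>" "\<eta> < 1" "b > 0" "fiber_slope \<eta> n (b / 2) = 0"
  shows "fiber_lambda n b = b * \<eta>"
proof -
  interpret positive_ground_state "{0<..<1}" "\<lambda>r. r" "\<lambda>r. real n / r - b / 2 * r"
    "fiber_state \<eta> n b" "\<lambda>r. 2 * fiber_slope \<eta> n (b * r\<^sup>2 / 2) / r * fiber_state \<eta> n b r" "b * \<eta>"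
    by (rule fiber_ground_state[OF assms])
  show ?thesis using neumann_lowest_eq by (simp add: fiber_lambda_def radial_measure_def M_def)
qed

text \<open>
  The slope at \<open>z\<close> changes sign between energy 0, where the potential is nonnegative, and energy 1,
  where the regular solution is \<open>z\<^bsup>n/2\<^esup> e\<^bsup>-z/2\<^esup>\<close>, decreasing beyond \<open>z = n\<close>.
\<close>

lemma fiber_neumann_energy_exists:
  assumes z: "z > real n"
  shows "\<exists>\<eta>. 0 < \<eta> \<and> \<eta> < 1 \<and> fiber_slope \<eta> n z = 0"
proof -
  have z0: "z > 0" using z by (meson le_less_trans of_nat_0_le_iff)
  have c: "real n + 1 > 0" by simp
  have "fiber_slope 1 n z = (real n - z) / 2" by (simp add: fiber_slope_def kummer'_def)
  then have one: "fiber_slope 1 n z < 0" using z by simp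
  have K: "kummer (1 / 2) (real n + 1) y > 0" if "y \<ge> 0" for y
    using kummer_ge_1[of "1/2" "real n + 1" y] that by simp
  \<comment> \<open>The comparison starts at \<open>z = n\<close>, where the slope is \<open>n M'/M \<ge> 0\<close>. For \<open>n = 0\<close> this is the singular
    point, and the coefficient is written in a form that is continuous there.\<close>
  let ?h = "\<lambda>y. if n = 0 then 1 / 2 - kummer' (1 / 2) (real n + 1) y / kummer (1 / 2) (real n + 1) y
     else - fiber_slope 0 n y / y"
  have fs: "fiber_slope 0 n = (\<lambda>y. (real n - y) / 2 + y * kummer' (1 / 2) (real n + 1) y / kummer (1 / 2) (real n + 1) y)"
    by (simp add: fiber_slope_def fun_eq_iff)
  have cK: "continuous_on A (kummer (1 / 2) (real n + 1))" "continuous_on A (kummer' (1 / 2) (real n + 1))" for A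
    using continuous_on_kummer[OF c, of A "\<lambda>x. 1/2" "\<lambda>x. x"] continuous_on_kummer'[OF c, of A "\<lambda>x. 1/2" "\<lambda>x. x"]
    by (auto intro: continuous_intros)
  have nz: "\<forall>y\<in>{real n..z}. kummer (1 / 2) (real n + 1) y \<noteq> 0"
    using K by (metis atLeastAtMost_iff less_irrefl of_nat_0_le_iff order_trans)
  have cs: "continuous_on {real n..z} (fiber_slope 0 n)"
    unfolding fs by (intro continuous_intros cK nz) auto
  have "fiber_slope 0 n z > 0"
  proof (rule strict_gronwall_pos[OF z cs, of ?h "\<lambda>y. ((y - real n)\<^sup>2 / 4 - (fiber_slope 0 n y)\<^sup>2) / y"])
    show "continuous_on {real n..z} ?h"
    proof -
      have "continuous_on {real n..z} (\<lambda>y. 1 / 2 - kummer' (1 / 2) (real n + 1) y / kummer (1 / 2) (real n + 1) y)"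
        by (intro continuous_intros cK nz)
      moreover have "continuous_on {real n..z} (\<lambda>y. - fiber_slope 0 n y / y)" if "n \<noteq> 0"
        using that by (intro continuous_intros cs) auto
      ultimately show ?thesis by (cases "n = 0") simp_all
    qed
    fix y assume y: "real n < y" "y < z"
    then have y0: "y > 0" by (meson le_less_trans of_nat_0_le_iff)
    show "(fiber_slope 0 n has_real_derivative ((y - real n)\<^sup>2 / 4 - (fiber_slope 0 n y)\<^sup>2) / y) (at y)"
      using fiber_slope_riccati[of 0 y n] y0 by simp
    have "?h y = - fiber_slope 0 n y / y"
      using y0 K[of y] fun_cong[OF fs, of y] by (cases "n = 0") (auto simp: field_simps)
    then have "?h y * fiber_slope 0 n y = - (fiber_slope 0 n y)\<^sup>2 / y" by (simp add: power2_eq_square)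
    also have "\<dots> < ((y - real n)\<^sup>2 / 4 - (fiber_slope 0 n y)\<^sup>2) / y"
      using y y0 by (intro divide_strict_right_mono) auto
    finally show "?h y * fiber_slope 0 n y < ((y - real n)\<^sup>2 / 4 - (fiber_slope 0 n y)\<^sup>2) / y" .
  next
    have "kummer' (1 / 2) (real n + 1) (real n) \<ge> 0"
      using kummer_ge_1[of "1/2 + 1" "real n + 1 + 1" "real n"] by (simp add: kummer'_def)
    then show "fiber_slope 0 n (real n) \<ge> 0" using K[of "real n"] by (simp add: fs)
  qed
  moreover have "continuous_on {0..1} (\<lambda>\<eta>. fiber_slope \<eta> n z)"
    unfolding fiber_slope_def
  proof (intro continuous_intros ballI)
    fix \<eta> :: real assume "\<eta> \<in> {0..1}"
    then show "kummer ((1 - \<eta>) / 2) (real n + 1) z \<noteq> 0"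
      using kummer_ge_1[of "(1 - \<eta>) / 2" "real n + 1" z] z0 by simp
  qed auto
  ultimately obtain \<eta> where \<eta>: "0 \<le> \<eta>" "\<eta> \<le> 1" "fiber_slope \<eta> n z = 0"
    using IVT2'[of "\<lambda>\<eta>. fiber_slope \<eta> n z" 1 0 0] one by auto
  moreover have "\<eta> \<noteq> 0" "\<eta> \<noteq> 1" using \<eta>(3) one \<open>fiber_slope 0 n z > 0\<close> by auto
  ultimately show ?thesis by (intro exI[of _ \<eta>]) auto
qed

section \<open>The Neumann solution on the half-line\<close>

text \<open>
  The even and odd solutions of \<open>u'' = (x\<^sup>2 - \<mu>) u\<close>.
\<close>

definition herm_even :: "real \<Rightarrow> real \<Rightarrow> real" where
  "herm_even \<mu> x = exp (- x\<^sup>2 / 2) * kummer ((1 - \<mu>) / 4) (1 / 2) (x\<^sup>2)"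

definition herm_even' :: "real \<Rightarrow> real \<Rightarrow> real" where
  "herm_even' \<mu> x = exp (- x\<^sup>2 / 2) * (2 * x * kummer' ((1 - \<mu>) / 4) (1 / 2) (x\<^sup>2)
     - x * kummer ((1 - \<mu>) / 4) (1 / 2) (x\<^sup>2))"

definition herm_odd :: "real \<Rightarrow> real \<Rightarrow> real" where
  "herm_odd \<mu> x = exp (- x\<^sup>2 / 2) * (x * kummer ((3 - \<mu>) / 4) (3 / 2) (x\<^sup>2))"

definition herm_odd' :: "real \<Rightarrow> real \<Rightarrow> real" where
  "herm_odd' \<mu> x = exp (- x\<^sup>2 / 2) * ((1 - x\<^sup>2) * kummer ((3 - \<mu>) / 4) (3 / 2) (x\<^sup>2)
     + 2 * x\<^sup>2 * kummer' ((3 - \<mu>) / 4) (3 / 2) (x\<^sup>2))"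

lemma kummer_square_deriv:
  assumes "c > 0"
  shows "((\<lambda>x. kummer a c (x\<^sup>2)) has_real_derivative kummer' a c (x\<^sup>2) * (2 * x)) (at x)"
    and "((\<lambda>x. kummer' a c (x\<^sup>2)) has_real_derivative a / c * kummer' (a + 1) (c + 1) (x\<^sup>2) * (2 * x)) (at x)"
proof -
  have sq: "((\<lambda>x. x\<^sup>2) has_real_derivative 2 * x) (at x)" by (auto intro!: derivative_eq_intros)
  show "((\<lambda>x. kummer a c (x\<^sup>2)) has_real_derivative kummer' a c (x\<^sup>2) * (2 * x)) (at x)"
    by (rule DERIV_chain2[OF kummer_deriv[OF assms] sq])
  show "((\<lambda>x. kummer' a c (x\<^sup>2)) has_real_derivative a / c * kummer' (a + 1) (c + 1) (x\<^sup>2) * (2 * x)) (at x)"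
    by (rule DERIV_chain2[OF kummer'_deriv[OF assms] sq])
qed

lemma gauss_deriv: "((\<lambda>x. exp (- x\<^sup>2 / 2)) has_real_derivative exp (- x\<^sup>2 / 2) * (- x)) (at x)"
  for x :: real
  by (auto intro!: derivative_eq_intros)

lemma herm_even_deriv: "(herm_even \<mu> has_real_derivative herm_even' \<mu> x) (at x)"
  unfolding herm_even_def[abs_def] herm_even'_def
  by (rule DERIV_cong[OF DERIV_mult[OF gauss_deriv kummer_square_deriv(1)]]) (simp_all add: algebra_simps)

lemma herm_odd_deriv: "(herm_odd \<mu> has_real_derivative herm_odd' \<mu> x) (at x)"
  unfolding herm_odd_def[abs_def] herm_odd'_def
  by (rule DERIV_cong[OF DERIV_mult[OF gauss_deriv DERIV_mult[OF DERIV_ident kummer_square_deriv(1)]]])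
     (simp_all add: algebra_simps power2_eq_square)

lemma herm_even'_deriv: "(herm_even' \<mu> has_real_derivative (x\<^sup>2 - \<mu>) * herm_even \<mu> x) (at x)"
proof -
  define a where "a = (1 - \<mu>) / 4"
  have mu: "\<mu> = 1 - 4 * a" by (simp add: a_def diff_divide_distrib)
  define K K1 K2 where "K = kummer a (1/2) (x\<^sup>2)" and "K1 = kummer' a (1/2) (x\<^sup>2)"
    and "K2 = a / (1/2) * kummer' (a + 1) (1/2 + 1) (x\<^sup>2)"
  have ode: "x\<^sup>2 * K2 = a * K - (1/2 - x\<^sup>2) * K1"
    unfolding K_def K1_def K2_def by (rule kummer_ode) simp
  have d2: "((\<lambda>x. 2 * x * kummer' a (1/2) (x\<^sup>2)) has_real_derivative 2 * K1 + K2 * (2 * x) * (2 * x)) (at x)"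
    unfolding K1_def K2_def
    by (rule DERIV_mult[OF _ kummer_square_deriv(2), THEN DERIV_cong]) (auto intro!: derivative_eq_intros)
  have d1: "((\<lambda>x. x * kummer a (1/2) (x\<^sup>2)) has_real_derivative K + K1 * (2 * x) * x) (at x)"
    unfolding K_def K1_def
    by (rule DERIV_mult[OF DERIV_ident kummer_square_deriv(1), THEN DERIV_cong]) auto
  have "((\<lambda>x. exp (- x\<^sup>2 / 2) * (2 * x * kummer' a (1/2) (x\<^sup>2) - x * kummer a (1/2) (x\<^sup>2))) has_real_derivative
     exp (- x\<^sup>2 / 2) * (- x) * (2 * x * K1 - x * K)
     + (2 * K1 + K2 * (2 * x) * (2 * x) - (K + K1 * (2 * x) * x)) * exp (- x\<^sup>2 / 2)) (at x)"
    using DERIV_mult[OF gauss_deriv[of x] DERIV_diff[OF d2 d1]] by (simp add: K_def K1_def)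
  moreover have "exp (- x\<^sup>2 / 2) * (- x) * (2 * x * K1 - x * K)
     + (2 * K1 + K2 * (2 * x) * (2 * x) - (K + K1 * (2 * x) * x)) * exp (- x\<^sup>2 / 2)
     = (x\<^sup>2 - \<mu>) * (exp (- x\<^sup>2 / 2) * K)"
  proof -
    have "K2 * (2 * x) * (2 * x) = 4 * (x\<^sup>2 * K2)" by (simp add: power2_eq_square)
    then show ?thesis unfolding ode by (simp add: mu algebra_simps power2_eq_square)
  qed
  ultimately show ?thesis by (simp add: herm_even'_def[abs_def] herm_even_def a_def K_def)
qed

lemma herm_odd'_deriv: "(herm_odd' \<mu> has_real_derivative (x\<^sup>2 - \<mu>) * herm_odd \<mu> x) (at x)"
proof -
  define a where "a = (3 - \<mu>) / 4"
  have mu: "\<mu> = 3 - 4 * a" by (simp add: a_def diff_divide_distrib)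
  define K K1 K2 where "K = kummer a (3/2) (x\<^sup>2)" and "K1 = kummer' a (3/2) (x\<^sup>2)"
    and "K2 = a / (3/2) * kummer' (a + 1) (3/2 + 1) (x\<^sup>2)"
  have ode: "x\<^sup>2 * K2 = a * K - (3/2 - x\<^sup>2) * K1"
    unfolding K_def K1_def K2_def by (rule kummer_ode) simp
  have d2: "((\<lambda>x. 2 * x\<^sup>2 * kummer' a (3/2) (x\<^sup>2)) has_real_derivative 4 * x * K1 + K2 * (2 * x) * (2 * x\<^sup>2)) (at x)"
    unfolding K1_def K2_def
    by (rule DERIV_mult[OF _ kummer_square_deriv(2), THEN DERIV_cong]) (auto intro!: derivative_eq_intros)
  have d1: "((\<lambda>x. (1 - x\<^sup>2) * kummer a (3/2) (x\<^sup>2)) has_real_derivative (- 2 * x) * K + K1 * (2 * x) * (1 - x\<^sup>2)) (at x)"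
    unfolding K_def K1_def
    by (rule DERIV_mult[OF _ kummer_square_deriv(1), THEN DERIV_cong]) (auto intro!: derivative_eq_intros)
  have "((\<lambda>x. exp (- x\<^sup>2 / 2) * ((1 - x\<^sup>2) * kummer a (3/2) (x\<^sup>2) + 2 * x\<^sup>2 * kummer' a (3/2) (x\<^sup>2))) has_real_derivative
     exp (- x\<^sup>2 / 2) * (- x) * ((1 - x\<^sup>2) * K + 2 * x\<^sup>2 * K1)
     + ((- 2 * x) * K + K1 * (2 * x) * (1 - x\<^sup>2) + (4 * x * K1 + K2 * (2 * x) * (2 * x\<^sup>2))) * exp (- x\<^sup>2 / 2)) (at x)"
    using DERIV_mult[OF gauss_deriv[of x] DERIV_add[OF d1 d2]] by (simp add: K_def K1_def)
  moreover have "exp (- x\<^sup>2 / 2) * (- x) * ((1 - x\<^sup>2) * K + 2 * x\<^sup>2 * K1)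
     + ((- 2 * x) * K + K1 * (2 * x) * (1 - x\<^sup>2) + (4 * x * K1 + K2 * (2 * x) * (2 * x\<^sup>2))) * exp (- x\<^sup>2 / 2)
     = (x\<^sup>2 - \<mu>) * (exp (- x\<^sup>2 / 2) * (x * K))"
  proof -
    have "K2 * (2 * x) * (2 * x\<^sup>2) = 4 * x * (x\<^sup>2 * K2)" by (simp add: power2_eq_square)
    then show ?thesis unfolding ode by (simp add: mu algebra_simps power2_eq_square)
  qed
  ultimately show ?thesis by (simp add: herm_odd'_def[abs_def] herm_odd_def a_def K_def)
qed

lemma herm_wronskian: "herm_even \<mu> x * herm_odd' \<mu> x - herm_even' \<mu> x * herm_odd \<mu> x = 1"
proof -
  have "((\<lambda>x. herm_even \<mu> x * herm_odd' \<mu> x - herm_even' \<mu> x * herm_odd \<mu> x) has_real_derivative 0) (at x)" for x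
    by (rule DERIV_cong[OF DERIV_diff[OF DERIV_mult[OF herm_even_deriv herm_odd'_deriv]
          DERIV_mult[OF herm_even'_deriv herm_odd_deriv]]]) (simp add: algebra_simps)
  then have "herm_even \<mu> x * herm_odd' \<mu> x - herm_even' \<mu> x * herm_odd \<mu> x
      = herm_even \<mu> 0 * herm_odd' \<mu> 0 - herm_even' \<mu> 0 * herm_odd \<mu> 0"
    by (intro DERIV_isconst_all[of "\<lambda>x. herm_even \<mu> x * herm_odd' \<mu> x - herm_even' \<mu> x * herm_odd \<mu> x"] allI)
  then show ?thesis by (simp add: herm_even_def herm_even'_def herm_odd_def herm_odd'_def)
qed

text \<open>
  The solution of \<open>u'' = ((t - \<xi>)\<^sup>2 - \<mu>) u\<close> with \<open>u 0 = 1\<close> and \<open>u' 0 = 0\<close>.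
\<close>

definition half_sol :: "real \<Rightarrow> real \<Rightarrow> real \<Rightarrow> real" where
  "half_sol \<xi> \<mu> t = herm_odd' \<mu> (- \<xi>) * herm_even \<mu> (t - \<xi>) - herm_even' \<mu> (- \<xi>) * herm_odd \<mu> (t - \<xi>)"

definition half_sol' :: "real \<Rightarrow> real \<Rightarrow> real \<Rightarrow> real" where
  "half_sol' \<xi> \<mu> t = herm_odd' \<mu> (- \<xi>) * herm_even' \<mu> (t - \<xi>) - herm_even' \<mu> (- \<xi>) * herm_odd' \<mu> (t - \<xi>)"

lemma half_sol_0 [simp]: "half_sol \<xi> \<mu> 0 = 1" "half_sol' \<xi> \<mu> 0 = 0"
  using herm_wronskian[of \<mu> "- \<xi>"] by (simp_all add: half_sol_def half_sol'_def mult.commute)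

lemma half_sol_deriv: "(half_sol \<xi> \<mu> has_real_derivative half_sol' \<xi> \<mu> t) (at t)"
  unfolding half_sol_def[abs_def] half_sol'_def
  by (intro DERIV_diff DERIV_cmult DERIV_chain2[where g = "\<lambda>t. t - \<xi>", OF herm_even_deriv, THEN DERIV_cong]
      DERIV_chain2[where g = "\<lambda>t. t - \<xi>", OF herm_odd_deriv, THEN DERIV_cong])
     (auto intro!: derivative_eq_intros)

lemma half_sol'_deriv: "(half_sol' \<xi> \<mu> has_real_derivative ((t - \<xi>)\<^sup>2 - \<mu>) * half_sol \<xi> \<mu> t) (at t)"
proof -
  have 1: "((\<lambda>t. herm_even' \<mu> (t - \<xi>)) has_real_derivative ((t - \<xi>)\<^sup>2 - \<mu>) * herm_even \<mu> (t - \<xi>)) (at t)"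
    by (rule DERIV_chain2[where g = "\<lambda>t. t - \<xi>", OF herm_even'_deriv, THEN DERIV_cong])
       (auto intro!: derivative_eq_intros)
  have 2: "((\<lambda>t. herm_odd' \<mu> (t - \<xi>)) has_real_derivative ((t - \<xi>)\<^sup>2 - \<mu>) * herm_odd \<mu> (t - \<xi>)) (at t)"
    by (rule DERIV_chain2[where g = "\<lambda>t. t - \<xi>", OF herm_odd'_deriv, THEN DERIV_cong])
       (auto intro!: derivative_eq_intros)
  show ?thesis unfolding half_sol'_def[abs_def] half_sol_def
    by (rule DERIV_cong[OF DERIV_diff[OF DERIV_cmult[OF 1] DERIV_cmult[OF 2]]]) (simp add: algebra_simps)
qed

lemma continuous_on_half_sol_param:
  assumes "continuous_on A f" "continuous_on A g"
  shows "continuous_on A (\<lambda>x. half_sol \<xi> (f x) (g x))" "continuous_on A (\<lambda>x. half_sol' \<xi> (f x) (g x))"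
  unfolding half_sol_def half_sol'_def herm_even_def herm_even'_def herm_odd_def herm_odd'_def
  by (intro continuous_intros assms; simp)+

lemma continuous_on_half_sol: "continuous_on A (half_sol \<xi> \<mu>)" "continuous_on A (half_sol' \<xi> \<mu>)"
  using continuous_on_half_sol_param[of A "\<lambda>_. \<mu>" "\<lambda>x. x"] by (auto intro: continuous_intros)

lemma first_zero:
  fixes f :: "real \<Rightarrow> real"
  assumes "continuous_on {a..t1} f" "f a > 0" "a \<le> t1" "f t1 \<le> 0"
  obtains t0 where "a < t0" "t0 \<le> t1" "f t0 = 0" "\<And>t. a \<le> t \<Longrightarrow> t < t0 \<Longrightarrow> f t > 0"
proof -
  let ?Z = "{a..t1} \<inter> f -` {..0}"
  have "closed ?Z" by (rule continuous_closed_preimage[OF assms(1)]) auto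
  then have cZ: "compact ?Z"
    by (simp add: compact_eq_bounded_closed bounded_Int bounded_closed_interval)
  have "?Z \<noteq> {}" using assms(3,4) by auto
  from compact_attains_inf[OF cZ this]
  obtain t0 where t0: "t0 \<in> ?Z" "\<And>t. t \<in> ?Z \<Longrightarrow> t0 \<le> t" by blast
  have pos: "f t > 0" if "a \<le> t" "t < t0" for t
    using t0(2)[of t] that t0(1) by force
  have "a < t0" using t0(1) assms(2) by (cases "t0 = a") auto
  moreover have "f t0 = 0"
  proof (rule ccontr)
    assume "f t0 \<noteq> 0"
    then have "f t0 < 0" using t0(1) by auto
    have "continuous_on {a..t0} f" using assms(1) t0(1) by (auto intro: continuous_on_subset)
    with \<open>f t0 < 0\<close> \<open>a < t0\<close> assms(2) obtain x where "a \<le> x" "x \<le> t0" "f x = 0"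
      using IVT2'[of f t0 0 a] by auto
    then show False using pos[of x] \<open>f t0 \<noteq> 0\<close> by (cases "x = t0") auto
  qed
  ultimately show thesis using that t0(1) pos by auto
qed

section \<open>The bottom of the half-line operator\<close>

definition half_sol_pos :: "real \<Rightarrow> real \<Rightarrow> bool" where
  "half_sol_pos \<xi> \<mu> \<longleftrightarrow> (\<forall>t\<ge>0. half_sol \<xi> \<mu> t > 0)"

text \<open>
  Positivity is required at all smaller energies as well, so that the set is an interval unbounded
  below; its supremum turns out to be the lowest eigenvalue.
\<close>

definition half_energies :: "real \<Rightarrow> real set" where
  "half_energies \<xi> = {\<mu>. \<forall>\<nu>\<le>\<mu>. half_sol_pos \<xi> \<nu>}"

definition half_energy :: "real \<Rightarrow> real" where
  "half_energy \<xi> = Sup (half_energies \<xi>)"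

text \<open>
  Where the potential is nonnegative, a positive solution with nonnegative slope keeps growing.
\<close>

lemma half_sol_pos_extend:
  assumes t1: "t1 \<ge> 0" and pos: "\<And>t. 0 \<le> t \<Longrightarrow> t \<le> t1 \<Longrightarrow> half_sol \<xi> \<mu> t > 0"
    and slope: "half_sol' \<xi> \<mu> t1 \<ge> 0" and V: "\<And>t. t \<ge> t1 \<Longrightarrow> \<mu> \<le> (t - \<xi>)\<^sup>2"
  shows "half_sol_pos \<xi> \<mu>"
  unfolding half_sol_pos_def
proof (intro allI impI)
  fix t :: real assume t: "t \<ge> 0"
  show "half_sol \<xi> \<mu> t > 0"
  proof (rule ccontr)
    assume neg: "\<not> half_sol \<xi> \<mu> t > 0"
    have a1: "half_sol \<xi> \<mu> t1 > 0" using pos[of t1] t1 by simp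
    have a2: "t1 \<le> t" using pos[of t] t neg by (meson linear)
    have a3: "half_sol \<xi> \<mu> t \<le> 0" using neg by simp
    obtain t0 where t0': "t1 < t0" "t0 \<le> t" and t0: "t1 < t0" "half_sol \<xi> \<mu> t0 = 0"
        "\<And>s. t1 \<le> s \<Longrightarrow> s < t0 \<Longrightarrow> half_sol \<xi> \<mu> s > 0"
      by (rule first_zero[OF continuous_on_half_sol(1) a1 a2 a3]) blast
    have slope': "half_sol' \<xi> \<mu> s \<ge> 0" if s: "t1 \<le> s" "s \<le> t0" for s
    proof -
      have "half_sol' \<xi> \<mu> t1 \<le> half_sol' \<xi> \<mu> s"
      proof (rule DERIV_nonneg_imp_nondecreasing[OF s(1)])
        fix x assume x: "t1 \<le> x" "x \<le> s"
        have "half_sol \<xi> \<mu> x \<ge> 0"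
        proof (cases "x = t0")
          case False
          then have "x < t0" using x s by simp
          then show ?thesis using t0(3)[OF x(1)] by simp
        qed (simp add: t0(2))
        then show "\<exists>y. (half_sol' \<xi> \<mu> has_real_derivative y) (at x) \<and> 0 \<le> y"
          using half_sol'_deriv[of \<xi> \<mu> x] V[OF x(1)] by (meson diff_ge_0_iff_ge mult_nonneg_nonneg)
      qed
      then show ?thesis using slope by simp
    qed
    have "half_sol \<xi> \<mu> t1 \<le> half_sol \<xi> \<mu> t0"
      by (rule DERIV_nonneg_imp_nondecreasing) (use t0(1) slope' half_sol_deriv[of \<xi> \<mu>] in \<open>auto intro: less_imp_le\<close>)
    then show False using t0(2) pos[of t1] t1 by simp
  qed
qed

lemma half_sol_pos_of_le: "(\<And>t. t \<ge> 0 \<Longrightarrow> \<mu> \<le> (t - \<xi>)\<^sup>2) \<Longrightarrow> half_sol_pos \<xi> \<mu>"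
  by (rule half_sol_pos_extend[of 0]) auto

text \<open>
  Sturm comparison with \<open>cos (\<pi> t / 2)\<close>, which has a zero at 1.
\<close>

lemma half_sol_not_pos_large:
  assumes "\<mu> \<ge> (1 + \<bar>\<xi>\<bar>)\<^sup>2 + 4" shows "\<not> half_sol_pos \<xi> \<mu>"
proof
  assume pos: "half_sol_pos \<xi> \<mu>"
  define W where "W t = half_sol \<xi> \<mu> t * (- (pi / 2) * sin (pi / 2 * t)) - half_sol' \<xi> \<mu> t * cos (pi / 2 * t)" for t
  have dW: "(W has_real_derivative half_sol \<xi> \<mu> t * cos (pi / 2 * t) * (\<mu> - (t - \<xi>)\<^sup>2 - (pi / 2)\<^sup>2)) (at t)" for t
    unfolding W_def[abs_def]
    by (rule derivative_eq_intros half_sol_deriv half_sol'_deriv refl)+ (simp add: algebra_simps power2_eq_square)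
  have "W 0 \<le> W 1"
  proof (rule DERIV_nonneg_imp_nondecreasing[of 0 1 W])
    fix t :: real assume t: "0 \<le> t" "t \<le> 1"
    have "\<bar>t - \<xi>\<bar> \<le> 1 + \<bar>\<xi>\<bar>" using t by linarith
    then have "(t - \<xi>)\<^sup>2 \<le> (1 + \<bar>\<xi>\<bar>)\<^sup>2" by (simp add: abs_le_square_iff[symmetric])
    moreover have "(pi / 2)\<^sup>2 \<le> 2\<^sup>2" using pi_less_4 pi_gt_zero by (intro power_mono) auto
    moreover have "half_sol \<xi> \<mu> t > 0" using pos t by (simp add: half_sol_pos_def)
    moreover have "cos (pi / 2 * t) \<ge> 0"
      using t pi_gt_zero by (intro cos_ge_zero) (auto simp: mult_left_le intro: order_trans[of _ 0])
    ultimately have "half_sol \<xi> \<mu> t * cos (pi / 2 * t) * (\<mu> - (t - \<xi>)\<^sup>2 - (pi / 2)\<^sup>2) \<ge> 0"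
      using assms by (intro mult_nonneg_nonneg) auto
    then show "\<exists>y. (W has_real_derivative y) (at t) \<and> 0 \<le> y" using dW by blast
  qed simp
  moreover have "W 0 = 0" by (simp add: W_def)
  moreover have "W 1 = - (half_sol \<xi> \<mu> 1 * (pi / 2))" by (simp add: W_def)
  ultimately have "half_sol \<xi> \<mu> 1 * (pi / 2) \<le> 0" by simp
  moreover have "half_sol \<xi> \<mu> 1 * (pi / 2) > 0" using pos by (simp add: half_sol_pos_def)
  ultimately show False by simp
qed

lemma half_energies_nonempty: "0 \<in> half_energies \<xi>"
  unfolding half_energies_def
  by (auto intro!: half_sol_pos_of_le intro: order_trans[OF _ zero_le_power2])

lemma half_energies_bdd: "bdd_above (half_energies \<xi>)"
proof (rule bdd_aboveI)
  fix \<mu> assume \<mu>: "\<mu> \<in> half_energies \<xi>"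
  show "\<mu> \<le> (1 + \<bar>\<xi>\<bar>)\<^sup>2 + 4"
  proof (rule ccontr)
    assume "\<not> \<mu> \<le> (1 + \<bar>\<xi>\<bar>)\<^sup>2 + 4"
    then have "\<not> half_sol_pos \<xi> \<mu>" by (intro half_sol_not_pos_large) simp
    then show False using \<mu> by (simp add: half_energies_def)
  qed
qed

lemma half_energy_nonneg: "half_energy \<xi> \<ge> 0"
  unfolding half_energy_def by (rule cSup_upper[OF half_energies_nonempty half_energies_bdd])

lemma half_sol_pos_below:
  assumes "\<mu> < half_energy \<xi>" shows "half_sol_pos \<xi> \<mu>"
proof -
  obtain \<nu> where "\<nu> \<in> half_energies \<xi>" "\<mu> < \<nu>"
    using less_cSupD[OF _ assms[unfolded half_energy_def]] half_energies_nonempty by blast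
  then show ?thesis by (auto simp: half_energies_def)
qed

lemma half_sol_zero_above:
  assumes "half_energy \<xi> < \<mu>"
  obtains \<nu> S where "\<nu> \<le> \<mu>" "\<nu> \<ge> half_energy \<xi>" "S > 0" "half_sol \<xi> \<nu> S = 0"
    "\<And>t. 0 \<le> t \<Longrightarrow> t < S \<Longrightarrow> half_sol \<xi> \<nu> t > 0"
proof -
  have "\<mu> \<notin> half_energies \<xi>"
    using cSup_upper[OF _ half_energies_bdd, of \<mu> \<xi>] assms by (auto simp: half_energy_def)
  then obtain \<nu> where \<nu>: "\<nu> \<le> \<mu>" "\<not> half_sol_pos \<xi> \<nu>" by (auto simp: half_energies_def)
  then obtain t where t: "t \<ge> 0" "half_sol \<xi> \<nu> t \<le> 0" by (auto simp: half_sol_pos_def not_less)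
  have 1: "half_sol \<xi> \<nu> 0 > 0" by simp
  have ge: "\<nu> \<ge> half_energy \<xi>" using half_sol_pos_below[of \<nu> \<xi>] \<nu>(2) by (meson not_le)
  show thesis
    by (rule first_zero[OF continuous_on_half_sol(1) 1 t]) (rule that[OF \<nu>(1) ge])
qed

text \<open>
  By continuity in the energy the solution is nonnegative, so a zero would be a double one. The
  Wronskian with a positive solution of smaller energy excludes this.
\<close>

lemma half_ground_state_pos: "half_sol_pos \<xi> (half_energy \<xi>)"
proof -
  let ?e = "half_energy \<xi>"
  have ge: "half_sol \<xi> ?e t \<ge> 0" if t: "t \<ge> 0" for t
  proof -
    have c: "isCont (\<lambda>\<mu>. half_sol \<xi> \<mu> t) ?e"
      using continuous_on_half_sol_param(1)[of UNIV "\<lambda>\<mu>. \<mu>" "\<lambda>_. t" \<xi>]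
      by (simp add: continuous_on_eq_continuous_at continuous_intros)
    have "(\<lambda>k. ?e - 1 / real (Suc k)) \<longlonglongrightarrow> ?e - 0"
      by (intro tendsto_intros) (use LIMSEQ_inverse_real_of_nat in \<open>simp add: inverse_eq_divide\<close>)
    from isCont_tendsto_compose[OF c this[simplified]]
    have "(\<lambda>k. half_sol \<xi> (?e - 1 / real (Suc k)) t) \<longlonglongrightarrow> half_sol \<xi> ?e t" by simp
    then show ?thesis
      by (rule LIMSEQ_le_const)
        (use half_sol_pos_below[of _ \<xi>] t in \<open>auto simp: half_sol_pos_def less_imp_le\<close>)
  qed
  show ?thesis
  proof (rule ccontr)
    assume "\<not> half_sol_pos \<xi> ?e"
    then obtain t where t: "t \<ge> 0" "half_sol \<xi> ?e t \<le> 0" by (auto simp: half_sol_pos_def not_less)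
    have 1: "half_sol \<xi> ?e 0 > 0" by simp
    obtain S where S: "0 < S" "half_sol \<xi> ?e S = 0" "\<And>t. 0 \<le> t \<Longrightarrow> t < S \<Longrightarrow> half_sol \<xi> ?e t > 0"
      by (rule first_zero[OF continuous_on_half_sol(1) 1 t]) blast
    have S': "half_sol' \<xi> ?e S = 0"
    proof (rule DERIV_local_min[OF half_sol_deriv S(1)], intro allI impI)
      fix y assume "\<bar>S - y\<bar> < S"
      then have "y \<ge> 0" by linarith
      then show "half_sol \<xi> ?e S \<le> half_sol \<xi> ?e y" using ge S(2) by simp
    qed
    let ?l = "?e - 1"
    have lpos: "half_sol \<xi> ?l t > 0" if "t \<ge> 0" for t
      using half_sol_pos_below[of ?l \<xi>] that by (simp add: half_sol_pos_def)
    define W where "W t = half_sol \<xi> ?l t * half_sol' \<xi> ?e t - half_sol' \<xi> ?l t * half_sol \<xi> ?e t" for t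
    have dW: "(W has_real_derivative - (half_sol \<xi> ?l t * half_sol \<xi> ?e t)) (at t)" for t
      unfolding W_def[abs_def]
      by (rule derivative_eq_intros half_sol_deriv half_sol'_deriv refl)+ (simp add: algebra_simps)
    have "W S < W 0"
    proof (rule DERIV_neg_imp_decreasing_open[OF S(1)])
      show "continuous_on {0..S} W" using dW by (meson DERIV_isCont continuous_at_imp_continuous_on)
      fix t assume "0 < t" "t < S"
      then show "\<exists>y. (W has_real_derivative y) (at t) \<and> y < 0"
        using dW[of t] lpos[of t] S(3)[of t] by (intro exI conjI) auto
    qed
    then show False using S(2) S' by (simp add: W_def)
  qed
qed

text \<open>
  A positive slope in the region of positive potential would persist under a small increase of the
  energy and keep the solution positive, contradicting the choice of the energy as a supremum.
\<close>

lemma half_ground_state_slope: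
  assumes t1: "t1 \<ge> 0" "t1 > \<xi>" "(t1 - \<xi>)\<^sup>2 > half_energy \<xi>"
  shows "half_sol' \<xi> (half_energy \<xi>) t1 \<le> 0"
proof (rule ccontr)
  let ?e = "half_energy \<xi>"
  assume "\<not> half_sol' \<xi> ?e t1 \<le> 0"
  then have slope: "half_sol' \<xi> ?e t1 > 0" by simp
  define d0 where "d0 = min 1 (((t1 - \<xi>)\<^sup>2 - ?e) / 2)"
  have d0: "d0 > 0" "?e + d0 < (t1 - \<xi>)\<^sup>2" using t1(3) by (auto simp: d0_def min_def field_simps)
  let ?K = "{?e..?e + d0} \<times> {0..t1}"
  have "continuous_on ?K (\<lambda>x. half_sol \<xi> (fst x) (snd x))" "continuous_on ?K (\<lambda>x. half_sol' \<xi> (fst x) (snd x))"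
    by (intro continuous_on_half_sol_param continuous_intros)+
  then have uc: "uniformly_continuous_on ?K (\<lambda>x. half_sol \<xi> (fst x) (snd x))"
      "uniformly_continuous_on ?K (\<lambda>x. half_sol' \<xi> (fst x) (snd x))"
    by (auto intro!: compact_uniformly_continuous compact_Times)
  obtain tm where tm: "tm \<in> {0..t1}" "\<And>t. t \<in> {0..t1} \<Longrightarrow> half_sol \<xi> ?e tm \<le> half_sol \<xi> ?e t"
    using continuous_attains_inf[OF compact_Icc _ continuous_on_half_sol(1), of 0 t1 \<xi> ?e] t1(1) by auto
  have m: "half_sol \<xi> ?e tm > 0" using half_ground_state_pos tm(1) by (simp add: half_sol_pos_def)
  obtain d1 where d1: "d1 > 0" "\<And>x y. x \<in> ?K \<Longrightarrow> y \<in> ?K \<Longrightarrow> dist y x < d1 \<Longrightarrow>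
      dist (half_sol \<xi> (fst y) (snd y)) (half_sol \<xi> (fst x) (snd x)) < half_sol \<xi> ?e tm"
    using uc(1)[unfolded uniformly_continuous_on_def, rule_format, OF m] by blast
  obtain d2 where d2: "d2 > 0" "\<And>x y. x \<in> ?K \<Longrightarrow> y \<in> ?K \<Longrightarrow> dist y x < d2 \<Longrightarrow>
      dist (half_sol' \<xi> (fst y) (snd y)) (half_sol' \<xi> (fst x) (snd x)) < half_sol' \<xi> ?e t1"
    using uc(2)[unfolded uniformly_continuous_on_def, rule_format, OF slope] by blast
  define d where "d = min d0 (min d1 d2) / 2"
  have d: "d > 0" "d < d0" "d < d1" "d < d2" using d0 d1(1) d2(1) by (auto simp: d_def min_def)
  have "?e + d \<in> half_energies \<xi>"
    unfolding half_energies_def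
  proof (intro CollectI allI impI)
    fix \<nu> assume \<nu>: "\<nu> \<le> ?e + d"
    show "half_sol_pos \<xi> \<nu>"
    proof (cases "\<nu> < ?e")
      case True
      then show ?thesis by (rule half_sol_pos_below)
    next
      case False
      show ?thesis
      proof (rule half_sol_pos_extend[OF t1(1)])
        fix t assume t: "0 \<le> t" "t \<le> t1"
        have "dist (half_sol \<xi> \<nu> t) (half_sol \<xi> ?e t) < half_sol \<xi> ?e tm"
          using d1(2)[of "(?e, t)" "(\<nu>, t)"] \<nu> False d t by (auto simp: dist_Pair_Pair dist_real_def)
        then show "half_sol \<xi> \<nu> t > 0" using tm(2)[of t] t by (auto simp: dist_real_def abs_if split: if_splits)
      next
        have "dist (half_sol' \<xi> \<nu> t1) (half_sol' \<xi> ?e t1) < half_sol' \<xi> ?e t1"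
          using d2(2)[of "(?e, t1)" "(\<nu>, t1)"] \<nu> False d t1(1) by (auto simp: dist_Pair_Pair dist_real_def)
        then show "half_sol' \<xi> \<nu> t1 \<ge> 0" by (auto simp: dist_real_def abs_if split: if_splits)
      next
        fix t assume "t1 \<le> t"
        then have "(t1 - \<xi>)\<^sup>2 \<le> (t - \<xi>)\<^sup>2" using t1(2) by (intro power_mono) auto
        then show "\<nu> \<le> (t - \<xi>)\<^sup>2" using d0(2) d \<nu> by linarith
      qed
    qed
  qed
  then have "?e + d \<le> ?e" unfolding half_energy_def by (rule cSup_upper[OF _ half_energies_bdd])
  then show False using d(1) by simp
qed

text \<open>
  If \<open>k = u' + m u\<close> were positive at \<open>t1\<close>, then \<open>k' \<ge> m k\<close> would make it grow exponentially, while
  \<open>k \<le> m u\<close> and \<open>u\<close> is decreasing.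
\<close>

lemma half_ground_state_decay:
  assumes t1: "t1 \<ge> 0" "t1 > \<xi>" and m: "m > 0" "m\<^sup>2 + half_energy \<xi> \<le> (t1 - \<xi>)\<^sup>2"
  shows "half_sol' \<xi> (half_energy \<xi>) t1 \<le> - m * half_sol \<xi> (half_energy \<xi>) t1"
proof (rule ccontr)
  let ?e = "half_energy \<xi>"
  let ?c = "half_sol \<xi> ?e" and ?c' = "half_sol' \<xi> ?e"
  assume "\<not> ?c' t1 \<le> - m * ?c t1"
  then have k1: "?c' t1 + m * ?c t1 > 0" by simp
  have pos: "?c t > 0" if "t \<ge> t1" for t
    using half_ground_state_pos that t1(1) by (simp add: half_sol_pos_def)
  have V: "m\<^sup>2 + ?e \<le> (t - \<xi>)\<^sup>2" if "t \<ge> t1" for t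
  proof -
    have "(t1 - \<xi>)\<^sup>2 \<le> (t - \<xi>)\<^sup>2" using t1(2) that by (intro power_mono) auto
    then show ?thesis using m(2) by simp
  qed
  have slope: "?c' t \<le> 0" if "t \<ge> t1" for t
    by (rule half_ground_state_slope)
       (use t1 that V[OF that] m(1) zero_less_power[of m 2] in linarith)+
  define k where "k t = (?c' t + m * ?c t) * exp (- m * t)" for t
  have dk: "(k has_real_derivative ((t - \<xi>)\<^sup>2 - ?e - m\<^sup>2) * ?c t * exp (- m * t)) (at t)" for t
    unfolding k_def[abs_def]
    by (rule derivative_eq_intros half_sol_deriv half_sol'_deriv refl)+ (simp add: algebra_simps power2_eq_square)
  have mono: "k t1 \<le> k t" if t: "t \<ge> t1" for t
  proof (rule DERIV_nonneg_imp_nondecreasing[OF t])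
    fix x assume "t1 \<le> x" "x \<le> t"
    then have "((x - \<xi>)\<^sup>2 - ?e - m\<^sup>2) * ?c x * exp (- m * x) \<ge> 0"
      using V[of x] pos[of x] by (intro mult_nonneg_nonneg) auto
    then show "\<exists>y. (k has_real_derivative y) (at x) \<and> 0 \<le> y" using dk by blast
  qed
  have k1pos: "k t1 > 0" using k1 by (simp add: k_def)
  have cm: "?c t \<le> ?c t1" if t: "t \<ge> t1" for t
    by (rule DERIV_nonpos_imp_nonincreasing[OF t]) (use half_sol_deriv slope in blast)
  have bound: "k t1 * exp (m * t) \<le> m * ?c t1" if t: "t \<ge> t1" for t
  proof -
    have "k t1 * exp (m * t) \<le> k t * exp (m * t)" using mono[OF t] by (intro mult_right_mono) auto
    also have "\<dots> = ?c' t + m * ?c t" by (simp add: k_def mult.assoc exp_add[symmetric])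
    also have "\<dots> \<le> m * ?c t1" using slope[OF t] mult_left_mono[OF cm[OF t], of m] m(1) by linarith
    finally show ?thesis .
  qed
  have "k t1 * (m * t) < m * ?c t1" if t: "t \<ge> t1" for t
  proof -
    have "m * t < exp (m * t)" using exp_ge_add_one_self[of "m * t"] by linarith
    then have "k t1 * (m * t) < k t1 * exp (m * t)"
      using k1pos by (rule mult_strict_left_mono)
    then show ?thesis using bound[OF t] by simp
  qed
  from this[of "max t1 (?c t1 / k t1)"] have "k t1 * max t1 (?c t1 / k t1) < ?c t1"
    using m(1) by (simp add: mult.left_commute)
  moreover have "k t1 * (?c t1 / k t1) \<le> k t1 * max t1 (?c t1 / k t1)"
    using k1pos by (intro mult_left_mono) auto
  ultimately show False using k1pos by simp
qed

text \<open>
  Beyond exponential decay, the Picone boundary terms require an upper bound on \<open>|u'| / u\<close>. The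
  function \<open>u'\<^sup>2 - ((t - \<xi>)\<^sup>2 - \<mu> + 2) u\<^sup>2\<close> is eventually nondecreasing; were it ever positive,
  \<open>u'\<close> would stay away from zero and \<open>u\<close> would change sign.
\<close>

lemma half_ground_state_asymptotics:
  obtains T where "T \<ge> 0" "T > \<xi>"
    "\<And>t. t \<ge> T \<Longrightarrow> half_sol' \<xi> (half_energy \<xi>) t \<le> - half_sol \<xi> (half_energy \<xi>) t"
    "\<And>t. t \<ge> T \<Longrightarrow> (half_sol' \<xi> (half_energy \<xi>) t)\<^sup>2 \<le> ((t - \<xi>)\<^sup>2 + 2) * (half_sol \<xi> (half_energy \<xi>) t)\<^sup>2"
proof -
  let ?e = "half_energy \<xi>"
  let ?c = "half_sol \<xi> ?e" and ?c' = "half_sol' \<xi> ?e"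
  have e: "?e \<ge> 0" by (rule half_energy_nonneg)
  \<comment> \<open>Beyond \<open>T\<close> the decay lemma applies with \<open>m = (t - \<xi>) / 2\<close>.\<close>
  define T where "T = \<bar>\<xi>\<bar> + \<xi> + 2 + 2 * ?e"
  have T: "T \<ge> 0" "T > \<xi>" using e by (auto simp: T_def)
  have far: "t - \<xi> \<ge> 2 + 2 * ?e" if "t \<ge> T" for t using that by (simp add: T_def)
  have q: "((t - \<xi>) / 2)\<^sup>2 + ?e \<le> (t - \<xi>)\<^sup>2" if t: "t \<ge> T" for t
  proof -
    have "(2 + 2 * ?e) * (2 + 2 * ?e) \<le> (t - \<xi>) * (t - \<xi>)"
      using far[OF t] e by (intro mult_mono) auto
    moreover have "(2 + 2 * ?e) * (2 + 2 * ?e) = 4 + 8 * ?e + 4 * ?e * ?e" by (simp add: algebra_simps)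
    moreover have "?e * ?e \<ge> 0" using e by simp
    ultimately have "(t - \<xi>) * (t - \<xi>) \<ge> 8 * ?e" by linarith
    moreover have "(t - \<xi>) * (t - \<xi>) \<ge> 0" by simp
    ultimately have "?e + (t - \<xi>) * (t - \<xi>) / 4 \<le> (t - \<xi>) * (t - \<xi>)" using e by linarith
    then show ?thesis by (simp add: power2_eq_square)
  qed
  have pos: "?c t > 0" if "t \<ge> T" for t
    using half_ground_state_pos that T(1) by (simp add: half_sol_pos_def)
  have decay: "?c' t \<le> - ((t - \<xi>) / 2) * ?c t" if t: "t \<ge> T" for t
    using T t far[OF t] e q[OF t] by (intro half_ground_state_decay) auto
  have decay1: "?c' t \<le> - ?c t" if t: "t \<ge> T" for t
  proof -
    have "((t - \<xi>) / 2) * ?c t \<ge> 1 * ?c t"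
      using far[OF t] e pos[OF t] by (intro mult_right_mono) auto
    then show ?thesis using decay[OF t] by simp
  qed
  define \<Phi> where "\<Phi> t = (?c' t)\<^sup>2 - ((t - \<xi>)\<^sup>2 - ?e + 2) * (?c t)\<^sup>2" for t
  have d\<Phi>: "(\<Phi> has_real_derivative ?c t * (- 4 * ?c' t - 2 * (t - \<xi>) * ?c t)) (at t)" for t
    unfolding \<Phi>_def[abs_def]
    by (rule derivative_eq_intros half_sol_deriv half_sol'_deriv refl)+ (simp add: algebra_simps power2_eq_square)
  have mono: "\<Phi> s \<le> \<Phi> t" if "T \<le> s" "s \<le> t" for s t
  proof (rule DERIV_nonneg_imp_nondecreasing[OF that(2)])
    fix x assume "s \<le> x" "x \<le> t"
    then have x: "x \<ge> T" using that by simp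
    have "?c x * (- 4 * ?c' x - 2 * (x - \<xi>) * ?c x) \<ge> 0"
      using decay[OF x] pos[OF x] by (intro mult_nonneg_nonneg) (auto simp: field_simps)
    then show "\<exists>y. (\<Phi> has_real_derivative y) (at x) \<and> 0 \<le> y" using d\<Phi> by blast
  qed
  have \<Phi>: "\<Phi> s \<le> 0" if s: "s \<ge> T" for s
  proof (rule ccontr)
    assume "\<not> \<Phi> s \<le> 0"
    then have \<kappa>: "\<Phi> s > 0" by simp
    define r where "r = sqrt (\<Phi> s)"
    have r: "r > 0" using \<kappa> by (simp add: r_def)
    have slope: "?c' t \<le> - r" if t: "t \<ge> s" for t
    proof -
      have tT: "t \<ge> T" using t s by simp
      have "((t - \<xi>)\<^sup>2 - ?e + 2) * (?c t)\<^sup>2 \<ge> 0"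
        using q[OF tT] zero_le_power2[of "(t - \<xi>) / 2"] by (intro mult_nonneg_nonneg) (linarith, simp)
      then have "\<Phi> s \<le> (?c' t)\<^sup>2" using mono[OF s t] by (simp add: \<Phi>_def)
      then have "r \<le> \<bar>?c' t\<bar>" using real_sqrt_le_mono by (fastforce simp: r_def)
      moreover have "?c' t \<le> 0" using decay1[OF tT] pos[OF tT] by simp
      ultimately show ?thesis by simp
    qed
    have "?c (s + ?c s / r) \<le> - r * (s + ?c s / r) - (- r * s) + ?c s"
    proof -
      have "(\<lambda>t. ?c t - - r * t) (s + ?c s / r) \<le> (\<lambda>t. ?c t - - r * t) s"
      proof (rule DERIV_nonpos_imp_nonincreasing[of s "s + ?c s / r" "\<lambda>t. ?c t - - r * t"])
        show "s \<le> s + ?c s / r" using pos[OF s] r by simp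
        fix x assume "s \<le> x" "x \<le> s + ?c s / r"
        moreover have "((\<lambda>t. ?c t - - r * t) has_real_derivative ?c' x - - r) (at x)"
          by (rule derivative_eq_intros half_sol_deriv refl)+ simp
        ultimately show "\<exists>y. ((\<lambda>t. ?c t - - r * t) has_real_derivative y) (at x) \<and> y \<le> 0"
          using slope[of x] by (intro exI conjI) auto
      qed
      then show ?thesis by simp
    qed
    also have "\<dots> = 0" using r by (simp add: field_simps)
    finally have "?c (s + ?c s / r) \<le> 0" .
    moreover have "?c s / r > 0" using pos[OF s] r by simp
    ultimately show False using pos[of "s + ?c s / r"] s by linarith
  qed
  show thesis
  proof (rule that[OF T decay1])
    fix t assume t: "t \<ge> T"
    have "(?c' t)\<^sup>2 \<le> ((t - \<xi>)\<^sup>2 - ?e + 2) * (?c t)\<^sup>2" using \<Phi>[OF t] by (simp add: \<Phi>_def)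
    also have "\<dots> \<le> ((t - \<xi>)\<^sup>2 + 2) * (?c t)\<^sup>2" using e by (intro mult_right_mono) auto
    finally show "(?c' t)\<^sup>2 \<le> ((t - \<xi>)\<^sup>2 + 2) * (?c t)\<^sup>2" .
  qed
qed

section \<open>De Gennes' function\<close>

lemma small_near_infinity:
  fixes I :: "real \<Rightarrow> real"
  assumes I: "integrable (lebesgue_on {0<..}) I" and nn: "\<And>r. 0 < r \<Longrightarrow> I r \<ge> 0"
    and "\<epsilon> > 0"
  shows "\<exists>t. 0 < t \<and> t > T \<and> I t < \<epsilon>"
proof (rule ccontr)
  assume *: "\<not> ?thesis"
  define d where "d = max T 0 + 1"
  have d: "0 < d" "d > T" by (auto simp: d_def)
  have ge: "I s \<ge> \<epsilon>" if "s \<ge> d" for s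
    using * that d by (meson less_le_trans not_le)
  have aS: "I absolutely_integrable_on {0<..}"
    using I by (simp add: set_integrable_def integrable_restrict_space)
  then have iS: "I integrable_on {0<..}" using set_lebesgue_integral_eq_integral(1) by blast
  define J where "J = integral {0<..} I"
  have bound: "\<epsilon> * (b - d) \<le> J" if b: "b \<ge> d" for b
  proof -
    have "I absolutely_integrable_on {d..b}"
      by (rule set_integrable_subset[OF aS]) (use d in auto)
    then have ia: "I integrable_on {d..b}" using set_lebesgue_integral_eq_integral(1) by blast
    have "integral {d..b} (\<lambda>_. \<epsilon>) \<le> integral {d..b} I"
      using ge by (intro integral_le ia) auto
    then have "\<epsilon> * (b - d) \<le> integral {d..b} I" using b by (simp add: mult.commute)
    also have "\<dots> \<le> J" unfolding J_def
      using d ia iS nn by (intro integral_subset_le) auto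
    finally show ?thesis .
  qed
  have "J \<ge> 0" using bound[of d] by simp
  then have "\<epsilon> * ((J + 1) / \<epsilon>) \<le> J" using bound[of "d + (J + 1) / \<epsilon>"] assms(3) by simp
  then show False using assms(3) by simp
qed

lemma integrable_exp_bound:
  fixes h :: "real \<Rightarrow> real"
  assumes h: "continuous_on {0..} h" and T: "T \<ge> 0" and b: "\<And>t. t \<ge> T \<Longrightarrow> \<bar>h t\<bar> \<le> D * exp (- t)"
  shows "integrable (lebesgue_on {0<..}) h"
proof -
  have "bounded (h ` {0..T})"
    by (intro compact_imp_bounded compact_continuous_image continuous_on_subset[OF h]) auto
  then obtain B where B: "\<forall>x\<in>h ` {0..T}. norm x \<le> B" unfolding bounded_iff by blast
  define E where "E = \<bar>D\<bar> + \<bar>B\<bar> * exp T"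
  have bound: "norm (h t) \<le> E * exp (- t)" if t: "t \<in> {0<..}" for t
  proof (cases "t \<le> T")
    case True
    then have "norm (h t) \<le> B" using B t by auto
    also have "\<dots> \<le> \<bar>B\<bar> * 1" by simp
    also have "\<dots> \<le> \<bar>B\<bar> * (exp T * exp (- t))"
      using True by (intro mult_left_mono) (auto simp: exp_add[symmetric])
    also have "\<dots> \<le> E * exp (- t)" by (simp add: E_def distrib_right)
    finally show ?thesis .
  next
    case False
    then have "norm (h t) \<le> D * exp (- t)" using b[of t] by simp
    also have "\<dots> \<le> E * exp (- t)"
      by (intro mult_right_mono) (auto simp: E_def intro!: add_increasing2)
    finally show ?thesis .
  qed
  have "(\<lambda>t. E * exp (- t)) integrable_on {0..}"
    using integrable_on_exp_minus_to_infinity[of 1 0] by (intro integrable_on_mult_right) simp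
  then have "(\<lambda>t. E * exp (- t)) absolutely_integrable_on {0..}"
    by (rule nonnegative_absolutely_integrable_1) (simp add: E_def)
  then have "(\<lambda>t. E * exp (- t)) absolutely_integrable_on {0<..}"
    by (rule set_integrable_subset) auto
  then have i: "(\<lambda>t. E * exp (- t)) integrable_on {0<..}"
    using set_lebesgue_integral_eq_integral(1) by blast
  have "h absolutely_integrable_on {0<..}"
    by (rule measurable_bounded_by_integrable_imp_absolutely_integrable[OF _ _ i bound])
       (auto intro!: continuous_imp_measurable_on_sets_lebesgue continuous_on_subset[OF h])
  then show ?thesis by (simp add: set_integrable_def integrable_restrict_space)
qed

text \<open>
  At 0 the boundary terms vanish by the Neumann condition. At infinity the asymptotics bound them by
  the energy density or a multiple of its square root, which is small along a sequence.
\<close>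

lemma half_ground_state:
  "positive_ground_state {0<..} (\<lambda>_. 1) (\<lambda>t. t - \<xi>) (half_sol \<xi> (half_energy \<xi>))
     (half_sol' \<xi> (half_energy \<xi>)) (half_energy \<xi>)"
proof -
  let ?S = "{0::real<..}"
  let ?e = "half_energy \<xi>"
  let ?c = "half_sol \<xi> ?e" and ?c' = "half_sol' \<xi> ?e"
  interpret weighted_interval ?S "\<lambda>_. 1" "\<lambda>t. t - \<xi>"
    by standard (auto intro!: continuous_intros simp: is_interval_1)
  have pos: "?c t > 0" if "t \<ge> 0" for t
    using half_ground_state_pos that by (simp add: half_sol_pos_def)
  obtain T where T: "T \<ge> 0" "T > \<xi>" and decay: "\<And>t. t \<ge> T \<Longrightarrow> ?c' t \<le> - ?c t"
    and quot: "\<And>t. t \<ge> T \<Longrightarrow> (?c' t)\<^sup>2 \<le> ((t - \<xi>)\<^sup>2 + 2) * (?c t)\<^sup>2"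
    by (rule half_ground_state_asymptotics[of \<xi>]) blast
  define C where "C = ?c T * exp T"
  have C: "C > 0" using pos[OF T(1)] by (simp add: C_def)
  have cexp: "?c t \<le> C * exp (- t)" if t: "t \<ge> T" for t
  proof -
    have "?c t * exp t \<le> ?c T * exp T"
    proof (rule DERIV_nonpos_imp_nonincreasing[OF t, of "\<lambda>t. ?c t * exp t"])
      fix x assume "T \<le> x" "x \<le> t"
      moreover have "((\<lambda>t. ?c t * exp t) has_real_derivative (?c' x + ?c x) * exp x) (at x)"
        by (rule derivative_eq_intros half_sol_deriv refl)+ (simp add: algebra_simps)
      ultimately show "\<exists>y. ((\<lambda>t. ?c t * exp t) has_real_derivative y) (at x) \<and> y \<le> 0"
        using decay[of x] mult_nonpos_nonneg[of "?c' x + ?c x" "exp x"] by (intro exI conjI) auto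
    qed
    then have "?c t * exp t * exp (- t) \<le> C * exp (- t)" by (simp add: C_def)
    then show ?thesis by (simp add: mult.assoc exp_add[symmetric])
  qed
  define D where "D = (6 + 2 * \<xi>\<^sup>2) * C\<^sup>2"
  have energy: "((t - \<xi>)\<^sup>2 + 2) * (?c t)\<^sup>2 \<le> D * exp (- t)" if t: "t \<ge> T" for t
  proof -
    have t0: "t \<ge> 0" using t T by simp
    have "(t - \<xi>)\<^sup>2 + 2 \<le> 2 * t\<^sup>2 + 2 * \<xi>\<^sup>2 + 2"
      using zero_le_power2[of "t + \<xi>"] by (simp add: power2_eq_square algebra_simps)
    also have "t\<^sup>2 \<le> 2 * exp t" using exp_lower_Taylor_quadratic[OF t0] t0 by simp
    also have "2 * (2 * exp t) + 2 * \<xi>\<^sup>2 + 2 \<le> (6 + 2 * \<xi>\<^sup>2) * exp t"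
    proof -
      have "(2 * \<xi>\<^sup>2 + 2) * 1 \<le> (2 * \<xi>\<^sup>2 + 2) * exp t" using t0 by (intro mult_left_mono) auto
      then show ?thesis by (simp add: algebra_simps)
    qed
    finally have 1: "(t - \<xi>)\<^sup>2 + 2 \<le> (6 + 2 * \<xi>\<^sup>2) * exp t" by simp
    have 2: "(?c t)\<^sup>2 \<le> (C * exp (- t))\<^sup>2" using cexp[OF t] pos[OF t0] by (intro power_mono) auto
    have "((t - \<xi>)\<^sup>2 + 2) * (?c t)\<^sup>2 \<le> ((6 + 2 * \<xi>\<^sup>2) * exp t) * (C * exp (- t))\<^sup>2"
      using 1 2 by (intro mult_mono) auto
    also have "\<dots> = D * (exp t * (exp (- t) * exp (- t)))"
      by (simp add: D_def power2_eq_square mult_ac)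
    also have "exp t * (exp (- t) * exp (- t)) = exp (- t)" by (simp add: exp_minus)
    finally show ?thesis .
  qed
  have cc: "continuous_on A ?c" "continuous_on A ?c'" for A by (rule continuous_on_half_sol)+
  have ic: "integrable (lebesgue_on ?S) (\<lambda>r. (?c r)\<^sup>2)"
  proof (rule integrable_exp_bound[OF _ T(1)])
    fix t assume t: "T \<le> t"
    have "(?c t)\<^sup>2 \<le> ((t - \<xi>)\<^sup>2 + 2) * (?c t)\<^sup>2"
      using mult_right_mono[of 1 "(t - \<xi>)\<^sup>2 + 2" "(?c t)\<^sup>2"] by simp
    then show "\<bar>(?c t)\<^sup>2\<bar> \<le> D * exp (- t)" using energy[OF t] by simp
  qed (intro continuous_intros cc)
  have ic': "integrable (lebesgue_on ?S) (\<lambda>r. (?c' r)\<^sup>2)"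
  proof (rule integrable_exp_bound[OF _ T(1)])
    fix t assume t: "T \<le> t"
    show "\<bar>(?c' t)\<^sup>2\<bar> \<le> D * exp (- t)" using energy[OF t] quot[OF t] by simp
  qed (intro continuous_intros cc)
  have icp: "integrable (lebesgue_on ?S) (\<lambda>r. ((r - \<xi>) * ?c r)\<^sup>2)"
  proof (rule integrable_exp_bound[OF _ T(1)])
    fix t assume t: "T \<le> t"
    have "((t - \<xi>) * ?c t)\<^sup>2 \<le> ((t - \<xi>)\<^sup>2 + 2) * (?c t)\<^sup>2"
      by (simp add: power_mult_distrib distrib_right)
    then show "\<bar>((t - \<xi>) * ?c t)\<^sup>2\<bar> \<le> D * exp (- t)" using energy[OF t] by simp
  qed (intro continuous_intros cc)
  show ?thesis
  proof
    fix r assume r: "r \<in> ?S"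
    show "?c r > 0" using pos r by simp
    show "(?c has_real_derivative ?c' r) (at r)" by (rule half_sol_deriv)
    show "((\<lambda>r. 1 * ?c' r) has_real_derivative ((r - \<xi>)\<^sup>2 - ?e) * (1 * ?c r)) (at r)"
      using half_sol'_deriv[of \<xi> ?e r] by simp
  next
    fix V G :: "real \<Rightarrow> complex"
    assume V: "primitive_on ?S V G" "continuous_on ?S V" "G \<in> borel_measurable (lebesgue_on ?S)"
      "integrable (lebesgue_on ?S) (\<lambda>r. 1 * (cmod (V r))\<^sup>2)"
      "integrable (lebesgue_on ?S) (\<lambda>r. 1 * (cmod (G r))\<^sup>2)"
      "integrable (lebesgue_on ?S) (\<lambda>r. 1 * (cmod (of_real (r - \<xi>) * V r))\<^sup>2)"
    let ?I = "\<lambda>r. (cmod (V r))\<^sup>2 + (cmod (of_real (r - \<xi>) * V r))\<^sup>2"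
    have I: "?I r = (1 + (r - \<xi>)\<^sup>2) * (cmod (V r))\<^sup>2" for r
      unfolding norm_mult power_mult_distrib norm_of_real power2_abs by (simp add: distrib_right)
    have "\<exists>t. \<forall>k. 0 < t k \<and> t k > max T (real k + 2) \<and> ?I (t k) < 1 / (real k + 1)"
      by (rule choice, rule allI, rule small_near_infinity) (use V(4,6) in auto)
    then obtain t where t: "\<And>k. 0 < t k" "\<And>k. t k > max T (real k + 2)"
      "\<And>k. ?I (t k) < 1 / (real k + 1)" by blast
    have tT: "t k \<ge> T" "t k > real k + 2" for k using t(2)[of k] by auto
    define s where "s k = 1 / (real k + 2)" for k
    have s: "0 < s k" "s k \<le> 1 / 2" for k by (auto simp: s_def divide_simps)
    have lim0: "(\<lambda>k. 1 / (real k + 1)) \<longlonglongrightarrow> 0" "s \<longlonglongrightarrow> 0"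
      using LIMSEQ_inverse_real_of_nat LIMSEQ_ignore_initial_segment[OF LIMSEQ_inverse_real_of_nat, of 1]
      by (simp_all add: inverse_eq_divide add_ac s_def[abs_def])
    define B where "B = cmod (V 1) + 1 + (LINT r|lebesgue_on ?S. 1 * (cmod (G r))\<^sup>2) / 1"
    have Vs: "cmod (V (s k)) \<le> B" for k
    proof -
      have "cmod (V 1 - V (s k)) \<le> (1 - s k) + (LINT r|lebesgue_on ?S. 1 * (cmod (G r))\<^sup>2) / 1"
        using s[of k] by (intro primitive_increment_bound[OF V(1,3,5)]) auto
      moreover have "cmod (V (s k)) \<le> cmod (V 1) + cmod (V 1 - V (s k))"
        using norm_triangle_ineq4[of "V 1" "V 1 - V (s k)"] by simp
      ultimately show ?thesis using s(1)[of k] unfolding B_def by linarith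
    qed
    have c'lim: "(\<lambda>k. ?c' (s k)) \<longlonglongrightarrow> 0"
      using isCont_tendsto_compose[OF DERIV_isCont[OF half_sol'_deriv[of \<xi> ?e 0]] lim0(2)] by simp
    have clim: "(\<lambda>k. ?c (s k)) \<longlonglongrightarrow> 1"
      using isCont_tendsto_compose[OF DERIV_isCont[OF half_sol_deriv[of \<xi> ?e 0]] lim0(2)] by simp
    have s1: "(\<lambda>k. 1 * ?c' (s k) * cmod (V (s k))) \<longlonglongrightarrow> 0"
    proof (rule Lim_null_comparison)
      show "\<forall>\<^sub>F k in sequentially. norm (1 * ?c' (s k) * cmod (V (s k))) \<le> \<bar>?c' (s k)\<bar> * B"
        by (rule always_eventually) (auto simp: abs_mult intro!: mult_left_mono Vs)
      show "(\<lambda>k. \<bar>?c' (s k)\<bar> * B) \<longlonglongrightarrow> 0"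
        using tendsto_mult[OF tendsto_rabs_zero[OF c'lim] tendsto_const, of B] by simp
    qed
    have s2: "(\<lambda>k. 1 * ?c' (s k) / ?c (s k) * (cmod (V (s k)))\<^sup>2) \<longlonglongrightarrow> 0"
    proof (rule Lim_null_comparison)
      show "\<forall>\<^sub>F k in sequentially. norm (1 * ?c' (s k) / ?c (s k) * (cmod (V (s k)))\<^sup>2) \<le> \<bar>?c' (s k) / ?c (s k)\<bar> * B\<^sup>2"
        by (rule always_eventually) (auto simp: abs_mult abs_divide intro!: mult_left_mono divide_right_mono power_mono Vs)
      have "(\<lambda>k. ?c' (s k) / ?c (s k)) \<longlonglongrightarrow> 0 / 1" by (intro tendsto_divide c'lim clim) simp
      then have "(\<lambda>k. ?c' (s k) / ?c (s k)) \<longlonglongrightarrow> 0" by simp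
      from tendsto_mult[OF tendsto_rabs_zero[OF this] tendsto_const, of "B\<^sup>2"]
      show "(\<lambda>k. \<bar>?c' (s k) / ?c (s k)\<bar> * B\<^sup>2) \<longlonglongrightarrow> 0" by simp
    qed
    have Vt: "(1 + (t k - \<xi>)\<^sup>2) * (cmod (V (t k)))\<^sup>2 \<le> 1 / (real k + 1)" for k
      using t(3)[of k] unfolding I by simp
    have t1: "(\<lambda>k. 1 * ?c' (t k) * cmod (V (t k))) \<longlonglongrightarrow> 0"
    proof (rule Lim_null_comparison)
      show "\<forall>\<^sub>F k in sequentially. norm (1 * ?c' (t k) * cmod (V (t k))) \<le> sqrt (D * (1 / (real k + 1)))"
      proof (rule always_eventually, rule allI, rule real_le_rsqrt)
        fix k
        have D: "D \<ge> 0" by (simp add: D_def)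
        have "(?c' (t k))\<^sup>2 \<le> D * exp (- t k)" using quot[OF tT(1)] energy[OF tT(1)] by (rule order_trans)
        also have "\<dots> \<le> D * 1" using D t(1)[of k] by (intro mult_left_mono) auto
        finally have 1: "(?c' (t k))\<^sup>2 \<le> D" by simp
        have "1 * (cmod (V (t k)))\<^sup>2 \<le> (1 + (t k - \<xi>)\<^sup>2) * (cmod (V (t k)))\<^sup>2" by (rule mult_right_mono) auto
        then have 2: "(cmod (V (t k)))\<^sup>2 \<le> 1 / (real k + 1)" using Vt[of k] by simp
        have "(?c' (t k))\<^sup>2 * (cmod (V (t k)))\<^sup>2 \<le> D * (1 / (real k + 1))"
          using 1 2 D by (intro mult_mono) auto
        then show "(norm (1 * ?c' (t k) * cmod (V (t k))))\<^sup>2 \<le> D * (1 / (real k + 1))"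
          by (simp add: power_mult_distrib)
      qed
      show "(\<lambda>k. sqrt (D * (1 / (real k + 1)))) \<longlonglongrightarrow> 0"
        using tendsto_real_sqrt[OF tendsto_mult[OF tendsto_const lim0(1), of D]] by simp
    qed
    have t2: "(\<lambda>k. 1 * ?c' (t k) / ?c (t k) * (cmod (V (t k)))\<^sup>2) \<longlonglongrightarrow> 0"
    proof (rule Lim_null_comparison)
      show "\<forall>\<^sub>F k in sequentially. norm (1 * ?c' (t k) / ?c (t k) * (cmod (V (t k)))\<^sup>2) \<le> 3 * (1 / (real k + 1))"
      proof (rule always_eventually, rule allI)
        fix k
        have cp: "?c (t k) > 0" using pos t(1)[of k] by simp
        have "\<bar>?c' (t k) / ?c (t k)\<bar>\<^sup>2 \<le> (t k - \<xi>)\<^sup>2 + 2"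
          using quot[OF tT(1), of k] cp by (simp add: power_divide pos_divide_le_eq)
        also have "\<dots> \<le> (2 + (t k - \<xi>)\<^sup>2)\<^sup>2"
        proof -
          have "1 * (2 + (t k - \<xi>)\<^sup>2) \<le> (2 + (t k - \<xi>)\<^sup>2) * (2 + (t k - \<xi>)\<^sup>2)"
            by (rule mult_right_mono) (auto intro: add_increasing2)
          then show ?thesis
            by (simp only: power2_eq_square[of "2 + (t k - \<xi>)\<^sup>2"] mult_1 add.commute[of "(t k - \<xi>)\<^sup>2"])
        qed
        finally have "\<bar>?c' (t k) / ?c (t k)\<bar> \<le> 2 + (t k - \<xi>)\<^sup>2"
          by (rule power2_le_imp_le) simp
        also have "\<dots> \<le> 3 * (1 + (t k - \<xi>)\<^sup>2)" by (simp add: distrib_left)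
        finally have "\<bar>?c' (t k) / ?c (t k)\<bar> * (cmod (V (t k)))\<^sup>2 \<le> 3 * (1 + (t k - \<xi>)\<^sup>2) * (cmod (V (t k)))\<^sup>2"
          by (rule mult_right_mono) simp
        also have "\<dots> \<le> 3 * (1 / (real k + 1))" unfolding mult.assoc using Vt[of k] by (intro mult_left_mono) auto
        finally show "norm (1 * ?c' (t k) / ?c (t k) * (cmod (V (t k)))\<^sup>2) \<le> 3 * (1 / (real k + 1))"
          by (simp add: abs_mult)
      qed
      show "(\<lambda>k. 3 * (1 / (real k + 1))) \<longlonglongrightarrow> 0"
        using tendsto_mult[OF tendsto_const lim0(1), of 3] by simp
    qed
    show "\<exists>s t. (\<forall>k. s k \<in> ?S \<and> t k \<in> ?S \<and> s k \<le> t k) \<and>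
        (\<forall>x\<in>?S. \<forall>\<^sub>F k in sequentially. s k \<le> x \<and> x \<le> t k) \<and>
        (\<lambda>k. 1 * ?c' (s k) * cmod (V (s k))) \<longlonglongrightarrow> 0 \<and>
        (\<lambda>k. 1 * ?c' (t k) * cmod (V (t k))) \<longlonglongrightarrow> 0 \<and>
        (\<lambda>k. 1 * ?c' (s k) / ?c (s k) * (cmod (V (s k)))\<^sup>2) \<longlonglongrightarrow> 0 \<and>
        (\<lambda>k. 1 * ?c' (t k) / ?c (t k) * (cmod (V (t k)))\<^sup>2) \<longlonglongrightarrow> 0"
    proof (rule exI[of _ s], rule exI[of _ t], intro conjI s1 s2 t1 t2 allI ballI)
      show "s k \<in> ?S" "t k \<in> ?S" for k using s(1)[of k] t(1)[of k] by auto
      show "s k \<le> t k" for k using s(2)[of k] tT(2)[of k] by linarith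
      fix x assume x: "x \<in> ?S"
      have "\<forall>\<^sub>F k in sequentially. s k < x" using x order_tendstoD(2)[OF lim0(2)] by auto
      moreover have "\<forall>\<^sub>F k in sequentially. x \<le> real k"
        by (rule eventually_sequentiallyI[of "nat \<lceil>x\<rceil>"]) linarith
      ultimately show "\<forall>\<^sub>F k in sequentially. s k \<le> x \<and> x \<le> t k"
      proof eventually_elim
        case (elim k)
        then show ?case using tT(2)[of k] by linarith
      qed
    qed
  qed (use ic ic' icp in \<open>auto intro: cc\<close>)
qed

theorem de_Gennes_mu_eq: "de_Gennes_mu \<xi> = half_energy \<xi>"
proof -
  interpret positive_ground_state "{0<..}" "\<lambda>_. 1" "\<lambda>t. t - \<xi>" "half_sol \<xi> (half_energy \<xi>)"
     "half_sol' \<xi> (half_energy \<xi>)" "half_energy \<xi>"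
    by (rule half_ground_state)
  have "M = lebesgue_on {0<..}" by (simp add: M_def density_1)
  then show ?thesis using neumann_lowest_eq by (simp add: de_Gennes_mu_def)
qed

text \<open>
  Above the lowest eigenvalue the Neumann solution acquires a zero. For \<open>\<xi> \<le> 0\<close> the potential is at
  least \<open>\<xi>\<^sup>2\<close> on the half-line, so the energy then exceeds \<open>\<xi>\<^sup>2\<close>.
\<close>

lemma half_sol_zero_above_Theta0:
  assumes "Theta0 < \<eta>"
  obtains \<xi> \<nu> S where "\<nu> < \<eta>" "\<nu> \<ge> 0" "\<xi> \<le> 0 \<Longrightarrow> \<xi>\<^sup>2 < \<nu>" "S > 0" "half_sol \<xi> \<nu> S = 0"
    "\<And>t. 0 \<le> t \<Longrightarrow> t < S \<Longrightarrow> half_sol \<xi> \<nu> t > 0"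
proof -
  obtain \<xi> where \<xi>: "de_Gennes_mu \<xi> < \<eta>"
    using cInf_lessD[of "range de_Gennes_mu" \<eta>] assms by (auto simp: Theta0_def)
  \<comment> \<open>The midpoint gives a strict inequality between the energy of the zero and \<open>\<eta>\<close>.\<close>
  define \<mu> where "\<mu> = (half_energy \<xi> + \<eta>) / 2"
  have \<mu>: "half_energy \<xi> < \<mu>" "\<mu> < \<eta>" using \<xi> by (auto simp: \<mu>_def de_Gennes_mu_eq)
  obtain \<nu> S where \<nu>: "\<nu> \<le> \<mu>" "\<nu> \<ge> half_energy \<xi>" and S: "S > 0" "half_sol \<xi> \<nu> S = 0"
    "\<And>t. 0 \<le> t \<Longrightarrow> t < S \<Longrightarrow> half_sol \<xi> \<nu> t > 0"
    by (rule half_sol_zero_above[OF \<mu>(1)]) blast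
  have "\<xi>\<^sup>2 < \<nu>" if "\<xi> \<le> 0"
  proof (rule ccontr)
    assume n: "\<not> \<xi>\<^sup>2 < \<nu>"
    have "half_sol_pos \<xi> \<nu>"
    proof (rule half_sol_pos_of_le)
      fix t :: real assume "t \<ge> 0"
      then have "(- \<xi>)\<^sup>2 \<le> (t - \<xi>)\<^sup>2" using that by (intro power_mono) auto
      then show "\<nu> \<le> (t - \<xi>)\<^sup>2" using n by simp
    qed
    then have "half_sol \<xi> \<nu> S > 0" using S(1) by (simp add: half_sol_pos_def)
    then show False using S(2) by simp
  qed
  moreover have "\<nu> < \<eta>" "\<nu> \<ge> 0" using \<nu> \<mu> half_energy_nonneg[of \<xi>] by auto
  ultimately show thesis using that S by blast
qed

section \<open>The crossing points\<close>

text \<open>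
  The root above \<open>n + 1\<close> of \<open>(z - n) (z - n - 1) = 2 \<eta> z\<close>.
\<close>

definition res_point :: "real \<Rightarrow> nat \<Rightarrow> real" where
  "res_point \<eta> n = real n + (1 / 2 + \<eta> + sqrt ((1 / 2 + \<eta>)\<^sup>2 + 2 * \<eta> * real n))"

lemma res_point_root:
  assumes "\<eta> > 0"
  shows "(res_point \<eta> n - real n) * (res_point \<eta> n - real n - 1) = 2 * \<eta> * res_point \<eta> n"
    and "res_point \<eta> n > real n + 1"
proof -
  define q where "q = sqrt ((1 / 2 + \<eta>)\<^sup>2 + 2 * \<eta> * real n)"
  have nn: "2 * \<eta> * real n \<ge> 0" using assms by simp
  have qq: "q * q = (1 / 2 + \<eta>)\<^sup>2 + 2 * \<eta> * real n"
    using nn by (simp add: q_def power2_eq_square[symmetric])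
  show "(res_point \<eta> n - real n) * (res_point \<eta> n - real n - 1) = 2 * \<eta> * res_point \<eta> n"
    unfolding res_point_def q_def[symmetric] using qq by (simp add: algebra_simps power2_eq_square, simp add: field_simps)
  have "sqrt ((1 / 2 + \<eta>)\<^sup>2) \<le> q" unfolding q_def using nn by (intro real_sqrt_le_mono) simp
  then have "1 / 2 + \<eta> \<le> q" using assms by simp
  then show "res_point \<eta> n > real n + 1" unfolding res_point_def q_def[symmetric] using assms by simp
qed

lemma res_point_unique:
  assumes "\<eta> > 0" "(z - real n) * (z - real n - 1) = 2 * \<eta> * z" "z > real n"
  shows "z = res_point \<eta> n"
proof -
  define d e where "d = z - real n" and "e = res_point \<eta> n - real n"
  have eq: "d * (d - 1) = 2 * \<eta> * (real n + d)" "e * (e - 1) = 2 * \<eta> * (real n + e)"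
    using assms(2) res_point_root(1)[OF assms(1), of n] by (simp_all add: d_def e_def)
  have e: "e > 1" using res_point_root(2)[OF assms(1), of n] by (simp add: e_def)
  have d: "d > 0" using assms(3) by (simp add: d_def)
  have "e * (e - 1 - 2 * \<eta>) = 2 * \<eta> * real n" using eq(2) by (simp add: algebra_simps)
  moreover have "2 * \<eta> * real n \<ge> 0" using assms(1) by simp
  ultimately have "e * (e - 1 - 2 * \<eta>) \<ge> 0" by simp
  then have "e - 1 - 2 * \<eta> \<ge> 0" using e by (simp add: zero_le_mult_iff)
  moreover have "(d - e) * (d + (e - 1 - 2 * \<eta>)) = 0" using eq by (simp add: algebra_simps)
  ultimately have "d = e" using d by simp
  then show ?thesis by (simp add: d_def e_def)
qed

lemma double_res_point:
  "2 * res_point \<eta> n = (2 * real n + 1) + 2 * \<eta> + sqrt (4 * \<eta> * (2 * real n + 1) + 4 * \<eta>\<^sup>2 + 1)"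
proof -
  have "4 * \<eta> * (2 * real n + 1) + 4 * \<eta>\<^sup>2 + 1 = 2\<^sup>2 * ((1 / 2 + \<eta>)\<^sup>2 + 2 * \<eta> * real n)"
    by (simp add: algebra_simps power2_eq_square)
  then have "sqrt (4 * \<eta> * (2 * real n + 1) + 4 * \<eta>\<^sup>2 + 1) = 2 * sqrt ((1 / 2 + \<eta>)\<^sup>2 + 2 * \<eta> * real n)"
    by (simp only: real_sqrt_mult real_sqrt_abs abs_numeral)
  then show ?thesis by (simp add: res_point_def)
qed

lemma res_point_strict_mono:
  assumes "0 < \<eta>" "\<eta> < \<eta>'" shows "res_point \<eta> n < res_point \<eta>' n"
proof -
  have "(1 / 2 + \<eta>)\<^sup>2 < (1 / 2 + \<eta>')\<^sup>2" using assms by (intro power_strict_mono) auto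
  moreover have "2 * \<eta> * real n \<le> 2 * \<eta>' * real n" using assms by (intro mult_right_mono) auto
  ultimately have "sqrt ((1 / 2 + \<eta>)\<^sup>2 + 2 * \<eta> * real n) < sqrt ((1 / 2 + \<eta>')\<^sup>2 + 2 * \<eta>' * real n)"
    by (intro real_sqrt_less_mono) linarith
  then show ?thesis unfolding res_point_def using assms by linarith
qed

lemma slope_at_res_point_Suc:
  assumes \<eta>: "0 < \<eta>" "\<eta> < 1" and start: "fiber_slope \<eta> n (res_point \<eta> n) \<ge> 0"
  shows "fiber_slope \<eta> (Suc n) (res_point \<eta> n) \<ge> 0"
    and "fiber_slope \<eta> (Suc n) (res_point \<eta> (Suc n)) > 0"
proof -
  let ?z = "res_point \<eta> n" and ?z' = "res_point \<eta> (Suc n)"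
  note r = res_point_root[OF \<eta>(1), of n] and r' = res_point_root[OF \<eta>(1), of "Suc n"]
  have "?z > 0" using r(2) by linarith
  then obtain q where "q > 0" "fiber_slope \<eta> (Suc n) ?z = q * fiber_slope \<eta> n ?z"
    using fiber_slope_ladder[OF _ _ _ r(1)] \<eta> by auto
  then show 1: "fiber_slope \<eta> (Suc n) ?z \<ge> 0" using start by simp
  show "fiber_slope \<eta> (Suc n) ?z' > 0"
    by (rule fiber_slope_propagation(2)[OF \<eta>, of "Suc n" ?z])
       (use r r' 1 in \<open>auto simp: algebra_simps\<close>)
qed

lemma slope_at_res_point_later:
  assumes \<eta>: "0 < \<eta>" "\<eta> < 1" and start: "fiber_slope \<eta> n (res_point \<eta> n) \<ge> 0"
  shows "fiber_slope \<eta> (n + k) (res_point \<eta> (n + k)) \<ge> 0"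
  by (induction k) (use start slope_at_res_point_Suc(2)[OF \<eta>] in \<open>auto intro: less_imp_le\<close>)

text \<open>
  At the crossing point the two Neumann energies agree, so both slopes vanish there and the quadratic
  equation holds.
\<close>

lemma crossing_energy:
  assumes cs: "crossing_sequence \<beta>"
  obtains \<eta> where "0 < \<eta>" "\<eta> < 1" "\<beta> n = 2 * res_point \<eta> n" "fiber_lambda n (\<beta> n) = \<beta> n * \<eta>"
    "fiber_slope \<eta> n (res_point \<eta> n) = 0"
proof -
  let ?z = "\<beta> n / 2"
  have b: "\<beta> n > 2 * (real n + 1)" using cs by (simp add: crossing_sequence_def)
  then have z: "?z > real n" "?z > real (Suc n)" "\<beta> n > 0" by auto
  obtain \<eta> where \<eta>: "0 < \<eta>" "\<eta> < 1" "fiber_slope \<eta> n ?z = 0"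
    using fiber_neumann_energy_exists[OF z(1)] by blast
  obtain \<eta>' where \<eta>': "0 < \<eta>'" "\<eta>' < 1" "fiber_slope \<eta>' (Suc n) ?z = 0"
    using fiber_neumann_energy_exists[OF z(2)] by blast
  have l: "fiber_lambda n (\<beta> n) = \<beta> n * \<eta>" "fiber_lambda (Suc n) (\<beta> n) = \<beta> n * \<eta>'"
    using fiber_lambda_eq \<eta> \<eta>' z(3) by auto
  have "\<beta> n \<in> {b. b > 0 \<and> fiber_lambda n b = fiber_lambda (n + 1) b}"
    using cs unfolding crossing_sequence_def by blast
  then have "\<eta> = \<eta>'" using l z(3) by simp
  then have "(?z - real n) * (?z - real n - 1) = 2 * \<eta> * ?z"
    using \<eta> \<eta>' z by (intro fiber_slope_common_zero) auto
  then have "?z = res_point \<eta> n" using \<eta>(1) z(1) by (intro res_point_unique) auto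
  then show thesis using that[of \<eta>] \<eta> l by simp
qed

lemma crossing_energy_unique:
  assumes cs: "crossing_sequence \<beta>" and \<eta>: "0 < \<eta>" "\<eta> < 1"
    and zero: "fiber_slope \<eta> n (res_point \<eta> n) = 0"
  shows "\<beta> n = 2 * res_point \<eta> n"
proof -
  let ?z = "res_point \<eta> n"
  note r = res_point_root[OF \<eta>(1), of n]
  have z: "?z > 0" using r(2) by linarith
  obtain q where "fiber_slope \<eta> (Suc n) ?z = q * fiber_slope \<eta> n ?z"
    using fiber_slope_ladder[OF _ _ z r(1)] \<eta> by auto
  then have "fiber_slope \<eta> (Suc n) ?z = 0" using zero by simp
  then have "fiber_lambda n (2 * ?z) = fiber_lambda (n + 1) (2 * ?z)"
    using fiber_lambda_eq[OF \<eta>, of "2 * ?z"] zero z by simp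
  then have "2 * ?z \<in> {b. b > 0 \<and> fiber_lambda n b = fiber_lambda (n + 1) b}" using z by simp
  then have "2 * ?z \<in> {\<beta> n}" using cs unfolding crossing_sequence_def by blast
  then show ?thesis by simp
qed

text \<open>
  As a function of the energy, the slope at \<open>res_point\<close> is positive at \<open>\<eta>\<close> and negative at 1. Its
  zero in between is a crossing, and there is only one.
\<close>

lemma crossing_energy_increasing:
  assumes cs: "crossing_sequence \<beta>" and \<eta>: "0 < \<eta>" "\<eta> < 1"
    and pos: "fiber_slope \<eta> n (res_point \<eta> n) > 0"
    and \<eta>': "0 < \<eta>'" "\<eta>' < 1" "\<beta> n = 2 * res_point \<eta>' n"
  shows "\<eta> < \<eta>'"
proof -
  have one: "fiber_slope 1 n (res_point 1 n) < 0"
    using res_point_root(2)[of 1 n] by (simp add: fiber_slope_def kummer'_def)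
  have cr: "continuous_on {\<eta>..1} (\<lambda>x. res_point x n)"
    unfolding res_point_def by (intro continuous_intros)
  have "continuous_on {\<eta>..1} (\<lambda>x. fiber_slope x n (res_point x n))"
    unfolding fiber_slope_def
  proof (intro continuous_intros cr ballI)
    fix x assume x: "x \<in> {\<eta>..1}"
    then have "res_point x n \<ge> 0" using res_point_root(2)[of x n] \<eta> by auto
    then show "kummer ((1 - x) / 2) (real n + 1) (res_point x n) \<noteq> 0"
      using kummer_ge_1[of "(1 - x) / 2" "real n + 1" "res_point x n"] x by auto
  qed auto
  then obtain x where x: "\<eta> \<le> x" "x \<le> 1" "fiber_slope x n (res_point x n) = 0"
    using IVT2'[of "\<lambda>x. fiber_slope x n (res_point x n)" 1 0 \<eta>] one pos \<eta> by auto
  have "x \<noteq> \<eta>" "x \<noteq> 1" using x(3) one pos by auto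
  then have "0 < x" "x < 1" "\<eta> < x" using x \<eta> by auto
  have "res_point x n = res_point \<eta>' n"
    using crossing_energy_unique[OF cs \<open>0 < x\<close> \<open>x < 1\<close> x(3)] \<eta>'(3) by simp
  then have "x = \<eta>'"
    using res_point_strict_mono[of x \<eta>' n] res_point_strict_mono[of \<eta>' x n] \<open>0 < x\<close> \<eta>'(1)
    by (cases x \<eta>' rule: linorder_cases) auto
  then show ?thesis using \<open>\<eta> < x\<close> by simp
qed

text \<open>
  Potential and logarithmic derivative in the variable \<open>s\<close> given by \<open>z = Z e\<^bsup>-s/\<kappa>\<^esup>\<close>, \<open>\<kappa> = sqrt (Z / 2)\<close>. It
  measures the distance from the boundary on the magnetic length scale, and being logarithmic in
  \<open>z\<close> it leaves no first order term in the equation.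
\<close>

definition rescaled_potential :: "real \<Rightarrow> nat \<Rightarrow> real \<Rightarrow> real \<Rightarrow> real" where
  "rescaled_potential \<eta> N Z s =
     ((Z * exp (- (s / sqrt (Z / 2))) - real N)\<^sup>2 - 2 * \<eta> * (Z * exp (- (s / sqrt (Z / 2))))) / (2 * Z)"

definition rescaled_slope :: "real \<Rightarrow> nat \<Rightarrow> real \<Rightarrow> real \<Rightarrow> real" where
  "rescaled_slope \<eta> N Z s = - fiber_slope \<eta> N (Z * exp (- (s / sqrt (Z / 2)))) / sqrt (Z / 2)"

lemma rescaled_slope_riccati:
  assumes "\<eta> \<le> 1" "Z > 0"
  shows "(rescaled_slope \<eta> N Z has_real_derivative
     rescaled_potential \<eta> N Z s - (rescaled_slope \<eta> N Z s)\<^sup>2) (at s)"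
proof -
  define k where "k = sqrt (Z / 2)"
  have k: "k > 0" "k * k = Z / 2" using assms(2) by (simp_all add: k_def)
  define z where "z = Z * exp (- (s / k))"
  have z: "z > 0" using assms(2) by (simp add: z_def)
  define w where "w = fiber_slope \<eta> N z"
  define P where "P = (z - real N)\<^sup>2 - 2 * \<eta> * z"
  have dz: "((\<lambda>s. Z * exp (- (s / k))) has_real_derivative - z / k) (at s)"
    unfolding z_def using k(1) by (auto intro!: derivative_eq_intros)
  have "((\<lambda>s. fiber_slope \<eta> N (Z * exp (- (s / k)))) has_real_derivative (P / 4 - w\<^sup>2) / z * (- z / k)) (at s)"
    unfolding P_def w_def
    by (rule DERIV_chain2[OF _ dz]) (use fiber_slope_riccati[OF assms(1) z, of N] in \<open>simp add: z_def\<close>)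
  then have "((\<lambda>s. fiber_slope \<eta> N (Z * exp (- (s / k))) * (- 1 / k)) has_real_derivative
      (P / 4 - w\<^sup>2) / z * (- z / k) * (- 1 / k)) (at s)"
    by (rule DERIV_cmult_right)
  moreover have "(P / 4 - w\<^sup>2) / z * (- z / k) * (- 1 / k) = P / (2 * Z) - (- w / k)\<^sup>2"
  proof -
    have "(P / 4 - w\<^sup>2) / z * (- z / k) * (- 1 / k) = (P / 4 - w\<^sup>2) / (k * k)"
      using z k(1) by (simp add: field_simps)
    also have "\<dots> = P / (4 * (k * k)) - w\<^sup>2 / (k * k)" by (simp add: diff_divide_distrib)
    also have "4 * (k * k) = 2 * Z" using k(2) by simp
    finally show ?thesis by (simp add: power_divide power2_eq_square)
  qed
  ultimately show ?thesis
    by (simp add: rescaled_slope_def[abs_def] rescaled_potential_def k_def[symmetric] z_def w_def P_def)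
qed

text \<open>
  The potential equals \<open>(\<delta> - \<kappa> (1 - e\<^bsup>-s/\<kappa>\<^esup>))\<^sup>2 - \<eta> e\<^bsup>-s/\<kappa>\<^esup>\<close> with
  \<open>\<delta> = (Z - n - 1) / (2 \<kappa>)\<close>, and the quadratic equation for \<open>Z\<close> reads \<open>\<delta>\<^sup>2 + \<delta> / (2 \<kappa>) = \<eta>\<close>.
\<close>

lemma rescaled_potential_limit:
  assumes \<eta>: "0 < \<eta>" and S: "S > 0" and \<epsilon>: "\<epsilon> > 0"
  shows "\<forall>\<^sub>F n in sequentially. \<forall>s\<in>{0..S}.
    \<bar>rescaled_potential \<eta> (Suc n) (res_point \<eta> n) s - ((s - sqrt \<eta>)\<^sup>2 - \<eta>)\<bar> < \<epsilon>"
proof -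
  define \<mu> where "\<mu> = sqrt \<eta>"
  have \<mu>: "\<mu> > 0" "\<mu>\<^sup>2 = \<eta>" using \<eta> by (simp_all add: \<mu>_def)
  define Z k \<delta> where "Z n = res_point \<eta> n" and "k n = sqrt (Z n / 2)"
    and "\<delta> n = (Z n - real (Suc n)) / (2 * k n)" for n
  have Zn: "Z n > real n + 1" for n using res_point_root(2)[OF \<eta>] by (simp add: Z_def)
  have Zp: "Z n > 0" for n using Zn[of n] by linarith
  have k: "k n > 0" "k n * k n = Z n / 2" for n using Zp[of n] by (simp_all add: k_def)
  have \<delta>0: "\<delta> n > 0" for n using Zn[of n] k(1)[of n] by (simp add: \<delta>_def)
  have \<delta>eq: "(\<delta> n)\<^sup>2 + \<delta> n / (2 * k n) = \<eta>" for n
  proof -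
    have "(\<delta> n)\<^sup>2 + \<delta> n / (2 * k n) = (Z n - real (Suc n)) * (Z n - real (Suc n) + 1) / (4 * (k n * k n))"
      using k(1)[of n] by (simp add: \<delta>_def field_simps power2_eq_square)
    also have "(Z n - real (Suc n)) * (Z n - real (Suc n) + 1) = 2 * \<eta> * Z n"
      using res_point_root(1)[OF \<eta>, of n] by (simp add: Z_def algebra_simps)
    finally show ?thesis using k(2)[of n] Zp[of n] by simp
  qed
  have ktop: "filterlim k at_top sequentially"
    unfolding k_def
  proof (rule filterlim_compose[OF sqrt_at_top], rule filterlim_at_top_mono)
    show "filterlim (\<lambda>n. (1 / 2) * real n) at_top sequentially"
      by (rule filterlim_tendsto_pos_mult_at_top[OF tendsto_const _ filterlim_real_sequentially]) simp
    show "\<forall>\<^sub>F n in sequentially. (1 / 2) * real n \<le> Z n / 2"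
    proof (rule always_eventually, rule allI)
      show "(1 / 2) * real n \<le> Z n / 2" for n using Zn[of n] by simp
    qed
  qed
  have kinv: "(\<lambda>n. c / k n) \<longlonglongrightarrow> 0" for c
    by (rule tendsto_divide_0[OF tendsto_const filterlim_at_top_imp_at_infinity[OF ktop]])
  have \<delta>le: "\<delta> n \<le> \<mu>" for n
  proof -
    have "\<delta> n / (2 * k n) > 0" using \<delta>0[of n] k(1)[of n] by simp
    then have "(\<delta> n)\<^sup>2 \<le> \<mu>\<^sup>2" using \<delta>eq[of n] \<mu>(2) by linarith
    then show ?thesis by (rule power2_le_imp_le) (use \<mu>(1) in simp)
  qed
  have "(\<lambda>n. \<delta> n / (2 * k n)) \<longlonglongrightarrow> 0"
  proof (rule Lim_null_comparison)
    show "\<forall>\<^sub>F n in sequentially. norm (\<delta> n / (2 * k n)) \<le> (\<mu> / 2) / k n"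
    proof (rule always_eventually, rule allI)
      fix n
      have "\<delta> n / 2 / k n \<le> \<mu> / 2 / k n" using \<delta>le[of n] k(1)[of n] by (intro divide_right_mono) auto
      then show "norm (\<delta> n / (2 * k n)) \<le> (\<mu> / 2) / k n" using \<delta>0[of n] k(1)[of n] by simp
    qed
    show "(\<lambda>n. (\<mu> / 2) / k n) \<longlonglongrightarrow> 0" by (rule kinv)
  qed
  then have "(\<lambda>n. \<eta> - \<delta> n / (2 * k n)) \<longlonglongrightarrow> \<eta> - 0" by (intro tendsto_intros)
  moreover have "\<eta> - \<delta> n / (2 * k n) = (\<delta> n)\<^sup>2" for n using \<delta>eq[of n] by linarith
  ultimately have "(\<lambda>n. (\<delta> n)\<^sup>2) \<longlonglongrightarrow> \<eta>" by simp
  moreover have "sqrt ((\<delta> n)\<^sup>2) = \<delta> n" for n using \<delta>0[of n] by simp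
  ultimately have \<delta>lim: "\<delta> \<longlonglongrightarrow> \<mu>"
    using tendsto_real_sqrt[of "\<lambda>n. (\<delta> n)\<^sup>2" \<eta> sequentially] by (simp only: \<mu>_def)
  define r where "r n = \<bar>\<delta> n - \<mu>\<bar> + (S\<^sup>2 / 2) / k n" for n
  have "(\<lambda>n. \<bar>\<delta> n - \<mu>\<bar>) \<longlonglongrightarrow> \<bar>\<mu> - \<mu>\<bar>" by (intro tendsto_intros \<delta>lim)
  from tendsto_add[OF this kinv[of "S\<^sup>2 / 2"]] have rlim: "r \<longlonglongrightarrow> 0" by (simp add: r_def[abs_def])
  have "(\<lambda>n. r n * (2 * (\<mu> + S) + r n) + (\<eta> * S) / k n) \<longlonglongrightarrow> 0 * (2 * (\<mu> + S) + 0) + 0"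
    by (intro tendsto_intros rlim kinv)
  then have ev: "\<forall>\<^sub>F n in sequentially. r n * (2 * (\<mu> + S) + r n) + (\<eta> * S) / k n < \<epsilon>"
    using \<epsilon> by (intro order_tendstoD(2)[of _ 0]) auto
  show ?thesis
  proof (rule eventually_mono[OF ev], rule ballI)
    fix n s assume small: "r n * (2 * (\<mu> + S) + r n) + (\<eta> * S) / k n < \<epsilon>" and s: "s \<in> {0..S}"
    define y where "y = s / k n"
    have y: "y \<ge> 0" "y \<le> S / k n" "k n * y = s"
      using s k(1)[of n] by (auto simp: y_def divide_right_mono)
    have e1: "1 - exp (- y) \<le> y" using exp_ge_add_one_self[of "- y"] by simp
    have e2: "y - y\<^sup>2 / 2 \<le> 1 - exp (- y)"
    proof -
      have "1 + y + y\<^sup>2 / 2 \<le> exp y" using y(1) exp_lower_Taylor_quadratic by blast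
      then have "exp (- y) \<le> 1 / (1 + y + y\<^sup>2 / 2)"
        using y(1) by (simp add: exp_minus inverse_eq_divide) (intro divide_left_mono, auto intro!: mult_pos_pos add_pos_nonneg)
      also have "\<dots> \<le> 1 - y + y\<^sup>2 / 2"
      proof -
        have "(1 - y + y\<^sup>2 / 2) * (1 + y + y\<^sup>2 / 2) = 1 + (y\<^sup>2)\<^sup>2 / 4"
          by (simp add: algebra_simps power2_eq_square)
        then have "1 \<le> (1 - y + y\<^sup>2 / 2) * (1 + y + y\<^sup>2 / 2)" by simp
        moreover have "1 + y + y\<^sup>2 / 2 > 0" using y(1) by (simp add: add_pos_nonneg)
        ultimately show ?thesis by (simp add: pos_divide_le_eq)
      qed
      finally show ?thesis by simp
    qed
    define A where "A = \<delta> n - k n * (1 - exp (- y))"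
    have Ar: "\<bar>A - (\<mu> - s)\<bar> \<le> r n"
    proof -
      have "k n * (1 - exp (- y)) \<le> s" using mult_left_mono[OF e1, of "k n"] k(1)[of n] y(3) by simp
      moreover have "s - S\<^sup>2 / 2 / k n \<le> k n * (1 - exp (- y))"
      proof -
        have "k n * y\<^sup>2 = s\<^sup>2 / k n" using k(1)[of n] by (simp add: y_def power2_eq_square)
        also have "\<dots> \<le> S\<^sup>2 / k n" using s k(1)[of n] by (intro divide_right_mono power_mono) auto
        finally have "k n * (y\<^sup>2 / 2) \<le> S\<^sup>2 / 2 / k n" by simp
        moreover have "k n * (y - y\<^sup>2 / 2) \<le> k n * (1 - exp (- y))"
          using e2 k(1)[of n] by (intro mult_left_mono) auto
        ultimately show ?thesis using y(3) by (simp add: right_diff_distrib)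
      qed
      ultimately show ?thesis unfolding A_def r_def by linarith
    qed
    have pot: "rescaled_potential \<eta> (Suc n) (Z n) s = A\<^sup>2 - \<eta> * exp (- y)"
    proof -
      have "Z n * exp (- y) - real (Suc n) = 2 * k n * A"
      proof -
        have "2 * k n * A = 2 * k n * \<delta> n - 2 * (k n * k n) * (1 - exp (- y))" by (simp add: A_def algebra_simps)
        also have "2 * k n * \<delta> n = Z n - real (Suc n)" using k(1)[of n] by (simp add: \<delta>_def)
        also have "2 * (k n * k n) = Z n" using k(2)[of n] by simp
        finally show ?thesis by (simp add: algebra_simps)
      qed
      then have "rescaled_potential \<eta> (Suc n) (Z n) s = ((2 * k n * A)\<^sup>2 - 2 * \<eta> * (Z n * exp (- y))) / (2 * Z n)"
        by (simp only: rescaled_potential_def k_def[symmetric] y_def[symmetric])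
      also have "(2 * k n * A)\<^sup>2 = 4 * (k n * k n) * A\<^sup>2" by (simp add: power2_eq_square)
      also have "4 * (k n * k n) = 2 * Z n" using k(2)[of n] by simp
      also have "(2 * Z n * A\<^sup>2 - 2 * \<eta> * (Z n * exp (- y))) / (2 * Z n) = A\<^sup>2 - \<eta> * exp (- y)"
        using Zp[of n] by (simp add: field_simps)
      finally show ?thesis .
    qed
    have "\<bar>A\<^sup>2 - (\<mu> - s)\<^sup>2\<bar> \<le> r n * (2 * (\<mu> + S) + r n)"
    proof -
      have "A\<^sup>2 - (\<mu> - s)\<^sup>2 = (A - (\<mu> - s)) * (A + (\<mu> - s))" by (simp add: power2_eq_square algebra_simps)
      moreover have "\<bar>A + (\<mu> - s)\<bar> \<le> 2 * (\<mu> + S) + r n" using Ar s \<mu>(1) by auto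
      ultimately show ?thesis using Ar by (simp add: abs_mult mult_mono)
    qed
    moreover have "\<bar>\<eta> * exp (- y) - \<eta>\<bar> \<le> \<eta> * S / k n"
    proof -
      have "\<eta> * (1 - exp (- y)) \<le> \<eta> * (S / k n)" using e1 y(2) \<eta> by (intro mult_left_mono) auto
      moreover have "\<eta> * (1 - exp (- y)) \<ge> 0" using \<eta> y(1) by simp
      ultimately show ?thesis by (simp add: right_diff_distrib)
    qed
    moreover have "(\<mu> - s)\<^sup>2 = (s - \<mu>)\<^sup>2" by (rule power2_commute)
    ultimately show "\<bar>rescaled_potential \<eta> (Suc n) (res_point \<eta> n) s - ((s - sqrt \<eta>)\<^sup>2 - \<eta>)\<bar> < \<epsilon>"
      using small unfolding Z_def[symmetric] \<mu>_def[symmetric] pot by linarith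
  qed
qed

lemma half_sol_slope_at_zero:
  assumes "S > 0" "half_sol \<xi> \<nu> S = 0" "\<And>t. 0 \<le> t \<Longrightarrow> t < S \<Longrightarrow> half_sol \<xi> \<nu> t > 0"
  shows "half_sol' \<xi> \<nu> S \<le> 0"
proof (rule ccontr)
  assume "\<not> half_sol' \<xi> \<nu> S \<le> 0"
  then obtain d where d: "d > 0" "\<And>h. h > 0 \<Longrightarrow> h < d \<Longrightarrow> half_sol \<xi> \<nu> (S - h) < half_sol \<xi> \<nu> S"
    using DERIV_pos_inc_left[OF half_sol_deriv, of \<xi> \<nu> S] by (auto simp: not_le)
  let ?h = "min d S / 2"
  have "half_sol \<xi> \<nu> (S - ?h) < 0" using d(2)[of ?h] d(1) assms(1,2) by auto
  moreover have "half_sol \<xi> \<nu> (S - ?h) > 0" using d(1) assms(1) by (intro assms(3)) (auto simp: min_def)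
  ultimately show False by simp
qed

text \<open>
  As long as the potential is nonnegative the solution grows from its initial value 1.
\<close>

lemma half_sol_nondecreasing_start:
  assumes "\<And>t. 0 \<le> t \<Longrightarrow> t \<le> a \<Longrightarrow> \<nu> \<le> (t - \<xi>)\<^sup>2" "a \<ge> 0"
    and "S > 0" "half_sol \<xi> \<nu> S = 0" and pos: "\<And>t. 0 \<le> t \<Longrightarrow> t < S \<Longrightarrow> half_sol \<xi> \<nu> t > 0"
  shows "a < S" "half_sol' \<xi> \<nu> a \<ge> 0"
proof -
  have slope: "half_sol' \<xi> \<nu> s \<ge> 0" if s: "0 \<le> s" "s \<le> a" "s \<le> S" for s
  proof -
    have "half_sol' \<xi> \<nu> 0 \<le> half_sol' \<xi> \<nu> s"
    proof (rule DERIV_nonneg_imp_nondecreasing[OF s(1)])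
      fix x assume x: "0 \<le> x" "x \<le> s"
      have "half_sol \<xi> \<nu> x \<ge> 0"
        using pos[OF x(1)] assms(4) x(2) s(3) by (cases "x = S") auto
      then have "((x - \<xi>)\<^sup>2 - \<nu>) * half_sol \<xi> \<nu> x \<ge> 0"
        using assms(1)[of x] x s by (intro mult_nonneg_nonneg) auto
      then show "\<exists>y. (half_sol' \<xi> \<nu> has_real_derivative y) (at x) \<and> 0 \<le> y"
        using half_sol'_deriv by blast
    qed
    then show ?thesis by simp
  qed
  show less: "a < S"
  proof (rule ccontr)
    assume "\<not> a < S"
    then have "S \<le> a" by simp
    have "half_sol \<xi> \<nu> 0 \<le> half_sol \<xi> \<nu> S"
    proof (rule DERIV_nonneg_imp_nondecreasing[of 0 S "half_sol \<xi> \<nu>"])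
      fix x assume "0 \<le> x" "x \<le> S"
      then have "half_sol' \<xi> \<nu> x \<ge> 0" using \<open>S \<le> a\<close> by (intro slope) auto
      then show "\<exists>y. (half_sol \<xi> \<nu> has_real_derivative y) (at x) \<and> 0 \<le> y"
        using half_sol_deriv by blast
    qed (use assms(3) in simp)
    then show False using assms(4) by simp
  qed
  then show "half_sol' \<xi> \<nu> a \<ge> 0" using slope assms(2) by simp
qed

text \<open>
  Let \<open>U\<close> be a Neumann solution on some half-line that has a zero at an energy \<open>\<nu> < \<eta>\<close>, placed so
  that its potential is \<open>(s - \<surd>\<eta>)\<^sup>2 - \<nu>\<close>. For large \<open>n\<close> this exceeds the rescaled radial potential, and
  \<open>U' - y U\<close>, with \<open>y\<close> the rescaled slope, cannot return to zero once nonnegative; but at the first zero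
  of \<open>U\<close> it is at most zero. It starts nonnegative at the boundary \<open>s = 0\<close> if \<open>\<xi> \<ge> \<surd>\<eta>\<close>, because
  \<open>U\<close> is still nondecreasing there. If \<open>\<xi> < \<surd>\<eta>\<close>, the comparison starts at \<open>s = \<surd>\<eta> - \<xi>\<close>, where
  \<open>U' = 0\<close>; up to that point the radial potential is negative, so \<open>y\<close> has decreased from \<open>y 0 \<le> 0\<close>.
\<close>

lemma no_subcritical_energy_above_Theta0:
  assumes \<eta>: "0 < \<eta>" "\<eta> < 1" "Theta0 < \<eta>"
    and slope: "\<And>n. n \<ge> m \<Longrightarrow> fiber_slope \<eta> (Suc n) (res_point \<eta> n) \<ge> 0"
  shows False
proof -
  obtain \<xi> \<nu> S where \<nu>: "\<nu> < \<eta>" "\<nu> \<ge> 0" "\<xi> \<le> 0 \<Longrightarrow> \<xi>\<^sup>2 < \<nu>" and S: "S > 0" "half_sol \<xi> \<nu> S = 0"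
    "\<And>t. 0 \<le> t \<Longrightarrow> t < S \<Longrightarrow> half_sol \<xi> \<nu> t > 0"
    by (rule half_sol_zero_above_Theta0[OF \<eta>(3)]) blast
  define \<mu> where "\<mu> = sqrt \<eta>"
  have \<mu>: "\<mu> > 0" "\<mu>\<^sup>2 = \<eta>" using \<eta>(1) by (simp_all add: \<mu>_def)
  define b where "b = S + \<bar>\<mu> - \<xi>\<bar> + 1"
  have b: "b > 0" "S + \<mu> - \<xi> \<le> b" using S(1) by (auto simp: b_def)
  define \<epsilon> where "\<epsilon> = (if \<xi> < \<mu> then min (\<eta> - \<nu>) (\<eta> - \<xi>\<^sup>2) else \<eta> - \<nu>)"
  have \<xi>2: "\<xi>\<^sup>2 < \<eta>" if "\<xi> < \<mu>"
  proof (cases "\<xi> \<le> 0")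
    case True
    then show ?thesis using \<nu> by linarith
  next
    case False
    then have "\<xi>\<^sup>2 < \<mu>\<^sup>2" using that by (intro power_strict_mono) auto
    then show ?thesis using \<mu>(2) by simp
  qed
  have \<epsilon>: "\<epsilon> > 0" "\<epsilon> \<le> \<eta> - \<nu>" using \<nu>(1) \<xi>2 by (auto simp: \<epsilon>_def)
  have "\<forall>\<^sub>F n in sequentially. n \<ge> m \<and> (\<forall>s\<in>{0..b}.
    \<bar>rescaled_potential \<eta> (Suc n) (res_point \<eta> n) s - ((s - \<mu>)\<^sup>2 - \<eta>)\<bar> < \<epsilon>)"
    unfolding \<mu>_def by (intro eventually_conj eventually_ge_at_top rescaled_potential_limit \<eta>(1) b(1) \<epsilon>(1))
  then obtain n where n: "n \<ge> m" and close: "\<And>s. s \<in> {0..b} \<Longrightarrow>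
    \<bar>rescaled_potential \<eta> (Suc n) (res_point \<eta> n) s - ((s - \<mu>)\<^sup>2 - \<eta>)\<bar> < \<epsilon>"
    unfolding eventually_sequentially by blast
  define Z where "Z = res_point \<eta> n"
  have Zn: "Z > real n + 1" and Zroot: "(Z - real n) * (Z - real n - 1) = 2 * \<eta> * Z"
    using res_point_root[OF \<eta>(1), of n] by (simp_all add: Z_def)
  have Z: "Z > 0" using Zn by linarith
  let ?V = "rescaled_potential \<eta> (Suc n) Z" and ?y = "rescaled_slope \<eta> (Suc n) Z"
  have dy: "(?y has_real_derivative ?V s - (?y s)\<^sup>2) (at s)" for s
    using \<eta>(2) Z by (intro rescaled_slope_riccati) auto
  have y0: "?y 0 \<le> 0"
    using slope[OF n] Z by (simp add: rescaled_slope_def Z_def[symmetric])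
  have Vle: "?V s < (s - \<mu>)\<^sup>2 - \<nu>" if "s \<in> {0..b}" for s
    using close[OF that] \<epsilon>(2) unfolding Z_def[symmetric] by linarith
  let ?c = "half_sol \<xi> \<nu>" and ?c' = "half_sol' \<xi> \<nu>"
  define U U' where "U s = ?c (s - \<mu> + \<xi>)" and "U' s = ?c' (s - \<mu> + \<xi>)" for s
  have dU: "(U has_real_derivative U' s) (at s)" for s
    unfolding U_def[abs_def] U'_def
    by (rule DERIV_chain2[OF half_sol_deriv, THEN DERIV_cong]) (auto intro!: derivative_eq_intros)
  have dU': "(U' has_real_derivative ((s - \<mu>)\<^sup>2 - \<nu>) * U s) (at s)" for s
    unfolding U_def U'_def[abs_def]
    by (rule DERIV_chain2[OF half_sol'_deriv, THEN DERIV_cong]) (auto intro!: derivative_eq_intros)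
  define s1 where "s1 = S + \<mu> - \<xi>"
  have contra: False if s0: "0 \<le> s0" "\<mu> - \<xi> \<le> s0" "s0 < s1" and start: "U' s0 - ?y s0 * U s0 \<ge> 0" for s0
  proof -
    have "U' s1 - ?y s1 * U s1 > 0"
    proof (rule strict_gronwall_pos[OF s0(3), of "\<lambda>s. U' s - ?y s * U s" "\<lambda>s. - ?y s"
          "\<lambda>s. ((s - \<mu>)\<^sup>2 - \<nu>) * U s - ((?V s - (?y s)\<^sup>2) * U s + U' s * ?y s)"])
      show "continuous_on {s0..s1} (\<lambda>s. - ?y s)"
        by (intro continuous_intros continuous_at_imp_continuous_on ballI DERIV_isCont[OF dy])
      have d: "((\<lambda>s. U' s - ?y s * U s) has_real_derivative
          ((s - \<mu>)\<^sup>2 - \<nu>) * U s - ((?V s - (?y s)\<^sup>2) * U s + U' s * ?y s)) (at s)" for s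
        by (intro DERIV_diff DERIV_mult dU dU' dy)
      then show "continuous_on {s0..s1} (\<lambda>s. U' s - ?y s * U s)"
        by (intro continuous_at_imp_continuous_on ballI DERIV_isCont)
      fix s assume s: "s0 < s" "s < s1"
      show "((\<lambda>s. U' s - ?y s * U s) has_real_derivative
          ((s - \<mu>)\<^sup>2 - \<nu>) * U s - ((?V s - (?y s)\<^sup>2) * U s + U' s * ?y s)) (at s)" by (rule d)
      have "U s > 0" unfolding U_def using s s0 by (intro S(3)) (auto simp: s1_def)
      moreover have "?V s < (s - \<mu>)\<^sup>2 - \<nu>" using s s0 b by (intro Vle) (auto simp: s1_def)
      ultimately have "?V s * U s < ((s - \<mu>)\<^sup>2 - \<nu>) * U s" by simp
      then show "- ?y s * (U' s - ?y s * U s) <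
          ((s - \<mu>)\<^sup>2 - \<nu>) * U s - ((?V s - (?y s)\<^sup>2) * U s + U' s * ?y s)"
        by (simp add: algebra_simps power2_eq_square)
    qed (rule start)
    moreover have "U s1 = 0" "U' s1 \<le> 0"
      using S(2) half_sol_slope_at_zero[OF S] by (simp_all add: U_def U'_def s1_def)
    ultimately show False by simp
  qed
  show False
  proof (cases "\<xi> < \<mu>")
    case False
    have "a < S \<and> ?c' a \<ge> 0" if a: "a = \<xi> - \<mu>" for a
    proof -
      have "\<nu> \<le> (t - \<xi>)\<^sup>2" if "0 \<le> t" "t \<le> a" for t
      proof -
        have "\<mu>\<^sup>2 \<le> (\<xi> - t)\<^sup>2" using that a \<mu>(1) by (intro power_mono) auto
        then show ?thesis using \<mu>(2) \<nu>(1) by (simp add: power2_commute)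
      qed
      then show ?thesis using half_sol_nondecreasing_start[of a \<nu> \<xi> S] a False S by auto
    qed
    then have a: "\<xi> - \<mu> < S" "?c' (\<xi> - \<mu>) \<ge> 0" by auto
    have "U 0 > 0" unfolding U_def using a(1) False by (intro S(3)) auto
    then have "?y 0 * U 0 \<le> 0" using y0 by (simp add: mult_nonpos_nonneg)
    moreover have "U' 0 \<ge> 0" using a(2) by (simp add: U'_def)
    ultimately show False using False a(1) by (intro contra[of 0]) (auto simp: s1_def)
  next
    case True
    define a where "a = \<mu> - \<xi>"
    have a: "a > 0" "a \<le> b" using True S(1) by (auto simp: a_def b_def)
    \<comment> \<open>The numerator of the potential is a convex quadratic in \<open>z\<close>, so it suffices that it is negative
      at both ends.\<close>
    define z where "z s = Z * exp (- (s / sqrt (Z / 2)))" for s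
    define P where "P x = (x - real (Suc n))\<^sup>2 - 2 * \<eta> * x" for x
    have VP: "?V s = P (z s) / (2 * Z)" for s
      by (simp add: rescaled_potential_def P_def z_def)
    have "?V a < (a - \<mu>)\<^sup>2 - \<eta> + \<epsilon>" using close[of a] a unfolding Z_def[symmetric] by auto
    moreover have "(a - \<mu>)\<^sup>2 = \<xi>\<^sup>2" by (simp add: a_def)
    moreover have "\<epsilon> \<le> \<eta> - \<xi>\<^sup>2" using True by (simp add: \<epsilon>_def)
    ultimately have "?V a < 0" by linarith
    then have Pa: "P (z a) < 0" using Z by (simp add: VP divide_less_0_iff)
    have "P Z = - (Z - real (Suc n))" using Zroot by (simp add: P_def algebra_simps power2_eq_square)
    then have PZ: "P Z < 0" using Zn by simp
    have Vneg: "?V s < 0" if s: "0 \<le> s" "s \<le> a" for s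
    proof -
      have z: "z a \<le> z s" "z s \<le> Z"
        using s Z by (auto simp: z_def divide_right_mono mult_left_le)
      have za: "z a < Z" using a(1) Z by (simp add: z_def)
      have "P (z s) * (Z - z a) = P (z a) * (Z - z s) + P Z * (z s - z a) + (z s - z a) * (z s - Z) * (Z - z a)"
        by (simp add: P_def algebra_simps power2_eq_square)
      moreover have "P (z a) * (Z - z s) + P Z * (z s - z a) < 0"
      proof (cases "z s = Z")
        case True
        then show ?thesis using PZ za by (simp add: mult_neg_pos)
      next
        case False
        then have "P (z a) * (Z - z s) < 0" using Pa z by (intro mult_neg_pos) auto
        moreover have "P Z * (z s - z a) \<le> 0" using PZ z by (intro mult_nonpos_nonneg) auto
        ultimately show ?thesis by simp
      qed
      moreover have "(z s - z a) * (z s - Z) * (Z - z a) \<le> 0"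
        using z za by (intro mult_nonpos_nonneg mult_nonneg_nonpos) auto
      ultimately have "P (z s) * (Z - z a) < 0" by linarith
      then have "P (z s) < 0" using za by (simp add: mult_less_0_iff)
      then show ?thesis using Z by (simp add: VP divide_less_0_iff)
    qed
    have "?y a \<le> ?y 0"
    proof (rule DERIV_nonpos_imp_nonincreasing[of 0 a ?y])
      fix s assume s: "0 \<le> s" "s \<le> a"
      have "?V s - (?y s)\<^sup>2 \<le> 0" using Vneg[OF s] zero_le_power2[of "?y s"] by linarith
      then show "\<exists>d. (?y has_real_derivative d) (at s) \<and> d \<le> 0" using dy by blast
    qed (use a in simp)
    then have "?y a \<le> 0" using y0 by simp
    moreover have "U a = 1" "U' a = 0" by (simp_all add: U_def U'_def a_def)
    ultimately show False using a S(1) by (intro contra[of a]) (auto simp: s1_def a_def)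
  qed
qed

text \<open>
  Passing to the next crossing energy, which is larger, turns \<open>\<eta> \<ge> \<Theta>\<^sub>0\<close> into a strict inequality.
\<close>

theorem crossing_energy_below_Theta0:
  assumes cs: "crossing_sequence \<beta>" and \<eta>: "0 < \<eta>" "\<eta> < 1"
    and zero: "fiber_slope \<eta> n (res_point \<eta> n) = 0"
  shows "\<eta> < Theta0"
proof (rule ccontr)
  assume "\<not> \<eta> < Theta0"
  obtain \<eta>' where \<eta>': "0 < \<eta>'" "\<eta>' < 1" "\<beta> (Suc n) = 2 * res_point \<eta>' (Suc n)"
    "fiber_slope \<eta>' (Suc n) (res_point \<eta>' (Suc n)) = 0"
    by (rule crossing_energy[OF cs, of "Suc n"]) blast
  have "fiber_slope \<eta> (Suc n) (res_point \<eta> (Suc n)) > 0"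
    using zero by (intro slope_at_res_point_Suc(2)[OF \<eta>]) simp
  then have "\<eta> < \<eta>'" by (rule crossing_energy_increasing[OF cs \<eta> _ \<eta>'(1-3)])
  then have "Theta0 < \<eta>'" using \<open>\<not> \<eta> < Theta0\<close> by simp
  moreover have "fiber_slope \<eta>' (Suc k) (res_point \<eta>' k) \<ge> 0" if "k \<ge> Suc n" for k
    using slope_at_res_point_later[OF \<eta>'(1,2), of "Suc n" "k - Suc n"] \<eta>'(4) that
    by (intro slope_at_res_point_Suc(1)[OF \<eta>'(1,2)]) simp
  ultimately show False by (rule no_subcritical_energy_above_Theta0[OF \<eta>'(1,2)])
qed

theorem corollary1p8:
  fixes \<beta> :: "nat \<Rightarrow> real" and \<eta> :: real
  assumes "crossing_sequence \<beta>"
    and "\<eta> = disc_lambda (\<beta> 0) / \<beta> 0"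
  shows "(\<forall>n. \<beta> n < (2 * real n + 1) + 2 * Theta0
              + sqrt (4 * Theta0 * (2 * real n + 1) + 4 * Theta0\<^sup>2 + 1)) \<and>
         (\<forall>n\<ge>1. \<beta> n > (2 * real n + 1) + 2 * \<eta>
              + sqrt (4 * \<eta> * (2 * real n + 1) + 4 * \<eta>\<^sup>2 + 1))"
proof (intro conjI allI impI)
  fix n
  obtain e where e: "0 < e" "e < 1" "\<beta> n = 2 * res_point e n" "fiber_slope e n (res_point e n) = 0"
    by (rule crossing_energy[OF assms(1), of n]) blast
  have "e < Theta0" by (rule crossing_energy_below_Theta0[OF assms(1) e(1,2,4)])
  then have "\<beta> n < 2 * res_point Theta0 n" using res_point_strict_mono[OF e(1)] e(3) by simp
  then show "\<beta> n < (2 * real n + 1) + 2 * Theta0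
      + sqrt (4 * Theta0 * (2 * real n + 1) + 4 * Theta0\<^sup>2 + 1)" unfolding double_res_point .
next
  fix n :: nat assume n: "n \<ge> 1"
  obtain e0 where e0: "0 < e0" "e0 < 1" "\<beta> 0 = 2 * res_point e0 0" "fiber_lambda 0 (\<beta> 0) = \<beta> 0 * e0"
    "fiber_slope e0 0 (res_point e0 0) = 0"
    by (rule crossing_energy[OF assms(1), of 0]) blast
  have b0: "\<beta> 0 > 0" using res_point_root(2)[OF e0(1), of 0] e0(3) by simp
  have "disc_lambda (\<beta> 0) = fiber_lambda 0 (\<beta> 0)"
    using assms(1) b0 unfolding crossing_sequence_def by (meson less_imp_le order_refl)
  then have \<eta>: "\<eta> = e0" using assms(2) e0(4) b0 by simp
  obtain e where e: "0 < e" "e < 1" "\<beta> n = 2 * res_point e n"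
    by (rule crossing_energy[OF assms(1), of n]) blast
  have "fiber_slope e0 (n - 1) (res_point e0 (n - 1)) \<ge> 0"
    using slope_at_res_point_later[OF e0(1,2), of 0 "n - 1"] e0(5) by simp
  from slope_at_res_point_Suc(2)[OF e0(1,2) this] n
  have "fiber_slope e0 n (res_point e0 n) > 0" by simp
  then have "e0 < e" by (rule crossing_energy_increasing[OF assms(1) e0(1,2) _ e])
  then have "2 * res_point \<eta> n < \<beta> n" using res_point_strict_mono[OF e0(1)] e(3) \<eta> by simp
  then show "\<beta> n > (2 * real n + 1) + 2 * \<eta>
      + sqrt (4 * \<eta> * (2 * real n + 1) + 4 * \<eta>\<^sup>2 + 1)" unfolding double_res_point .
qed

end
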